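(* Let $\mathbf a_1,\mathbf a_2$ be two coefficient vectors taking values in $\mathbf D$. For $i=1,2$ let $(\mathbf m_h^{(i)},\bar\rho_h^{(i)}):I\to V_h\times Q_h$ be the solution of the semidiscrete problem $$(F(\mathbf a_i,|\mathbf m_h^{(i)}|)\mathbf m_h^{(i)},\mathbf v)-(\bar\rho_h^{(i)},\nabla\cdot\mathbf v)=-(\nabla\Psi,\mathbf v)\ \ \forall\mathbf v\in V_h,\qquad (\phi\bar\rho_{ht}^{(i)},q)+(\nabla\cdot\mathbf m_h^{(i)},q)=(f,q)-(\phi\Psi_t,q)\ \ \forall q\in Q_h,$$ with $\bar\rho_h^{(i)}(0)=\pi(\rho_0-\Psi(\cdot,0))$, and let $(\mathbf m^{(i)},\bar\rho^{(i)}):I\to V\times Q$ be the solution of the corresponding weak problem $$(F(\mathbf a_i,|\mathbf m^{(i)}|)\mathbf m^{(i)},\mathbf v)-(\bar\rho^{(i)},\nabla\cdot\mathbf v)=-(\nabla\Psi,\mathbf v)\ \ \forall\mathbf v\in V,\qquad (\phi\bar\rho_t^{(i)},q)+(\nabla\cdot\mathbf m^{(i)},q)=(f,q)-(\phi\Psi_t,q)\ \ \forall q\in Q,$$ with $\bar\rho^{(i)}(\cdot,0)=\rho_0-\Psi(\cdot,0)$; write $\rho^{(i)}=\bar\rho^{(i)}+\Psi$. Suppose that $(\mathbf m^{(i)},\bar\rho^{(i)})\in V\times Q$ and $\rho_t^{(i)}\in L^2(I,L^2(\Omega))$, $i=1,2$. Then there exists a positive constant $C$ independent of $h$ and of $\|\mathbf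 a_1-\mathbf a_2\|_{L^\infty(I,L^\infty(\Omega))}$ such that $$\|\bar\rho_h^{(1)}-\bar\rho_h^{(2)}\|_{L^\infty(I,L^2(\Omega))}^2+\|\mathbf m_h^{(1)}-\mathbf m_h^{(2)}\|_{L^s(I,L^s(\Omega))}^s\le C\Big(h^{s^*(1-\alpha)}+\|\mathbf a_1-\mathbf a_2\|_{L^\infty(I,L^\infty(\Omega))}^{s^*}\Big).$$
   Context: $\Omega\subset\mathbb R^d$ ($d\ge2$) is open, bounded, with $C^1$ boundary; $T>0$, $I=[0,T]$; $(\cdot,\cdot)$ is the integral pairing over $\Omega$ of scalar or vector functions; subscript $t$ denotes time derivative. Solutions are assumed to have enough regularity in $\mathbf x$ and $t$ for the expressions to make sense. Fix $N\ge1$ and real exponents $\alpha_{-1}=-\alpha<\alpha_0=0<\alpha_1<\dots<\alpha_N$ with $\alpha\in(0,1)$; put $s=\alpha_N+2$, $s^*=s/(s-1)$. For a vector of coefficient functions $\mathbf a=(a_{-1},a_0,\dots,a_N)$ on $\Omega\times I$, $F(\mathbf a,z)=\sum_{i=-1}^N a_i(\mathbf x,t)z^{\alpha_i}$, and $F(\mathbf a,|\mathbf m|)\mathbf m$ is understood as $0$ where $\mathbf m=0$. $\mathbf D$ is a compact subset of $\{(a_{-1},a_0,\dots,a_N):0<a_*\le a_{-1},a_0,a_N\le a^*,\ 0\le a_1,\dots,a_{N-1}\le a^*\}$, with $0<a_*\le a^*<\infty$ fixed. Coefficients are assumed to lie in $W^{1,\infty}(I,L^\infty(\Omega))$ with $|\partial_ta_i|<b^*<\infty$.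 Data (the same for $i=1,2$): $0<\phi_*\le\phi(\mathbf x)\le\phi^*<\infty$; $f\in L^\infty(I,L^2(\Omega))$; $\psi\in C^{1,2}_{\mathbf x,t}(\bar\Omega\times I)$; $\Psi$ is an extension of the boundary datum $\psi$ from $\partial\Omega\times I$ to $\bar\Omega\times I$; $\rho_0$ is the initial density. Spaces: $Q=L^2(\Omega)$; $V=\{\mathbf v\in(L^s(\Omega))^d:\nabla\cdot\mathbf v\in L^2(\Omega)\}$ with norm $\|\mathbf v\|_{L^s}+\|\nabla\cdot\mathbf v\|_{L^2}$. $\{\mathcal T_h\}_h$ is a family of globally quasi-uniform triangulations of $\Omega$ with $\max_{\tau\in\mathcal T_h}\operatorname{diam}\tau\le h$; for an integer $k\ge0$, $Q_h=\{\rho_h\in C^0(\overline\Omega):\rho_h|_\tau\in P_k(\tau)\ \forall\tau\}$, $V_h=\{\mathbf m_h\in C^0(\overline\Omega)^d:\mathbf m_h|_\tau\in P_k(\tau)\ \forall\tau\}$ (componentwise), $P_k(\tau)$ being the polynomials of degree at most $k$. Projections, with the properties used throughout the paper: $\Pi:V\to V_h$ (Raviart–Thomas projection) satisfies $(\nabla\cdot(\Pi\mathbf m-\mathbf m),q)=0$ for all $q\in Q_h$; $\pi:Q\to Q_h$ ($L^2$-projection) satisfies $(\pi\rho-\rho,q)=0$ for $q\in Q_h$ and $(\pi\rho-\rho,\nabla\cdot\mathbf m_h)=0$ for $\mathbf m_h\in V_h$; $\operatorname{div}\circ\Pi=\pi\circ\operatorname{div}$; $\|\Pi\mathbf m\|_{L^q}\le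 C(\|\mathbf m\|_{L^p}+h\|\nabla\cdot\mathbf m\|_{L^2})$ for $\mathbf m\in V\cap(W^{1,q})^d$; $\|\Pi\mathbf m-\mathbf m\|_{L^q}\le Ch^p\|\mathbf m\|_{W^{p,q}}$ for $1/q<p\le k+1$; $\|\nabla\cdot(\Pi\mathbf m-\mathbf m)\|_{L^2}\le Ch^p\|\nabla\cdot\mathbf m\|_{W^{p,2}}$ for $0\le p\le k+1$; $\|\pi\rho\|_{L^2}\le C\|\rho\|_{L^2}$; $\|\pi\rho-\rho\|_{L^q}\le Ch^p\|\rho\|_{W^{p,q}}$ for $0\le p\le k+1$, $q\in[1,\infty]$. *)

theory Defs
  imports "HOL-Analysis.Analysis" "HOL-Probability.Essential_Supremum"
begin

section \<open>Lebesgue and Bochner norms\<close>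

text \<open>Norms take values in \<^typ>\<open>ennreal\<close>, so a function outside the space has norm \<open>\<infinity>\<close>
  and no default value of a divergent integral is ever used. The exponents below are positive.\<close>

definition epow :: "ennreal \<Rightarrow> real \<Rightarrow> ennreal"
  where "epow x p = (if x = \<infinity> then \<infinity> else ennreal (enn2real x powr p))"

definition Lp_enorm :: "'c measure \<Rightarrow> real \<Rightarrow> ('c \<Rightarrow> ennreal) \<Rightarrow> ennreal"
  where "Lp_enorm M p g = epow (\<integral>\<^sup>+x. epow (g x) p \<partial>M) (1 / p)"

definition Lp_norm :: "'a::euclidean_space set \<Rightarrow> real \<Rightarrow> ('a \<Rightarrow> 'b::real_normed_vector) \<Rightarrow> ennreal"
  where "Lp_norm \<Omega> p u = Lp_enorm (lebesgue_on \<Omega>) p (\<lambda>x. ennreal (norm (u x)))"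

definition Linf_norm :: "'a::euclidean_space set \<Rightarrow> ('a \<Rightarrow> 'b::real_normed_vector) \<Rightarrow> ennreal"
  where "Linf_norm \<Omega> u = esssup (lebesgue_on \<Omega>) (\<lambda>x. ennreal (norm (u x)))"

definition Lp_space :: "'a::euclidean_space set \<Rightarrow> real \<Rightarrow> ('a \<Rightarrow> 'b::real_normed_vector) set"
  where "Lp_space \<Omega> p = {u \<in> borel_measurable (lebesgue_on \<Omega>). Lp_norm \<Omega> p u < \<infinity>}"

text \<open>Norms of \<open>L\<^sup>p(I, X)\<close> and \<open>L\<^sup>\<infinity>(I, X)\<close>, \<open>I = [0,T]\<close>, in terms of \<open>g t = \<parallel>u(t)\<parallel>\<^sub>X\<close>.\<close>

definition time_Lp :: "real \<Rightarrow> real \<Rightarrow> (real \<Rightarrow> ennreal) \<Rightarrow> ennreal"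
  where "time_Lp T p g = Lp_enorm (lebesgue_on {0..T}) p g"

definition time_Linf :: "real \<Rightarrow> (real \<Rightarrow> ennreal) \<Rightarrow> ennreal"
  where "time_Linf T g = esssup (lebesgue_on {0..T}) g"

definition spacetime_measurable ::
    "'a::euclidean_space set \<Rightarrow> real \<Rightarrow> (real \<Rightarrow> 'a \<Rightarrow> 'b::topological_space) \<Rightarrow> bool"
  where "spacetime_measurable \<Omega> T u \<longleftrightarrow>
    (\<lambda>(t, x). u t x) \<in> borel_measurable (lebesgue_on {0..T} \<Otimes>\<^sub>M lebesgue_on \<Omega>)"

definition pairing :: "'a::euclidean_space set \<Rightarrow> ('a \<Rightarrow> 'b::real_inner) \<Rightarrow> ('a \<Rightarrow> 'b) \<Rightarrow> real"
  where "pairing \<Omega> u v = (LINT x|lebesgue_on \<Omega>. u x \<bullet> v x)"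


section \<open>Derivatives\<close>

text \<open>\<open>u \<in> W\<^sup>1\<^sup>,\<^sup>1(I, L\<^sup>2(\<Omega>))\<close> up to \<open>u(0) \<in> L\<^sup>2(\<Omega>)\<close>, with time derivative \<open>u'\<close>: for every \<open>t\<close>,
  \<open>u(t) = u(0) + \<integral>\<^sub>0\<^sup>t u'(\<tau>) d\<tau>\<close> as elements of \<open>L\<^sup>2(\<Omega>)\<close>. Smoother classes are obtained by
  further conditions on \<open>u'\<close>.\<close>

definition has_time_derivative ::
    "'a::euclidean_space set \<Rightarrow> real \<Rightarrow> (real \<Rightarrow> 'a \<Rightarrow> real) \<Rightarrow> (real \<Rightarrow> 'a \<Rightarrow> real) \<Rightarrow> bool"
  where "has_time_derivative \<Omega> T u u' \<longleftrightarrow>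
    spacetime_measurable \<Omega> T u \<and> spacetime_measurable \<Omega> T u' \<and>
    time_Lp T 1 (\<lambda>t. Lp_norm \<Omega> 2 (u' t)) < \<infinity> \<and>
    (\<forall>t\<in>{0..T}. AE x in lebesgue_on \<Omega>. u t x = u 0 x + (LINT \<tau>|lebesgue_on {0..t}. u' \<tau> x))"

text \<open>Weak derivatives are tested with compactly supported \<open>C\<^sup>1\<close> functions \<open>\<eta>\<close>; \<open>G\<close> is the
  gradient of \<open>\<eta>\<close>.\<close>

definition has_L2_divergence ::
    "'a::euclidean_space set \<Rightarrow> ('a \<Rightarrow> 'a) \<Rightarrow> ('a \<Rightarrow> real) \<Rightarrow> bool"
  where "has_L2_divergence \<Omega> v d \<longleftrightarrow> d \<in> Lp_space \<Omega> 2 \<and>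
    (\<forall>\<eta> G. (\<forall>x. GDERIV \<eta> x :> G x) \<longrightarrow> continuous_on UNIV G \<longrightarrow>
       compact (closure {x. \<eta> x \<noteq> 0}) \<longrightarrow> closure {x. \<eta> x \<noteq> 0} \<subseteq> \<Omega> \<longrightarrow>
       pairing \<Omega> v G = - pairing \<Omega> d \<eta>)"

definition grad :: "('a::real_inner \<Rightarrow> real) \<Rightarrow> 'a \<Rightarrow> 'a"
  where "grad u x = (THE D. GDERIV u x :> D)"

definition time_deriv :: "real \<Rightarrow> (real \<Rightarrow> 'a \<Rightarrow> real) \<Rightarrow> real \<Rightarrow> 'a \<Rightarrow> real"
  where "time_deriv T u t x = vector_derivative (\<lambda>\<tau>. u \<tau> x) (at t within {0..T})"

text \<open>\<open>C\<^sup>1\<^sup>,\<^sup>2\<^sub>x\<^sub>,\<^sub>t\<close> on the closed cylinder: the derivatives, taken at points of \<open>\<Omega>\<close>, extend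
  continuously to the closure.\<close>

definition C12 :: "'a::euclidean_space set \<Rightarrow> real \<Rightarrow> (real \<Rightarrow> 'a \<Rightarrow> real) \<Rightarrow> bool"
  where "C12 \<Omega> T u \<longleftrightarrow>
    continuous_on ({0..T} \<times> closure \<Omega>) (\<lambda>(t, x). u t x) \<and>
    (\<exists>G u' u''.
       continuous_on ({0..T} \<times> closure \<Omega>) (\<lambda>(t, x). G t x) \<and>
       continuous_on ({0..T} \<times> closure \<Omega>) (\<lambda>(t, x). u' t x) \<and>
       continuous_on ({0..T} \<times> closure \<Omega>) (\<lambda>(t, x). u'' t x) \<and>
       (\<forall>t\<in>{0..T}. \<forall>x\<in>\<Omega>. GDERIV (u t) x :> G t x \<and>
          ((\<lambda>\<tau>. u \<tau> x) has_real_derivative u' t x) (at t within {0..T}) \<and>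
          ((\<lambda>\<tau>. u' \<tau> x) has_real_derivative u'' t x) (at t within {0..T})))"


section \<open>Domain and triangulations\<close>

text \<open>Near each boundary point, \<open>\<Omega>\<close> is the part of a ball lying above the graph of a \<open>C\<^sup>1\<close> function
  \<open>\<gamma>\<close> over the hyperplane orthogonal to a direction \<open>e\<close>.\<close>

definition C1_boundary :: "'a::euclidean_space set \<Rightarrow> bool"
  where "C1_boundary \<Omega> \<longleftrightarrow>
    (\<forall>p\<in>frontier \<Omega>. \<exists>r>0. \<exists>e \<gamma> G. norm e = 1 \<and>
       (\<forall>y. GDERIV \<gamma> y :> G y) \<and> continuous_on UNIV G \<and>
       \<Omega> \<inter> ball p r = {y \<in> ball p r. \<gamma> (y - (y \<bullet> e) *\<^sub>R e) < y \<bullet> e})"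

text \<open>A triangulation of \<open>closure \<Omega>\<close> is the homeomorphic image of a finite simplicial complex. Since
  a set with \<open>C\<^sup>1\<close> boundary is not a union of finitely many simplices, elements that meet the
  boundary may be curved; the elements inside \<open>\<Omega>\<close> are genuine simplices.\<close>

definition domain_triangulation :: "'a::euclidean_space set \<Rightarrow> 'a set set \<Rightarrow> bool"
  where "domain_triangulation \<Omega> \<T> \<longleftrightarrow>
    (\<exists>(K :: 'a set set) \<Phi> \<Phi>'. triangulation K \<and> (\<forall>S\<in>K. int DIM('a) simplex S) \<and>
       homeomorphism (\<Union>K) (closure \<Omega>) \<Phi> \<Phi>' \<and> \<T> = (\<lambda>S. \<Phi> ` S) ` K \<and>
       (\<forall>S\<in>K. \<Phi> ` S \<subseteq> \<Omega> \<longrightarrow> (\<exists>L b. linear L \<and> (\<forall>x\<in>S. \<Phi> x = L x + b))))"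

definition quasi_uniform_family :: "'a::euclidean_space set \<Rightarrow> real set \<Rightarrow> (real \<Rightarrow> 'a set set) \<Rightarrow> bool"
  where "quasi_uniform_family \<Omega> H \<T> \<longleftrightarrow> H \<subseteq> {0<..} \<and>
    (\<forall>h\<in>H. domain_triangulation \<Omega> (\<T> h)) \<and>
    (\<exists>\<sigma>>0. \<forall>h\<in>H. \<forall>\<tau>\<in>\<T> h. diameter \<tau> \<le> h \<and> (\<exists>c. cball c (\<sigma> * h) \<subseteq> \<tau>))"


section \<open>Function spaces\<close>

text \<open>Functions of total degree at most \<open>k\<close>, with scalar or vector coefficients \<open>c \<mu>\<close>.\<close>

definition polynomials :: "nat \<Rightarrow> ('a::euclidean_space \<Rightarrow> 'b::real_vector) set"
  where "polynomials k = {p. \<exists>c. \<forall>x. p x =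
    (\<Sum>\<mu> \<in> {\<mu> \<in> Basis \<rightarrow>\<^sub>E (UNIV :: nat set). (\<Sum>b\<in>Basis. \<mu> b) \<le> k}.
       (\<Prod>b\<in>Basis. (x \<bullet> b) ^ \<mu> b) *\<^sub>R c \<mu>)}"

text \<open>With \<open>'b = real\<close> this is \<open>Q\<^sub>h\<close>, with \<open>'b = 'a\<close> it is \<open>V\<^sub>h\<close>.\<close>

definition fe_space ::
    "'a::euclidean_space set \<Rightarrow> 'a set set \<Rightarrow> nat \<Rightarrow> ('a \<Rightarrow> 'b::real_normed_vector) set"
  where "fe_space \<Omega> \<T> k = {u. continuous_on (closure \<Omega>) u \<and>
    (\<forall>\<tau>\<in>\<T>. \<exists>p\<in>polynomials k. \<forall>x\<in>\<tau>. u x = p x)}"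

definition V_space :: "'a::euclidean_space set \<Rightarrow> real \<Rightarrow> ('a \<Rightarrow> 'a) set"
  where "V_space \<Omega> s = {v \<in> Lp_space \<Omega> s. \<exists>d. has_L2_divergence \<Omega> v d}"

definition is_L2_projection ::
    "'a::euclidean_space set \<Rightarrow> ('a \<Rightarrow> real) set \<Rightarrow> ('a \<Rightarrow> real) \<Rightarrow> ('a \<Rightarrow> real) \<Rightarrow> bool"
  where "is_L2_projection \<Omega> Q u p \<longleftrightarrow> p \<in> Q \<and> (\<forall>q\<in>Q. pairing \<Omega> (\<lambda>x. p x - u x) q = 0)"


section \<open>Coefficients and the mixed problem\<close>

text \<open>A coefficient vector \<open>(a\<^sub>-\<^sub>1, a\<^sub>0, \<dots>, a\<^sub>N)\<close> is a function on \<^typ>\<open>int\<close> vanishing outside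
  \<open>{-1..N}\<close>. These functions with the product topology form a copy of \<open>\<real>\<^sup>N\<^sup>+\<^sup>2\<close>.\<close>

definition coeff_box :: "nat \<Rightarrow> real \<Rightarrow> real \<Rightarrow> (int \<Rightarrow> real) set"
  where "coeff_box N lo hi = {c.
    (\<forall>i. i \<notin> {-1..int N} \<longrightarrow> c i = 0) \<and>
    (\<forall>i\<in>{-1, 0, int N}. lo \<le> c i \<and> c i \<le> hi) \<and>
    (\<forall>i\<in>{1..int N - 1}. 0 \<le> c i \<and> c i \<le> hi)}"

text \<open>Only \<open>F(a,|m|) m\<close> occurs below. It is \<open>0\<close> where \<open>m = 0\<close>, whatever the value of
  \<open>0 powr \<alpha> i\<close>.\<close>

definition forchheimer :: "nat \<Rightarrow> (int \<Rightarrow> real) \<Rightarrow> (int \<Rightarrow> real) \<Rightarrow> real \<Rightarrow> real"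
  where "forchheimer N \<alpha> c z = (\<Sum>i\<in>{-1..int N}. c i * z powr \<alpha> i)"

definition admissible_coeff ::
    "'a::euclidean_space set \<Rightarrow> real \<Rightarrow> nat \<Rightarrow> (int \<Rightarrow> real) set \<Rightarrow> real \<Rightarrow>
     (real \<Rightarrow> 'a \<Rightarrow> int \<Rightarrow> real) \<Rightarrow> bool"
  where "admissible_coeff \<Omega> T N D b a \<longleftrightarrow>
    (AE t in lebesgue_on {0..T}. AE x in lebesgue_on \<Omega>. a t x \<in> D) \<and>
    (\<forall>i\<in>{-1..int N}. \<exists>a'. has_time_derivative \<Omega> T (\<lambda>t x. a t x i) a' \<and>
       (AE t in lebesgue_on {0..T}. AE x in lebesgue_on \<Omega>. \<bar>a' t x\<bar> < b))"

definition coeff_dist ::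
    "'a::euclidean_space set \<Rightarrow> real \<Rightarrow> nat \<Rightarrow> (real \<Rightarrow> 'a \<Rightarrow> int \<Rightarrow> real) \<Rightarrow>
     (real \<Rightarrow> 'a \<Rightarrow> int \<Rightarrow> real) \<Rightarrow> ennreal"
  where "coeff_dist \<Omega> T N a a' =
    time_Linf T (\<lambda>t. Linf_norm \<Omega> (\<lambda>x. L2_set (\<lambda>i. a t x i - a' t x i) {-1..int N}))"

text \<open>The mixed problem in the pair of spaces \<open>V\<close>, \<open>Q\<close> (continuous or discrete). Since \<open>f\<close> is only
  \<open>L\<^sup>\<infinity>\<close> in time, the equations hold for almost every \<open>t\<close>. The functions \<open>dm\<close> and \<open>dv\<close> are
  the divergences of \<open>m t\<close> and \<open>v\<close>; they are unique almost everywhere, and every continuous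
  piecewise polynomial field has one, being Lipschitz on each line segment inside \<open>\<Omega>\<close>.\<close>

definition mixed_solution ::
    "'a::euclidean_space set \<Rightarrow> real \<Rightarrow> nat \<Rightarrow> (int \<Rightarrow> real) \<Rightarrow> ('a \<Rightarrow> real) \<Rightarrow>
     (real \<Rightarrow> 'a \<Rightarrow> real) \<Rightarrow> (real \<Rightarrow> 'a \<Rightarrow> real) \<Rightarrow> ('a \<Rightarrow> 'a) set \<Rightarrow> ('a \<Rightarrow> real) set \<Rightarrow>
     (real \<Rightarrow> 'a \<Rightarrow> int \<Rightarrow> real) \<Rightarrow> (real \<Rightarrow> 'a \<Rightarrow> 'a) \<Rightarrow> (real \<Rightarrow> 'a \<Rightarrow> real) \<Rightarrow> bool"
  where "mixed_solution \<Omega> T N \<alpha> \<phi> f \<Psi> V Q a m \<rho> \<longleftrightarrow>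
    spacetime_measurable \<Omega> T m \<and> (\<forall>t\<in>{0..T}. m t \<in> V \<and> \<rho> t \<in> Q) \<and>
    (\<exists>\<rho>'. has_time_derivative \<Omega> T \<rho> \<rho>' \<and>
      (AE t in lebesgue_on {0..T}.
        (\<forall>v\<in>V. \<forall>dv. has_L2_divergence \<Omega> v dv \<longrightarrow>
           pairing \<Omega> (\<lambda>x. forchheimer N \<alpha> (a t x) (norm (m t x)) *\<^sub>R m t x) v - pairing \<Omega> (\<rho> t) dv
             = - pairing \<Omega> (grad (\<Psi> t)) v) \<and>
        (\<exists>dm. has_L2_divergence \<Omega> (m t) dm \<and>
           (\<forall>q\<in>Q. pairing \<Omega> (\<lambda>x. \<phi> x * \<rho>' t x) q + pairing \<Omega> dm q
             = pairing \<Omega> (f t) q - pairing \<Omega> (\<lambda>x. \<phi> x * time_deriv T \<Psi> t x) q))))"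

end

(* Only the discrete problem enters. Subtract the two discrete systems and test with the differences
   of the discrete fluxes and densities: the pressure terms cancel, and phi-weighted L^2 energy plus the
   flux pairing remains. The top power z^(alpha_N) makes the flux strongly monotone of order s, which
   absorbs the perturbation (F(a_1,|m_2|) - F(a_2,|m_2|)) m_2 by Young's inequality up to
   |a_1 - a_2|^(s/(s-1)) (1 + |m_2|^s). The same energy argument applied to one discrete solution bounds
   the space-time integral of |m_2|^s independently of h, the two initial densities are equal as
   projections of the same function, and so the estimate holds even without the power of h. *)
theory Submission
  imports Defs
begin

section \<open>Monotonicity and stability of the flux\<close>

text \<open>The density is only known to be the time primitive of an L^1(I, L^2) function, as an
  identity in L^2 for each t whose exceptional set may vary with t. The product rule behind the
  energy argument cannot be had by differentiating; it comes from Fubini for an everywhere defined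
  primitive and is carried over to the density one time at a time. Discrete fluxes are bounded in
  space at each fixed time, which makes every spatial pairing finite, but their integrability in
  time is not given and has to come out of the energy inequality itself. In the bound for a single
  solution the source leaves a density norm on the right, which is absorbed through its supremum in
  time; in the difference of two solutions the sources cancel and only the coefficient perturbation
  remains. Uniformity is a matter of quantifiers: the final constant is obtained from the data
  before a mesh, a degree, coefficients or solutions are chosen.\<close>

lemma inner_scaleR_diff:
  fixes y z :: "'a::real_inner"
  shows "(A *\<^sub>R y - B *\<^sub>R z) \<bullet> (y - z)
    = (A + B) / 2 * (norm (y - z))\<^sup>2 + (A - B) / 2 * ((norm y)\<^sup>2 - (norm z)\<^sup>2)"
  unfolding power2_norm_eq_inner
  by (simp add: inner_diff_left inner_diff_right inner_commute field_simps)

text \<open>For negative \<beta> the factor |y|^\<beta> decreases in |y|, so the second term of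
  \<open>inner_scaleR_diff\<close> has the wrong sign. Cauchy-Schwarz instead leaves the scalar
  product (|y|^(\<beta>+1) - |z|^(\<beta>+1)) (|y| - |z|), which is nonnegative because \<beta> + 1
  > 0.\<close>

lemma powr_flux_monotone:
  fixes y z :: "'a::real_inner"
  assumes "-1 < \<beta>"
  shows "0 \<le> (norm y powr \<beta> *\<^sub>R y - norm z powr \<beta> *\<^sub>R z) \<bullet> (y - z)"
proof -
  define A where "A = norm y powr \<beta>"
  define B where "B = norm z powr \<beta>"
  have AB: "0 \<le> A" "0 \<le> B" by (simp_all add: A_def B_def)
  have eq: "norm x powr \<beta> * norm x = norm x powr (\<beta> + 1)" for x :: 'a
    by (cases "x = 0") (simp_all add: powr_add)
  have "0 \<le> (A * norm y - B * norm z) * (norm y - norm z)"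
  proof (cases "norm z \<le> norm y")
    case True
    then have "norm z powr (\<beta> + 1) \<le> norm y powr (\<beta> + 1)"
      using assms by (intro powr_mono2) auto
    then show ?thesis using True unfolding A_def B_def eq by simp
  next
    case False
    then have "norm y powr (\<beta> + 1) \<le> norm z powr (\<beta> + 1)"
      using assms by (intro powr_mono2) auto
    then show ?thesis using False unfolding A_def B_def eq by (simp add: mult_nonpos_nonpos)
  qed
  also have "\<dots> = A * (y \<bullet> y) + B * (z \<bullet> z) - (A + B) * (norm y * norm z)"
    by (simp add: dot_square_norm power2_eq_square algebra_simps)
  also have "\<dots> \<le> A * (y \<bullet> y) + B * (z \<bullet> z) - (A + B) * (y \<bullet> z)"
    using AB norm_cauchy_schwarz[of y z] by (simp add: mult_left_mono)
  also have "\<dots> = (A *\<^sub>R y - B *\<^sub>R z) \<bullet> (y - z)"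
    by (simp add: inner_diff_left inner_diff_right inner_commute algebra_simps)
  finally show ?thesis by (simp add: A_def B_def)
qed

text \<open>For \<beta> > 0 the longer vector carries the larger factor, so the second term of
  \<open>inner_scaleR_diff\<close> is nonnegative and the first alone gives the bound. The constant
  collects 2^(-\<beta>) from |y - z| \<le> 2 max(|y|, |z|) and 1/2 from the mean of the two
  factors.\<close>

lemma powr_flux_strongly_monotone:
  fixes y z :: "'a::real_inner"
  assumes "0 < \<beta>"
  shows "(1/2) powr (\<beta> + 1) * norm (y - z) powr (\<beta> + 2)
    \<le> (norm y powr \<beta> *\<^sub>R y - norm z powr \<beta> *\<^sub>R z) \<bullet> (y - z)"
proof -
  define A where "A = norm y powr \<beta>"
  define B where "B = norm z powr \<beta>"
  have nonneg: "0 \<le> (A - B) / 2 * ((norm y)\<^sup>2 - (norm z)\<^sup>2)"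
  proof (cases "norm z \<le> norm y")
    case True
    then have "B \<le> A" unfolding A_def B_def using assms by (intro powr_mono2) auto
    moreover have "(norm z)\<^sup>2 \<le> (norm y)\<^sup>2" using True by (intro power_mono) auto
    ultimately show ?thesis by simp
  next
    case False
    then have "A \<le> B" unfolding A_def B_def using assms by (intro powr_mono2) auto
    moreover have "(norm y)\<^sup>2 \<le> (norm z)\<^sup>2" using False by (intro power_mono) auto
    ultimately show ?thesis by (intro mult_nonpos_nonpos) auto
  qed
  have "norm (y - z) powr \<beta> \<le> (2 * max (norm y) (norm z)) powr \<beta>"
    using norm_triangle_ineq4[of y z] assms by (intro powr_mono2) auto
  also have "\<dots> = 2 powr \<beta> * max (norm y) (norm z) powr \<beta>"
    by (simp add: powr_mult)
  also have "max (norm y) (norm z) powr \<beta> \<le> A + B"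
    by (cases "norm y \<le> norm z") (simp_all add: A_def B_def max_def)
  finally have "norm (y - z) powr \<beta> \<le> 2 powr \<beta> * (A + B)" by simp
  then have "(1/2) powr \<beta> * norm (y - z) powr \<beta> \<le> (1/2) powr \<beta> * (2 powr \<beta> * (A + B))"
    by (intro mult_left_mono) auto
  also have "\<dots> = A + B" by (simp add: powr_divide)
  finally have *: "(1/2) powr \<beta> * norm (y - z) powr \<beta> \<le> A + B" .
  have "(1/2) powr (\<beta> + 1) * norm (y - z) powr (\<beta> + 2)
      = ((1/2) powr \<beta> * norm (y - z) powr \<beta>) / 2 * (norm (y - z))\<^sup>2"
    by (cases "y = z") (simp_all add: powr_add)
  also have "\<dots> \<le> (A + B) / 2 * (norm (y - z))\<^sup>2"
    using * by (intro mult_right_mono) auto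
  also have "\<dots> \<le> (A *\<^sub>R y - B *\<^sub>R z) \<bullet> (y - z)"
    using nonneg unfolding inner_scaleR_diff by simp
  finally show ?thesis by (simp add: A_def B_def)
qed

text \<open>Comparing y with \<kappa> x^(s-1) replaces convexity: on either side of this threshold
  one of the two terms alone dominates x y. The second constant is not sharp, but the weight
  \<kappa> of the power to be absorbed is free.\<close>

lemma young_absorb:
  fixes x y :: real
  assumes "0 \<le> x" "0 \<le> y" "1 < s" "0 < \<kappa>"
  shows "x * y \<le> \<kappa> * x powr s + (1 / \<kappa>) powr (1 / (s - 1)) * y powr (s / (s - 1))"
proof (cases "x = 0")
  case True
  then show ?thesis by simp
next
  case False
  with assms have x: "0 < x" by simp
  show ?thesis
  proof (cases "y \<le> \<kappa> * x powr (s - 1)")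
    case True
    then have "x * y \<le> x * (\<kappa> * x powr (s - 1))" using x by (intro mult_left_mono) auto
    also have "\<dots> = \<kappa> * x powr s" using x by (simp add: powr_diff)
    finally show ?thesis by (smt (verit) mult_nonneg_nonneg powr_ge_zero)
  next
    case False
    with assms have y: "0 < y" by (smt (verit) mult_nonneg_nonneg powr_ge_zero)
    have "x powr (s - 1) \<le> y / \<kappa>" using False assms by (simp add: field_simps)
    then have "(x powr (s - 1)) powr (1 / (s - 1)) \<le> (y / \<kappa>) powr (1 / (s - 1))"
      using assms by (intro powr_mono2) auto
    then have "x \<le> (y / \<kappa>) powr (1 / (s - 1))"
      using x assms by (simp add: powr_powr)
    then have "x * y \<le> (y / \<kappa>) powr (1 / (s - 1)) * y" using y by simp
    also have "\<dots> = (1 / \<kappa>) powr (1 / (s - 1)) * (y powr (1 / (s - 1)) * y)"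
      using y assms by (simp add: powr_divide)
    also have "y powr (1 / (s - 1)) * y = y powr (1 / (s - 1) + 1)"
      using y by (simp add: powr_add)
    also have "1 / (s - 1) + 1 = s / (s - 1)" using assms by (simp add: field_simps)
    finally show ?thesis using assms by (smt (verit) mult_nonneg_nonneg powr_ge_zero)
  qed
qed

lemma one_plus_powr_le:
  fixes b p :: real
  assumes "0 \<le> b" "0 \<le> p"
  shows "(1 + b) powr p \<le> 2 powr p * (1 + b powr p)"
proof -
  have "(1 + b) powr p \<le> (2 * max 1 b) powr p"
    using assms by (intro powr_mono2) auto
  also have "\<dots> = 2 powr p * max 1 b powr p" by (simp add: powr_mult)
  also have "max 1 b powr p \<le> 1 + b powr p"
    by (cases "1 \<le> b") (simp_all add: max_def)
  finally show ?thesis by simp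
qed

section \<open>Pointwise estimates for the flux with all its powers\<close>

locale forchheimer_exponents =
  fixes N :: nat and \<alpha> :: "int \<Rightarrow> real" and \<alpha>' s :: real
  assumes N: "N \<ge> 1" and \<alpha>': "0 < \<alpha>'" "\<alpha>' < 1"
    and \<alpha>_neg: "\<alpha> (-1) = - \<alpha>'" and \<alpha>_zero: "\<alpha> 0 = 0"
    and \<alpha>_mono: "strict_mono_on {0..int N} \<alpha>" and s_def: "s = \<alpha> (int N) + 2"
begin

lemma top_exponent_pos: "0 < \<alpha> (int N)"
  using strict_mono_onD[OF \<alpha>_mono, of 0 "int N"] N \<alpha>_zero by simp

lemma s_gt_2: "2 < s"
  using top_exponent_pos s_def by simp

text \<open>\<open>\<alpha>\<close> is ordered only on the indices 0, ..., N, so index -1 is handled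
  apart. The lower bound makes r^(\<alpha>_i + 1) increasing, hence every term monotone; the upper
  bound limits every term to growth of order s - 1.\<close>

lemma exponent_bounds:
  assumes "i \<in> {-1..int N}"
  shows "-1 < \<alpha> i" "\<alpha> i + 1 \<le> s - 1"
proof -
  have "i = -1 \<or> i \<in> {0..int N}" using assms by auto
  then have "-1 < \<alpha> i \<and> \<alpha> i \<le> \<alpha> (int N)"
  proof
    assume "i = -1"
    then show ?thesis using \<alpha>_neg \<alpha>' top_exponent_pos by simp
  next
    assume i: "i \<in> {0..int N}"
    have "mono_on {0..int N} \<alpha>" using \<alpha>_mono by (rule strict_mono_on_imp_mono_on)
    then have "\<alpha> 0 \<le> \<alpha> i" "\<alpha> i \<le> \<alpha> (int N)"
      using i by (auto intro: mono_onD)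
    then show ?thesis using \<alpha>_zero by simp
  qed
  then show "-1 < \<alpha> i" "\<alpha> i + 1 \<le> s - 1" using s_def by auto
qed

lemma forchheimer_scaleR:
  fixes z :: "'a::real_vector"
  shows "forchheimer N \<alpha> c r *\<^sub>R z = (\<Sum>i\<in>{-1..int N}. c i *\<^sub>R (r powr \<alpha> i *\<^sub>R z))"
  by (simp add: forchheimer_def scaleR_sum_left)

lemma forchheimer_strongly_monotone:
  fixes y z :: "'a::real_inner"
  assumes c: "c \<in> coeff_box N lo hi" and lo: "0 < lo"
  shows "lo * (1/2) powr (s - 1) * norm (y - z) powr s
    \<le> (forchheimer N \<alpha> c (norm y) *\<^sub>R y - forchheimer N \<alpha> c (norm z) *\<^sub>R z) \<bullet> (y - z)"
proof -
  define t where "t i = (norm y powr \<alpha> i *\<^sub>R y - norm z powr \<alpha> i *\<^sub>R z) \<bullet> (y - z)" for i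
  have c0: "0 \<le> c i" if "i \<in> {-1..int N}" for i
  proof -
    have "i \<in> {-1, 0, int N} \<or> i \<in> {1..int N - 1}" using that by auto
    then show ?thesis using c lo by (force simp: coeff_box_def)
  qed
  have "lo * (1/2) powr (s - 1) * norm (y - z) powr s
      = lo * ((1/2) powr (\<alpha> (int N) + 1) * norm (y - z) powr (\<alpha> (int N) + 2))"
    by (simp add: s_def add.commute)
  also have "\<dots> \<le> lo * t (int N)"
    unfolding t_def using lo powr_flux_strongly_monotone[OF top_exponent_pos]
    by (intro mult_left_mono) auto
  also have "\<dots> \<le> c (int N) * t (int N)"
    using c powr_flux_monotone[of "\<alpha> (int N)" y z] top_exponent_pos
    by (intro mult_right_mono) (auto simp: coeff_box_def t_def)
  also have "\<dots> \<le> (\<Sum>i\<in>{-1..int N}. c i * t i)"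
    using c0 by (intro member_le_sum)
      (auto simp: t_def intro!: mult_nonneg_nonneg powr_flux_monotone exponent_bounds(1))
  also have "\<dots> = (forchheimer N \<alpha> c (norm y) *\<^sub>R y - forchheimer N \<alpha> c (norm z) *\<^sub>R z) \<bullet> (y - z)"
    unfolding forchheimer_scaleR sum_subtractf[symmetric] inner_sum_left t_def
    by (simp add: inner_diff_left algebra_simps)
  finally show ?thesis .
qed

text \<open>On the unit ball an exponent above -1 keeps the term at most 1, even for the singular
  power; outside, the order s - 1 dominates. One growth function thus serves all indices.\<close>

lemma powr_exponent_le:
  fixes z :: "'a::real_normed_vector"
  assumes "i \<in> {-1..int N}"
  shows "norm (norm z powr \<alpha> i *\<^sub>R z) \<le> 1 + norm z powr (s - 1)"
proof -
  have "norm (norm z powr \<alpha> i *\<^sub>R z) = norm z powr (\<alpha> i + 1)"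
    by (cases "z = 0") (simp_all add: powr_add)
  also have "\<dots> \<le> 1 + norm z powr (s - 1)"
  proof (cases "norm z \<le> 1")
    case True
    then have "norm z powr (\<alpha> i + 1) \<le> 1"
      using exponent_bounds[OF assms] by (intro powr_le1) auto
    then show ?thesis by (smt (verit) powr_ge_zero)
  next
    case False
    then have "norm z powr (\<alpha> i + 1) \<le> norm z powr (s - 1)"
      using exponent_bounds[OF assms] by (intro powr_mono) auto
    then show ?thesis by simp
  qed
  finally show ?thesis .
qed

text \<open>The factor N + 2 counts the indices -1, ..., N. Since \<open>c'\<close> is arbitrary,
  comparison with the zero vector also gives the growth bound for the flux itself.\<close>

lemma forchheimer_diff_bound:
  fixes z :: "'a::real_normed_vector"
  assumes "\<And>i. i \<in> {-1..int N} \<Longrightarrow> \<bar>c i - c' i\<bar> \<le> \<delta>"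
  shows "norm (forchheimer N \<alpha> c (norm z) *\<^sub>R z - forchheimer N \<alpha> c' (norm z) *\<^sub>R z)
    \<le> \<delta> * ((real N + 2) * (1 + norm z powr (s - 1)))"
proof -
  have "norm (forchheimer N \<alpha> c (norm z) *\<^sub>R z - forchheimer N \<alpha> c' (norm z) *\<^sub>R z)
      = norm (\<Sum>i\<in>{-1..int N}. (c i - c' i) *\<^sub>R (norm z powr \<alpha> i *\<^sub>R z))"
    unfolding forchheimer_scaleR sum_subtractf[symmetric] by (simp add: algebra_simps)
  also have "\<dots> \<le> (\<Sum>i\<in>{-1..int N}. \<delta> * (1 + norm z powr (s - 1)))"
  proof (rule sum_norm_le)
    fix i assume i: "i \<in> {-1..int N}"
    have "0 \<le> \<delta>" using assms[OF i] by (smt (verit) abs_ge_zero)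
    then show "norm ((c i - c' i) *\<^sub>R (norm z powr \<alpha> i *\<^sub>R z)) \<le> \<delta> * (1 + norm z powr (s - 1))"
      using mult_mono[OF assms[OF i] powr_exponent_le[OF i, of z]] by (simp add: abs_mult mult.assoc)
  qed
  also have "\<dots> = \<delta> * ((real N + 2) * (1 + norm z powr (s - 1)))"
    by simp
  finally show ?thesis .
qed

lemma forchheimer_bound:
  fixes z :: "'a::real_normed_vector"
  assumes c: "c \<in> coeff_box N lo hi" and lo: "0 < lo"
  shows "norm (forchheimer N \<alpha> c (norm z) *\<^sub>R z) \<le> hi * ((real N + 2) * (1 + norm z powr (s - 1)))"
proof -
  have "\<bar>c i - 0\<bar> \<le> hi" if "i \<in> {-1..int N}" for i
  proof -
    have "i \<in> {-1, 0, int N} \<or> i \<in> {1..int N - 1}" using that by auto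
    then show ?thesis using c lo by (force simp: coeff_box_def)
  qed
  from forchheimer_diff_bound[of c "\<lambda>_. 0", OF this, of z]
  show ?thesis by (simp add: forchheimer_def)
qed

text \<open>The difference splits into the change of the field at fixed coefficients
  \<open>c\<close> and the change \<open>e\<close> of the coefficients at the fixed field z.
  Monotonicity gives 2 \<kappa> |y - z|^s for the first part, and \<open>young_absorb\<close> spends
  half of it on the second. The exponent s/(s-1) raises the growth |z|^(s-1) of \<open>e\<close> to
  |z|^s, the quantity that the energy controls.\<close>

lemma forchheimer_stability:
  fixes y z :: "'a::real_inner"
  assumes c: "c \<in> coeff_box N lo hi" and lo: "0 < lo"
    and \<delta>: "\<And>i. i \<in> {-1..int N} \<Longrightarrow> \<bar>c i - c' i\<bar> \<le> \<delta>"
    and \<kappa>: "\<kappa> = lo * (1/2) powr (s - 1) / 2"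
    and K: "K = (1 / \<kappa>) powr (1 / (s - 1)) * (2 * (real N + 2)) powr (s / (s - 1))"
  shows "\<kappa> * norm (y - z) powr s - K * \<delta> powr (s / (s - 1)) * (1 + norm z powr s)
    \<le> (forchheimer N \<alpha> c (norm y) *\<^sub>R y - forchheimer N \<alpha> c' (norm z) *\<^sub>R z) \<bullet> (y - z)"
proof -
  define p where "p = s / (s - 1)"
  define b where "b = norm z powr (s - 1)"
  define e where "e = forchheimer N \<alpha> c (norm z) *\<^sub>R z - forchheimer N \<alpha> c' (norm z) *\<^sub>R z"
  have s: "2 < s" by (rule s_gt_2)
  have p: "0 \<le> p" using s by (simp add: p_def)
  have \<kappa>0: "0 < \<kappa>" using lo by (simp add: \<kappa>)
  have "\<bar>c (-1) - c' (-1)\<bar> \<le> \<delta>" by (rule \<delta>) simp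
  then have \<delta>0: "0 \<le> \<delta>" by linarith
  have b0: "0 \<le> b" by (simp add: b_def)
  have bp: "b powr p = norm z powr s" using s by (simp add: b_def p_def powr_powr)
  have "- (e \<bullet> (y - z)) \<le> norm (y - z) * norm e"
    using norm_cauchy_schwarz[of "- e" "y - z"] by (simp add: mult.commute)
  also have "\<dots> \<le> norm (y - z) * (\<delta> * ((real N + 2) * (1 + b)))"
    using forchheimer_diff_bound[where z = z, OF \<delta>] by (intro mult_left_mono) (simp_all add: e_def b_def)
  also have "\<dots> \<le> \<kappa> * norm (y - z) powr s
      + (1 / \<kappa>) powr (1 / (s - 1)) * (\<delta> * ((real N + 2) * (1 + b))) powr p"
    unfolding p_def using s \<kappa>0 \<delta>0 b0 by (intro young_absorb) auto
  also have "(\<delta> * ((real N + 2) * (1 + b))) powr p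
      = \<delta> powr p * ((real N + 2) powr p * (1 + b) powr p)"
    using \<delta>0 b0 by (simp add: powr_mult)
  \<comment> \<open>The 2 inside \<open>K\<close> comes from replacing (1 + b)^p by 2^p (1 +
    b^p).\<close>
  also have "(1 / \<kappa>) powr (1 / (s - 1)) * (\<delta> powr p * ((real N + 2) powr p * (1 + b) powr p))
     \<le> (1 / \<kappa>) powr (1 / (s - 1)) * (\<delta> powr p * ((real N + 2) powr p * (2 powr p * (1 + b powr p))))"
    using one_plus_powr_le[OF b0 p] by (intro mult_left_mono) auto
  also have "\<dots> = K * \<delta> powr p * (1 + norm z powr s)"
    unfolding K bp p_def[symmetric] powr_mult[of 2 "real N + 2" p] by simp
  finally have 1: "- (e \<bullet> (y - z)) \<le> \<kappa> * norm (y - z) powr s + K * \<delta> powr p * (1 + norm z powr s)"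
    by simp
  have 2: "2 * \<kappa> * norm (y - z) powr s
    \<le> (forchheimer N \<alpha> c (norm y) *\<^sub>R y - forchheimer N \<alpha> c (norm z) *\<^sub>R z) \<bullet> (y - z)"
    using forchheimer_strongly_monotone[OF c lo, of y z] by (simp add: \<kappa>)
  have "(forchheimer N \<alpha> c (norm y) *\<^sub>R y - forchheimer N \<alpha> c' (norm z) *\<^sub>R z) \<bullet> (y - z)
     = (forchheimer N \<alpha> c (norm y) *\<^sub>R y - forchheimer N \<alpha> c (norm z) *\<^sub>R z) \<bullet> (y - z) + e \<bullet> (y - z)"
    by (simp add: e_def inner_diff_left)
  with 1 2 show ?thesis by (simp add: p_def)
qed

end

section \<open>Chain rule for squares of time primitives\<close>

lemma ennreal_power2_le_imp_le:
  fixes x y :: ennreal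
  assumes "x\<^sup>2 \<le> y\<^sup>2"
  shows "x \<le> y"
proof (rule ccontr)
  assume "\<not> x \<le> y"
  then have "y < x" by simp
  then have "y * y < x * x"
    by (cases x; cases y) (auto simp: ennreal_mult[symmetric] ennreal_less_iff ennreal_mult_top
        ennreal_top_mult top_unique less_top[symmetric] intro!: mult_strict_mono)
  then show False using assms by (simp add: power2_eq_square)
qed

text \<open>The diagonal splits the square \<open>S \<times> S\<close> into two triangles that Fubini maps to each other.\<close>

lemma integral_square_triangle:
  fixes g :: "real \<Rightarrow> real"
  assumes S: "S \<in> lmeasurable" and g: "integrable (lebesgue_on S) g"
  shows "(integral\<^sup>L (lebesgue_on S) g)\<^sup>2
    = 2 * (LINT \<tau>|lebesgue_on S. g \<tau> * (LINT \<sigma>|lebesgue_on S. (if \<sigma> \<le> \<tau> then g \<sigma> else 0)))"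
proof -
  let ?J = "lebesgue_on S"
  interpret J: finite_measure ?J by (rule finite_measure_lebesgue_on[OF S])
  interpret JJ: pair_sigma_finite ?J ?J ..
  have [measurable]: "(\<lambda>x. x) \<in> borel_measurable ?J"
    using id_borel_measurable_lebesgue_on[of S] by (simp add: id_def)
  have [measurable]: "g \<in> borel_measurable ?J" using g by auto
  define h where "h p = g (fst p) * g (snd p)" for p
  have [measurable]: "h \<in> borel_measurable (?J \<Otimes>\<^sub>M ?J)" unfolding h_def by measurable
  have h: "integrable (?J \<Otimes>\<^sub>M ?J) h"
    by (rule JJ.Fubini_integrable) (use g in \<open>auto simp: h_def abs_mult\<close>)
  define h1 where "h1 \<tau> \<sigma> = (if \<sigma> \<le> \<tau> then g \<tau> * g \<sigma> else 0)" for \<tau> \<sigma>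
  define h2 where "h2 \<tau> \<sigma> = (if \<sigma> \<le> \<tau> then 0 else g \<tau> * g \<sigma>)" for \<tau> \<sigma>
  have h1: "integrable (?J \<Otimes>\<^sub>M ?J) (\<lambda>(\<tau>, \<sigma>). h1 \<tau> \<sigma>)"
    by (rule Bochner_Integration.integrable_bound[OF h]) (auto simp: h_def h1_def)
  have h2: "integrable (?J \<Otimes>\<^sub>M ?J) (\<lambda>(\<tau>, \<sigma>). h2 \<tau> \<sigma>)"
    by (rule Bochner_Integration.integrable_bound[OF h]) (auto simp: h_def h2_def)
  have "(integral\<^sup>L ?J g)\<^sup>2 = (LINT \<tau>|?J. LINT \<sigma>|?J. h (\<tau>, \<sigma>))"
    by (simp add: h_def power2_eq_square)
  also have "\<dots> = integral\<^sup>L (?J \<Otimes>\<^sub>M ?J) h"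
    by (rule JJ.integral_fst'[OF h])
  also have "h = (\<lambda>p. (\<lambda>(\<tau>, \<sigma>). h1 \<tau> \<sigma>) p + (\<lambda>(\<tau>, \<sigma>). h2 \<tau> \<sigma>) p)"
    by (auto simp: h_def h1_def h2_def)
  also have "integral\<^sup>L (?J \<Otimes>\<^sub>M ?J) \<dots>
      = (LINT p|(?J \<Otimes>\<^sub>M ?J). (\<lambda>(\<tau>, \<sigma>). h1 \<tau> \<sigma>) p) + (LINT p|(?J \<Otimes>\<^sub>M ?J). (\<lambda>(\<tau>, \<sigma>). h2 \<tau> \<sigma>) p)"
    using h1 h2 by (rule Bochner_Integration.integral_add)
  also have "(LINT p|(?J \<Otimes>\<^sub>M ?J). (\<lambda>(\<tau>, \<sigma>). h1 \<tau> \<sigma>) p) = (LINT \<tau>|?J. LINT \<sigma>|?J. h1 \<tau> \<sigma>)"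
    by (rule JJ.integral_fst[OF h1, symmetric])
  also have "(\<lambda>\<tau>. LINT \<sigma>|?J. h1 \<tau> \<sigma>) = (\<lambda>\<tau>. g \<tau> * (LINT \<sigma>|?J. (if \<sigma> \<le> \<tau> then g \<sigma> else 0)))"
  proof
    fix \<tau>
    have "(LINT \<sigma>|?J. h1 \<tau> \<sigma>) = (LINT \<sigma>|?J. g \<tau> * (if \<sigma> \<le> \<tau> then g \<sigma> else 0))"
      by (intro Bochner_Integration.integral_cong) (auto simp: h1_def)
    then show "(LINT \<sigma>|?J. h1 \<tau> \<sigma>) = g \<tau> * (LINT \<sigma>|?J. (if \<sigma> \<le> \<tau> then g \<sigma> else 0))" by simp
  qed
  also have "(LINT p|(?J \<Otimes>\<^sub>M ?J). (\<lambda>(\<tau>, \<sigma>). h2 \<tau> \<sigma>) p) = (LINT \<sigma>|?J. LINT \<tau>|?J. h2 \<tau> \<sigma>)"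
    by (rule JJ.integral_snd[OF h2, symmetric])
  also have "(\<lambda>\<sigma>. LINT \<tau>|?J. h2 \<tau> \<sigma>) = (\<lambda>\<sigma>. g \<sigma> * (LINT \<tau>|?J. (if \<tau> \<le> \<sigma> then g \<tau> else 0)))"
  proof
    fix \<sigma> :: real
    \<comment> \<open>\<open>h2\<close> vanishes on the diagonal, whereas the integrand wanted here
      keeps the point \<tau> = \<sigma>. The two agree off this single point.\<close>
    have "{\<sigma>} \<in> null_sets lebesgue"
      by (simp add: null_sets_completionI)
    then have "AE \<tau> in lebesgue. \<tau> \<noteq> \<sigma>" using AE_not_in[of "{\<sigma>}" lebesgue] by simp
    then have "AE \<tau> in ?J. \<tau> \<noteq> \<sigma>" using fmeasurableD[OF S]
      by (subst AE_restrict_space_iff) (auto elim!: eventually_mono)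
    then have ae: "AE \<tau> in ?J. h2 \<tau> \<sigma> = g \<sigma> * (if \<tau> \<le> \<sigma> then g \<tau> else 0)"
      by (rule eventually_mono) (auto simp: h2_def)
    have "(LINT \<tau>|?J. h2 \<tau> \<sigma>) = (LINT \<tau>|?J. g \<sigma> * (if \<tau> \<le> \<sigma> then g \<tau> else 0))"
    proof (rule integral_cong_AE[OF _ _ ae])
      show "(\<lambda>\<tau>. h2 \<tau> \<sigma>) \<in> borel_measurable ?J" unfolding h2_def by measurable
    qed measurable
    then show "(LINT \<tau>|?J. h2 \<tau> \<sigma>) = g \<sigma> * (LINT \<tau>|?J. (if \<tau> \<le> \<sigma> then g \<tau> else 0))"
      by simp
  qed
  finally show ?thesis by simp
qed

text \<open>This replaces Minkowski's integral inequality: the square is a double time integral, and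
  Cauchy-Schwarz is applied in space for each pair of times.\<close>

lemma nn_integral_square_of_time_integral:
  fixes g :: "'t \<Rightarrow> 'x \<Rightarrow> ennreal"
  assumes J: "sigma_finite_measure J" and M: "sigma_finite_measure M"
    and g: "(\<lambda>(t, x). g t x) \<in> borel_measurable (J \<Otimes>\<^sub>M M)"
    and n: "n \<in> borel_measurable J" "\<And>t. t \<in> space J \<Longrightarrow> (\<integral>\<^sup>+x. (g t x)\<^sup>2 \<partial>M) = (n t)\<^sup>2"
  shows "(\<integral>\<^sup>+x. (\<integral>\<^sup>+t. g t x \<partial>J)\<^sup>2 \<partial>M) \<le> (\<integral>\<^sup>+t. n t \<partial>J)\<^sup>2"
proof -
  interpret J: sigma_finite_measure J by fact
  interpret M: sigma_finite_measure M by fact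
  interpret JM: pair_sigma_finite J M ..
  interpret MJ: pair_sigma_finite M J ..
  note [measurable] = n(1)
  have g1[measurable]: "(\<lambda>p. g (fst p) (snd p)) \<in> borel_measurable (J \<Otimes>\<^sub>M M)"
    using g by (simp add: case_prod_beta')
  have g2[measurable]: "(\<lambda>p. g (snd p) (fst p)) \<in> borel_measurable (M \<Otimes>\<^sub>M J)"
    using measurable_compose[OF measurable_pair_swap' g] by (simp add: case_prod_beta')
  have gt[measurable]: "(\<lambda>x. g t x) \<in> borel_measurable M" if "t \<in> space J" for t
    using measurable_Pair2[OF g that] by simp
  have gx[measurable]: "(\<lambda>t. g t x) \<in> borel_measurable J" if "x \<in> space M" for x
    using measurable_Pair1[OF g that] by simp
  define G where "G x = (\<integral>\<^sup>+t. g t x \<partial>J)" for x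
  have G[measurable]: "G \<in> borel_measurable M" unfolding G_def by measurable
  have cs: "(\<integral>\<^sup>+x. g t x * g r x \<partial>M) \<le> n t * n r" if "t \<in> space J" "r \<in> space J" for t r
  proof -
    have "(\<integral>\<^sup>+x. g t x * g r x \<partial>M)\<^sup>2 \<le> (n t)\<^sup>2 * (n r)\<^sup>2"
      using Cauchy_Schwarz_nn_integral[OF gt[OF that(1)] gt[OF that(2)]] n(2) that by simp
    also have "\<dots> = (n t * n r)\<^sup>2" by (simp add: power_mult_distrib)
    finally show ?thesis by (rule ennreal_power2_le_imp_le)
  qed
  have "(\<integral>\<^sup>+x. (G x)\<^sup>2 \<partial>M) = (\<integral>\<^sup>+x. (\<integral>\<^sup>+t. g t x * G x \<partial>J) \<partial>M)"
    by (intro nn_integral_cong) (simp add: nn_integral_multc G_def power2_eq_square)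
  also have "\<dots> = (\<integral>\<^sup>+t. (\<integral>\<^sup>+x. g t x * G x \<partial>M) \<partial>J)"
    by (rule JM.Fubini') (simp add: case_prod_beta')
  also have "\<dots> = (\<integral>\<^sup>+t. (\<integral>\<^sup>+x. (\<integral>\<^sup>+r. g t x * g r x \<partial>J) \<partial>M) \<partial>J)"
    by (intro nn_integral_cong) (simp add: nn_integral_cmult G_def)
  also have "\<dots> = (\<integral>\<^sup>+t. (\<integral>\<^sup>+r. (\<integral>\<^sup>+x. g t x * g r x \<partial>M) \<partial>J) \<partial>J)"
  proof (intro nn_integral_cong)
    fix t assume [measurable]: "t \<in> space J"
    show "(\<integral>\<^sup>+x. (\<integral>\<^sup>+r. g t x * g r x \<partial>J) \<partial>M) = (\<integral>\<^sup>+r. (\<integral>\<^sup>+x. g t x * g r x \<partial>M) \<partial>J)"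
      by (rule JM.Fubini') (simp add: case_prod_beta')
  qed
  also have "\<dots> \<le> (\<integral>\<^sup>+t. (\<integral>\<^sup>+r. n t * n r \<partial>J) \<partial>J)"
    by (intro nn_integral_mono cs)
  also have "\<dots> = (\<integral>\<^sup>+t. n t \<partial>J)\<^sup>2"
    by (simp add: nn_integral_cmult nn_integral_multc power2_eq_square)
  finally show ?thesis by (simp add: G_def)
qed

text \<open>The primitive is bounded by the integral of |g|, so the product is dominated by a
  constant multiple of g.\<close>

lemma integrable_times_primitive:
  fixes g :: "real \<Rightarrow> real"
  assumes S: "S \<in> lmeasurable" and g: "integrable (lebesgue_on S) g"
  shows "integrable (lebesgue_on S) (\<lambda>\<tau>. g \<tau> * (LINT \<sigma>|lebesgue_on S. (if \<sigma> \<le> \<tau> then g \<sigma> else 0)))"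
proof -
  let ?J = "lebesgue_on S"
  interpret J: finite_measure ?J by (rule finite_measure_lebesgue_on[OF S])
  have [measurable]: "(\<lambda>x. x) \<in> borel_measurable ?J"
    using id_borel_measurable_lebesgue_on[of S] by (simp add: id_def)
  have [measurable]: "g \<in> borel_measurable ?J" using g by auto
  have meas: "(\<lambda>\<tau>. LINT \<sigma>|?J. (if \<sigma> \<le> \<tau> then g \<sigma> else 0)) \<in> borel_measurable ?J"
    by (rule J.borel_measurable_lebesgue_integral) measurable
  have i: "integrable ?J (\<lambda>\<sigma>. if \<sigma> \<le> \<tau> then g \<sigma> else 0)" for \<tau>
    by (rule Bochner_Integration.integrable_bound[OF g]) auto
  have "\<bar>LINT \<sigma>|?J. (if \<sigma> \<le> \<tau> then g \<sigma> else 0)\<bar> \<le> (LINT \<sigma>|?J. \<bar>g \<sigma>\<bar>)" for \<tau>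
  proof -
    have "\<bar>LINT \<sigma>|?J. (if \<sigma> \<le> \<tau> then g \<sigma> else 0)\<bar> \<le> (LINT \<sigma>|?J. \<bar>if \<sigma> \<le> \<tau> then g \<sigma> else 0\<bar>)"
      by (rule integral_abs_bound)
    also have "\<dots> \<le> (LINT \<sigma>|?J. \<bar>g \<sigma>\<bar>)"
      using i g by (intro integral_mono) auto
    finally show ?thesis .
  qed
  then have le: "norm (g \<tau> * (LINT \<sigma>|?J. (if \<sigma> \<le> \<tau> then g \<sigma> else 0)))
     \<le> norm (g \<tau> * (LINT \<sigma>|?J. \<bar>g \<sigma>\<bar>))" for \<tau>
    by (auto simp: abs_mult intro!: mult_left_mono)
  show ?thesis
  proof (rule Bochner_Integration.integrable_bound[OF _ _ AE_I2[OF le]])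
    show "integrable ?J (\<lambda>\<tau>. g \<tau> * (LINT \<sigma>|?J. \<bar>g \<sigma>\<bar>))" using g by simp
  qed (use meas in measurable)
qed

text \<open>The integrated product rule for R^2, without differentiating R: the part with c is
  linear, and the square of the pure primitive is \<open>integral_square_triangle\<close> for g cut
  off at t. The upper limit is a cut-off in the integrand, so the measure does not change with t and
  Fubini can be applied.\<close>

lemma square_of_primitive:
  fixes g :: "real \<Rightarrow> real"
  assumes S: "S \<in> lmeasurable" and g: "integrable (lebesgue_on S) g"
    and R: "\<And>t. R t = c + (LINT \<sigma>|lebesgue_on S. (if \<sigma> \<le> t then g \<sigma> else 0))"
  shows "(R t)\<^sup>2 = c\<^sup>2 + 2 * (LINT \<tau>|lebesgue_on S. (if \<tau> \<le> t then g \<tau> * R \<tau> else 0))"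
proof -
  let ?J = "lebesgue_on S"
  define P where "P t = (LINT \<sigma>|?J. (if \<sigma> \<le> t then g \<sigma> else 0))" for t
  define gt where "gt \<sigma> = (if \<sigma> \<le> t then g \<sigma> else 0)" for \<sigma>
  have [measurable]: "(\<lambda>x. x) \<in> borel_measurable ?J"
    using id_borel_measurable_lebesgue_on[of S] by (simp add: id_def)
  have [measurable]: "g \<in> borel_measurable ?J" using g by auto
  have gt: "integrable ?J gt"
    unfolding gt_def by (rule Bochner_Integration.integrable_bound[OF g]) auto
  have gP: "integrable ?J (\<lambda>\<tau>. g \<tau> * P \<tau>)"
    unfolding P_def by (rule integrable_times_primitive[OF S g])
  then have gPt: "integrable ?J (\<lambda>\<tau>. if \<tau> \<le> t then g \<tau> * P \<tau> else 0)"
    by (rule Bochner_Integration.integrable_bound) (use gP in auto)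
  have Pt: "P t = integral\<^sup>L ?J gt" by (simp add: P_def gt_def[abs_def])
  then have "(P t)\<^sup>2 = 2 * (LINT \<tau>|?J. gt \<tau> * (LINT \<sigma>|?J. (if \<sigma> \<le> \<tau> then gt \<sigma> else 0)))"
    using integral_square_triangle[OF S gt] by (simp only:)
  also have "(LINT \<tau>|?J. gt \<tau> * (LINT \<sigma>|?J. (if \<sigma> \<le> \<tau> then gt \<sigma> else 0)))
      = (LINT \<tau>|?J. (if \<tau> \<le> t then g \<tau> * P \<tau> else 0))"
  proof (intro Bochner_Integration.integral_cong refl)
    fix \<tau>
    \<comment> \<open>For \<tau> \<le> t the inner cut-off at \<tau> already implies the cut-off at
      t; for \<tau> > t the outer factor \<open>gt\<close> is 0.\<close>
    have "(\<lambda>\<sigma>. if \<sigma> \<le> \<tau> then gt \<sigma> else 0) = (\<lambda>\<sigma>. if \<sigma> \<le> \<tau> then g \<sigma> else 0)" if "\<tau> \<le> t"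
      using that by (auto simp: gt_def)
    then show "gt \<tau> * (LINT \<sigma>|?J. (if \<sigma> \<le> \<tau> then gt \<sigma> else 0)) = (if \<tau> \<le> t then g \<tau> * P \<tau> else 0)"
      by (simp add: P_def) (simp add: gt_def)
  qed
  finally have P2: "(P t)\<^sup>2 = 2 * (LINT \<tau>|?J. (if \<tau> \<le> t then g \<tau> * P \<tau> else 0))" .
  have "(LINT \<tau>|?J. (if \<tau> \<le> t then g \<tau> * R \<tau> else 0))
     = (LINT \<tau>|?J. c * gt \<tau> + (if \<tau> \<le> t then g \<tau> * P \<tau> else 0))"
    by (intro Bochner_Integration.integral_cong) (auto simp: gt_def R P_def algebra_simps)
  also have "\<dots> = (LINT \<tau>|?J. c * gt \<tau>) + (LINT \<tau>|?J. (if \<tau> \<le> t then g \<tau> * P \<tau> else 0))"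
    using gt gPt by (intro Bochner_Integration.integral_add) auto
  also have "(LINT \<tau>|?J. c * gt \<tau>) = c * P t"
    unfolding Pt by simp
  finally have I: "(LINT \<tau>|?J. (if \<tau> \<le> t then g \<tau> * R \<tau> else 0))
      = c * P t + (LINT \<tau>|?J. (if \<tau> \<le> t then g \<tau> * P \<tau> else 0))" .
  have "R t = c + P t" by (simp only: R P_def)
  then show ?thesis unfolding I using P2 by (simp add: power2_sum)
qed

text \<open>\<open>square_of_primitive\<close> is integrated over x against w and the order of
  integration is exchanged. Fubini needs a majorant of w g R: |R| is at most
  |\<open>u\<^sub>0\<close>| + G, where G is the time integral of |g|, and \<open>gfin\<close> makes
  G square integrable in x.\<close>

lemma weighted_chain_rule:
  fixes g :: "real \<Rightarrow> 'x \<Rightarrow> real" and w u\<^sub>0 :: "'x \<Rightarrow> real"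
  assumes S: "S \<in> lmeasurable" and M: "finite_measure M"
    and g: "(\<lambda>(t, x). g t x) \<in> borel_measurable (lebesgue_on S \<Otimes>\<^sub>M M)"
    and gfin: "(\<integral>\<^sup>+x. (\<integral>\<^sup>+t. ennreal \<bar>g t x\<bar> \<partial>lebesgue_on S)\<^sup>2 \<partial>M) < \<infinity>"
    and u0: "u\<^sub>0 \<in> borel_measurable M" "integrable M (\<lambda>x. (u\<^sub>0 x)\<^sup>2)"
    and w: "w \<in> borel_measurable M" "\<And>x. x \<in> space M \<Longrightarrow> \<bar>w x\<bar> \<le> W"
    and R: "\<And>t x. R t x = u\<^sub>0 x + (LINT \<sigma>|lebesgue_on S. (if \<sigma> \<le> t then g \<sigma> x else 0))"
  shows "integrable (lebesgue_on S) (\<lambda>\<tau>. LINT x|M. w x * g \<tau> x * R \<tau> x)" (is ?int)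
    and "(LINT x|M. w x * (R t x)\<^sup>2) = (LINT x|M. w x * (u\<^sub>0 x)\<^sup>2)
      + 2 * (LINT \<tau>|lebesgue_on S. (if \<tau> \<le> t then LINT x|M. w x * g \<tau> x * R \<tau> x else 0))" (is ?eq)
    and "AE x in M. integrable (lebesgue_on S) (\<lambda>\<tau>. g \<tau> x)"
    and "\<And>t. R t \<in> borel_measurable M"
proof -
  let ?J = "lebesgue_on S"
  interpret J: finite_measure ?J by (rule finite_measure_lebesgue_on[OF S])
  interpret M: finite_measure M by fact
  interpret JM: pair_sigma_finite ?J M ..
  note [measurable] = u0(1) w(1)
  have [measurable]: "(\<lambda>x. x) \<in> borel_measurable ?J"
    using id_borel_measurable_lebesgue_on[of S] by (simp add: id_def)
  have g1[measurable]: "(\<lambda>p. g (fst p) (snd p)) \<in> borel_measurable (?J \<Otimes>\<^sub>M M)"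
    using g by (simp add: case_prod_beta')
  have g2[measurable]: "(\<lambda>p. g (snd p) (fst p)) \<in> borel_measurable (M \<Otimes>\<^sub>M ?J)"
    using measurable_compose[OF measurable_pair_swap' g] by (simp add: case_prod_beta')
  have gx[measurable]: "(\<lambda>t. g t x) \<in> borel_measurable ?J" if "x \<in> space M" for x
    using measurable_Pair1[OF g that] by simp
  define G where "G x = (\<integral>\<^sup>+t. ennreal \<bar>g t x\<bar> \<partial>?J)" for x
  have G[measurable]: "G \<in> borel_measurable M" unfolding G_def by measurable
  have R2[measurable]: "(\<lambda>p. R (fst p) (snd p)) \<in> borel_measurable (?J \<Otimes>\<^sub>M M)"
    unfolding R
  proof (intro borel_measurable_add J.borel_measurable_lebesgue_integral)
    have [measurable]: "(\<lambda>p. g (snd p) (snd (fst p))) \<in> borel_measurable ((?J \<Otimes>\<^sub>M M) \<Otimes>\<^sub>M ?J)"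
      by (rule measurable_compose[OF _ g, of "\<lambda>p. (snd p, snd (fst p))", simplified]) measurable
    show "(\<lambda>(p, \<sigma>). if \<sigma> \<le> fst p then g \<sigma> (snd p) else 0) \<in> borel_measurable ((?J \<Otimes>\<^sub>M M) \<Otimes>\<^sub>M ?J)"
      unfolding case_prod_beta' by measurable
  qed measurable
  have Rm: "R t \<in> borel_measurable M" for t
    unfolding R
  proof (intro borel_measurable_add J.borel_measurable_lebesgue_integral)
    show "(\<lambda>(x, \<sigma>). if \<sigma> \<le> t then g \<sigma> x else 0) \<in> borel_measurable (M \<Otimes>\<^sub>M ?J)"
      unfolding case_prod_beta' by measurable
  qed measurable
  show "\<And>t. R t \<in> borel_measurable M" by (rule Rm)
  have Gfin: "AE x in M. G x < \<infinity>"
  proof -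
    have "AE x in M. (G x)\<^sup>2 \<noteq> \<infinity>"
      using gfin by (intro nn_integral_PInf_AE) (auto simp: G_def[symmetric])
    then show ?thesis by (rule AE_mp) (auto simp: power2_eq_square less_top ennreal_mult_eq_top_iff)
  qed
  show gint: "AE x in M. integrable ?J (\<lambda>\<tau>. g \<tau> x)"
    using Gfin by (rule AE_mp) (intro AE_I2 impI integrableI_bounded, auto simp: G_def)
  have Rle: "ennreal \<bar>R t x\<bar> \<le> ennreal \<bar>u\<^sub>0 x\<bar> + G x" if "x \<in> space M" for t x
  proof -
    let ?k = "\<lambda>\<sigma>. if \<sigma> \<le> t then g \<sigma> x else 0"
    \<comment> \<open>Where \<open>?k\<close> is not integrable its integral is 0 by convention, so
      the bound holds at every x and no exceptional set arises.\<close>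
    have P: "ennreal \<bar>LINT \<sigma>|?J. ?k \<sigma>\<bar> \<le> G x"
    proof (cases "integrable ?J ?k")
      case True
      have "ennreal \<bar>LINT \<sigma>|?J. ?k \<sigma>\<bar> \<le> (\<integral>\<^sup>+\<sigma>. ennreal \<bar>?k \<sigma>\<bar> \<partial>?J)"
        using integral_norm_bound_ennreal[OF True] by simp
      also have "\<dots> \<le> G x" unfolding G_def by (intro nn_integral_mono) auto
      finally show ?thesis .
    qed (simp add: not_integrable_integral_eq)
    have "ennreal \<bar>R t x\<bar> \<le> ennreal \<bar>u\<^sub>0 x\<bar> + ennreal \<bar>LINT \<sigma>|?J. ?k \<sigma>\<bar>"
      unfolding R by (subst ennreal_plus[symmetric]) (auto intro!: ennreal_leI simp del: ennreal_plus)
    also have "\<dots> \<le> ennreal \<bar>u\<^sub>0 x\<bar> + G x" by (rule add_left_mono[OF P])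
    finally show ?thesis .
  qed
  define F where "F \<tau> x = w x * g \<tau> x * R \<tau> x" for \<tau> x
  have F: "integrable (?J \<Otimes>\<^sub>M M) (\<lambda>(\<tau>, x). F \<tau> x)"
  proof (rule integrableI_bounded)
    show "(\<lambda>(\<tau>, x). F \<tau> x) \<in> borel_measurable (?J \<Otimes>\<^sub>M M)"
      unfolding F_def case_prod_beta' by measurable
    have "(\<integral>\<^sup>+p. ennreal (norm (case p of (\<tau>, x) \<Rightarrow> F \<tau> x)) \<partial>(?J \<Otimes>\<^sub>M M))
        = (\<integral>\<^sup>+x. (\<integral>\<^sup>+\<tau>. ennreal \<bar>F \<tau> x\<bar> \<partial>?J) \<partial>M)"
      by (subst JM.nn_integral_snd[symmetric]) (auto simp: F_def case_prod_beta')
    \<comment> \<open>The time integral of |F| is at most W G (|\<open>u\<^sub>0\<close>| + G). The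
      mixed term G |\<open>u\<^sub>0\<close>| is at most the square of the larger factor, which
      gives the second G^2.\<close>
    also have "\<dots> \<le> (\<integral>\<^sup>+x. ennreal W * (2 * (G x)\<^sup>2 + ennreal ((u\<^sub>0 x)\<^sup>2)) \<partial>M)"
    proof (intro nn_integral_mono)
      fix x assume x[measurable]: "x \<in> space M"
      have "(\<integral>\<^sup>+\<tau>. ennreal \<bar>F \<tau> x\<bar> \<partial>?J)
          \<le> (\<integral>\<^sup>+\<tau>. ennreal \<bar>g \<tau> x\<bar> * (ennreal W * (ennreal \<bar>u\<^sub>0 x\<bar> + G x)) \<partial>?J)"
      proof (intro nn_integral_mono)
        fix \<tau>
        have "ennreal \<bar>F \<tau> x\<bar> = ennreal \<bar>g \<tau> x\<bar> * (ennreal \<bar>w x\<bar> * ennreal \<bar>R \<tau> x\<bar>)"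
          by (simp add: F_def abs_mult ennreal_mult ac_simps)
        also have "\<dots> \<le> ennreal \<bar>g \<tau> x\<bar> * (ennreal W * (ennreal \<bar>u\<^sub>0 x\<bar> + G x))"
          by (intro mult_mono Rle ennreal_leI w x) auto
        finally show "ennreal \<bar>F \<tau> x\<bar> \<le> \<dots>" .
      qed
      also have "\<dots> = G x * (ennreal W * (ennreal \<bar>u\<^sub>0 x\<bar> + G x))"
        by (subst nn_integral_multc) (auto simp: G_def)
      also have "\<dots> = ennreal W * ((G x)\<^sup>2 + G x * ennreal \<bar>u\<^sub>0 x\<bar>)"
        by (simp add: power2_eq_square distrib_left ac_simps)
      also have "G x * ennreal \<bar>u\<^sub>0 x\<bar> \<le> (G x)\<^sup>2 + ennreal ((u\<^sub>0 x)\<^sup>2)"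
      proof (cases "G x \<le> ennreal \<bar>u\<^sub>0 x\<bar>")
        case True
        then have "G x * ennreal \<bar>u\<^sub>0 x\<bar> \<le> ennreal \<bar>u\<^sub>0 x\<bar> * ennreal \<bar>u\<^sub>0 x\<bar>"
          by (intro mult_right_mono) auto
        also have "\<dots> = ennreal ((u\<^sub>0 x)\<^sup>2)"
          by (simp add: ennreal_mult[symmetric] power2_eq_square)
        finally show ?thesis by (simp add: add_increasing)
      next
        case False
        then have "G x * ennreal \<bar>u\<^sub>0 x\<bar> \<le> G x * G x"
          by (intro mult_left_mono) auto
        then show ?thesis by (simp add: add_increasing2 power2_eq_square)
      qed
      finally show "(\<integral>\<^sup>+\<tau>. ennreal \<bar>F \<tau> x\<bar> \<partial>?J) \<le> ennreal W * (2 * (G x)\<^sup>2 + ennreal ((u\<^sub>0 x)\<^sup>2))"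
        by (simp add: mult_left_mono add_left_mono mult_2 add.assoc)
    qed
    also have "\<dots> = ennreal W * (2 * (\<integral>\<^sup>+x. (G x)\<^sup>2 \<partial>M) + (\<integral>\<^sup>+x. ennreal ((u\<^sub>0 x)\<^sup>2) \<partial>M))"
      by (simp add: nn_integral_cmult nn_integral_add)
    also have "\<dots> < \<infinity>"
      using gfin u0(2) by (auto simp: integrable_iff_bounded G_def[symmetric] ennreal_mult_less_top)
    finally show "(\<integral>\<^sup>+p. ennreal (norm (case p of (\<tau>, x) \<Rightarrow> F \<tau> x)) \<partial>(?J \<Otimes>\<^sub>M M)) < \<infinity>" .
  qed
  show ?int using JM.integrable_fst[OF F] by (simp add: F_def)
  have Ft: "integrable (?J \<Otimes>\<^sub>M M) (\<lambda>(\<tau>, x). if \<tau> \<le> t then F \<tau> x else 0)"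
  proof (rule Bochner_Integration.integrable_bound[OF F])
    show "(\<lambda>(\<tau>, x). if \<tau> \<le> t then F \<tau> x else 0) \<in> borel_measurable (?J \<Otimes>\<^sub>M M)"
      unfolding F_def case_prod_beta' by measurable
  qed auto
  have u0w: "integrable M (\<lambda>x. w x * (u\<^sub>0 x)\<^sup>2)"
  proof (rule Bochner_Integration.integrable_bound)
    show "integrable M (\<lambda>x. W * (u\<^sub>0 x)\<^sup>2)" using u0(2) by simp
    have "norm (w x * (u\<^sub>0 x)\<^sup>2) \<le> norm (W * (u\<^sub>0 x)\<^sup>2)" if "x \<in> space M" for x
      using w(2)[OF that] by (auto simp: abs_mult intro!: mult_right_mono)
    then show "AE x in M. norm (w x * (u\<^sub>0 x)\<^sup>2) \<le> norm (W * (u\<^sub>0 x)\<^sup>2)" by (rule AE_I2)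
  qed measurable
  have "(LINT x|M. w x * (R t x)\<^sup>2)
     = (LINT x|M. w x * (u\<^sub>0 x)\<^sup>2 + 2 * (LINT \<tau>|?J. (if \<tau> \<le> t then F \<tau> x else 0)))"
  proof (rule integral_cong_AE)
    show "(\<lambda>x. w x * (R t x)\<^sup>2) \<in> borel_measurable M" using Rm by measurable
    show "(\<lambda>x. w x * (u\<^sub>0 x)\<^sup>2 + 2 * (LINT \<tau>|?J. (if \<tau> \<le> t then F \<tau> x else 0))) \<in> borel_measurable M"
      using JM.integrable_snd[OF Ft] u0w by measurable
    show "AE x in M. w x * (R t x)\<^sup>2
        = w x * (u\<^sub>0 x)\<^sup>2 + 2 * (LINT \<tau>|?J. (if \<tau> \<le> t then F \<tau> x else 0))"
      using gint
    proof (rule AE_mp, intro AE_I2 impI)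
      fix x assume i: "integrable ?J (\<lambda>\<tau>. g \<tau> x)"
      have "(LINT \<tau>|?J. (if \<tau> \<le> t then F \<tau> x else 0))
          = (LINT \<tau>|?J. w x * (if \<tau> \<le> t then g \<tau> x * R \<tau> x else 0))"
        by (intro Bochner_Integration.integral_cong) (auto simp: F_def)
      also have "\<dots> = w x * (LINT \<tau>|?J. (if \<tau> \<le> t then g \<tau> x * R \<tau> x else 0))" by simp
      finally show "w x * (R t x)\<^sup>2
          = w x * (u\<^sub>0 x)\<^sup>2 + 2 * (LINT \<tau>|?J. (if \<tau> \<le> t then F \<tau> x else 0))"
        using square_of_primitive[OF S i, of "\<lambda>t. R t x" "u\<^sub>0 x" t] R
        by (simp add: distrib_left)
    qed
  qed
  also have "\<dots> = (LINT x|M. w x * (u\<^sub>0 x)\<^sup>2) + 2 * (LINT x|M. LINT \<tau>|?J. (if \<tau> \<le> t then F \<tau> x else 0))"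
    using JM.integrable_snd[OF Ft] u0w by simp
  also have "(LINT x|M. LINT \<tau>|?J. (if \<tau> \<le> t then F \<tau> x else 0))
     = (LINT \<tau>|?J. LINT x|M. (if \<tau> \<le> t then F \<tau> x else 0))"
    by (rule JM.Fubini_integral[OF Ft])
  also have "(\<lambda>\<tau>. LINT x|M. (if \<tau> \<le> t then F \<tau> x else 0)) = (\<lambda>\<tau>. if \<tau> \<le> t then LINT x|M. F \<tau> x else 0)"
    by auto
  finally show ?eq unfolding F_def[abs_def] .
qed

section \<open>Lebesgue norms and the energy identity\<close>

lemma epow_ennreal: "0 \<le> r \<Longrightarrow> epow (ennreal r) p = ennreal (r powr p)"
  by (simp add: epow_def)

lemma epow_epow: "epow (epow x p) q = epow x (p * q)"
  by (simp add: epow_def powr_powr)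

lemma epow_one [simp]: "epow x 1 = x"
  by (simp add: epow_def less_top)

lemma epow_two: "epow x 2 = x\<^sup>2"
  by (cases x) (auto simp: epow_def ennreal_power)

lemma measurable_epow [measurable]:
  assumes [measurable]: "f \<in> borel_measurable M"
  shows "(\<lambda>x. epow (f x) p) \<in> borel_measurable M"
  unfolding epow_def by measurable

lemma epow_Lp_norm:
  assumes "p \<noteq> 0"
  shows "epow (Lp_norm \<Omega> p u) p = (\<integral>\<^sup>+x. ennreal (norm (u x) powr p) \<partial>lebesgue_on \<Omega>)"
  using assms by (simp add: Lp_norm_def Lp_enorm_def epow_epow epow_ennreal)

lemma Lp_norm_2_power2:
  "(Lp_norm \<Omega> 2 u)\<^sup>2 = (\<integral>\<^sup>+x. ennreal ((norm (u x))\<^sup>2) \<partial>lebesgue_on \<Omega>)"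
  using epow_Lp_norm[of 2 \<Omega> u] by (simp add: epow_two)

lemma Lp_norm_2_real_power2:
  fixes u :: "'a::euclidean_space \<Rightarrow> real"
  shows "(Lp_norm \<Omega> 2 u)\<^sup>2 = (\<integral>\<^sup>+x. ennreal ((u x)\<^sup>2) \<partial>lebesgue_on \<Omega>)"
  by (simp add: Lp_norm_2_power2)

lemma Lp_space_2_iff:
  fixes u :: "'a::euclidean_space \<Rightarrow> 'b::{real_normed_vector, second_countable_topology}"
  shows "u \<in> Lp_space \<Omega> 2 \<longleftrightarrow>
    u \<in> borel_measurable (lebesgue_on \<Omega>) \<and> integrable (lebesgue_on \<Omega>) (\<lambda>x. (norm (u x))\<^sup>2)"
proof -
  have "Lp_norm \<Omega> 2 u < \<infinity> \<longleftrightarrow> (Lp_norm \<Omega> 2 u)\<^sup>2 < \<infinity>"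
    by (auto simp: power2_eq_square ennreal_mult_eq_top_iff less_top[symmetric])
  then show ?thesis
    by (auto simp: Lp_space_def Lp_norm_2_power2 integrable_iff_bounded)
qed

text \<open>This serves only to show finiteness, so a crude factor 2 replaces Minkowski: (u - v)^2
  \<le> 4 u^2 + 4 v^2 pointwise, and 4 X^2 + 4 Y^2 \<le> (2 X + 2 Y)^2 for the norms.\<close>

lemma Lp_norm_2_diff_le:
  fixes u v :: "'a::euclidean_space \<Rightarrow> real"
  assumes [measurable]: "u \<in> borel_measurable (lebesgue_on \<Omega>)" "v \<in> borel_measurable (lebesgue_on \<Omega>)"
  shows "Lp_norm \<Omega> 2 (\<lambda>x. u x - v x) \<le> 2 * (Lp_norm \<Omega> 2 u + Lp_norm \<Omega> 2 v)"
proof (rule ennreal_power2_le_imp_le)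
  have "(Lp_norm \<Omega> 2 (\<lambda>x. u x - v x))\<^sup>2
      \<le> (\<integral>\<^sup>+x. 4 * ennreal ((u x)\<^sup>2) + 4 * ennreal ((v x)\<^sup>2) \<partial>lebesgue_on \<Omega>)"
    unfolding Lp_norm_2_real_power2
  proof (intro nn_integral_mono)
    fix x
    have "(u x - v x)\<^sup>2 \<le> 4 * (u x)\<^sup>2 + 4 * (v x)\<^sup>2"
    proof -
      have "(u x - v x)\<^sup>2 + (u x + v x)\<^sup>2 = 2 * (u x)\<^sup>2 + 2 * (v x)\<^sup>2"
        by (simp add: power2_eq_square algebra_simps)
      then show ?thesis
        using zero_le_power2[of "u x + v x"] zero_le_power2[of "u x"] zero_le_power2[of "v x"]
        by linarith
    qed
    then have "ennreal ((u x - v x)\<^sup>2) \<le> ennreal (4 * (u x)\<^sup>2 + 4 * (v x)\<^sup>2)" by (rule ennreal_leI)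
    then show "ennreal ((u x - v x)\<^sup>2) \<le> 4 * ennreal ((u x)\<^sup>2) + 4 * ennreal ((v x)\<^sup>2)"
      by (simp add: ennreal_mult)
  qed
  also have "\<dots> = 4 * (Lp_norm \<Omega> 2 u)\<^sup>2 + 4 * (Lp_norm \<Omega> 2 v)\<^sup>2"
    unfolding Lp_norm_2_real_power2 by (simp add: nn_integral_add nn_integral_cmult)
  also have "\<dots> \<le> (2 * (Lp_norm \<Omega> 2 u + Lp_norm \<Omega> 2 v))\<^sup>2"
    by (simp add: power2_eq_square algebra_simps add_increasing2 add_increasing)
  finally show "(Lp_norm \<Omega> 2 (\<lambda>x. u x - v x))\<^sup>2 \<le> (2 * (Lp_norm \<Omega> 2 u + Lp_norm \<Omega> 2 v))\<^sup>2" .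
qed

lemma time_Lp_1: "time_Lp T 1 g = (\<integral>\<^sup>+t. g t \<partial>lebesgue_on {0..T})"
  by (simp add: time_Lp_def Lp_enorm_def)

lemma sigma_finite_lebesgue_on_lmeasurable: "S \<in> lmeasurable \<Longrightarrow> sigma_finite_measure (lebesgue_on S)"
  using finite_measure_lebesgue_on finite_measure.axioms(1) by blast

lemma spacetime_measurable_at:
  assumes "spacetime_measurable \<Omega> T u" "t \<in> {0..T}"
  shows "u t \<in> borel_measurable (lebesgue_on \<Omega>)"
  using measurable_Pair2[of "\<lambda>(t, x). u t x" "lebesgue_on {0..T}" "lebesgue_on \<Omega>" borel t] assms
  by (simp add: spacetime_measurable_def)

lemma measurable_Lp_norm_in_time:
  assumes \<Omega>: "\<Omega> \<in> lmeasurable" and u: "spacetime_measurable \<Omega> T u"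
  shows "(\<lambda>t. Lp_norm \<Omega> p (u t)) \<in> borel_measurable (lebesgue_on {0..T})"
proof -
  interpret sigma_finite_measure "lebesgue_on \<Omega>"
    by (rule sigma_finite_lebesgue_on_lmeasurable[OF \<Omega>])
  have "(\<lambda>(t, x). epow (ennreal (norm (case (t, x) of (t, x) \<Rightarrow> u t x))) p)
      \<in> borel_measurable (lebesgue_on {0..T} \<Otimes>\<^sub>M lebesgue_on \<Omega>)"
    using u unfolding spacetime_measurable_def case_prod_beta' by measurable
  then have "(\<lambda>t. \<integral>\<^sup>+x. epow (ennreal (norm (u t x))) p \<partial>lebesgue_on \<Omega>)
      \<in> borel_measurable (lebesgue_on {0..T})"
    by (intro borel_measurable_nn_integral) simp
  then show ?thesis unfolding Lp_norm_def Lp_enorm_def by measurable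
qed

text \<open>Passes from the integrals over {0..t} in \<open>has_time_derivative\<close> to the
  cut-off form on a fixed interval used by the chain rule.\<close>

lemma integral_lebesgue_on_initial:
  fixes f :: "real \<Rightarrow> real"
  assumes "t \<le> T"
  shows "(LINT \<tau>|lebesgue_on {0..t}. f \<tau>) = (LINT \<tau>|lebesgue_on {0..T}. (if \<tau> \<le> t then f \<tau> else 0))"
proof -
  have "(LINT \<tau>|lebesgue_on {0..t}. f \<tau>) = (LINT \<tau>|lebesgue. indicator {0..t} \<tau> *\<^sub>R f \<tau>)"
    by (rule integral_restrict_space) simp
  also have "\<dots> = (LINT \<tau>|lebesgue. indicator {0..T} \<tau> *\<^sub>R (if \<tau> \<le> t then f \<tau> else 0))"
    using assms by (intro Bochner_Integration.integral_cong) (auto simp: indicator_def)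
  also have "\<dots> = (LINT \<tau>|lebesgue_on {0..T}. (if \<tau> \<le> t then f \<tau> else 0))"
    by (rule integral_restrict_space[symmetric]) simp
  finally show ?thesis .
qed

text \<open>\<open>nn_integral_square_of_time_integral\<close> turns the L^1(I, L^2) bound in
  \<open>has_time_derivative\<close> into square integrability of the time integral of |u'|, which
  is the finiteness required by \<open>weighted_chain_rule\<close>.\<close>

lemma time_derivative_square_integrable:
  assumes \<Omega>: "\<Omega> \<in> lmeasurable" and u: "has_time_derivative \<Omega> T u u'"
  shows "(\<integral>\<^sup>+x. (\<integral>\<^sup>+t. ennreal \<bar>u' t x\<bar> \<partial>lebesgue_on {0..T})\<^sup>2 \<partial>lebesgue_on \<Omega>) < \<infinity>"
proof -
  have m: "spacetime_measurable \<Omega> T u'" using u by (simp add: has_time_derivative_def)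
  have "(\<integral>\<^sup>+x. (\<integral>\<^sup>+t. ennreal \<bar>u' t x\<bar> \<partial>lebesgue_on {0..T})\<^sup>2 \<partial>lebesgue_on \<Omega>)
     \<le> (\<integral>\<^sup>+t. Lp_norm \<Omega> 2 (u' t) \<partial>lebesgue_on {0..T})\<^sup>2"
  proof (rule nn_integral_square_of_time_integral)
    show "(\<lambda>(t, x). ennreal \<bar>u' t x\<bar>) \<in> borel_measurable (lebesgue_on {0..T} \<Otimes>\<^sub>M lebesgue_on \<Omega>)"
      using m unfolding spacetime_measurable_def case_prod_beta' by measurable
    show "(\<integral>\<^sup>+x. (ennreal \<bar>u' t x\<bar>)\<^sup>2 \<partial>lebesgue_on \<Omega>) = (Lp_norm \<Omega> 2 (u' t))\<^sup>2" for t
      by (simp add: Lp_norm_2_real_power2 ennreal_power)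
  qed (use \<Omega> m in \<open>auto intro: sigma_finite_lebesgue_on_lmeasurable measurable_Lp_norm_in_time\<close>)
  also have "\<dots> < \<infinity>"
    using u by (simp add: has_time_derivative_def time_Lp_1 power_less_top_ennreal)
  finally show ?thesis .
qed

text \<open>With zero weight and zero initial value the side conditions of
  \<open>weighted_chain_rule\<close> are trivial, apart from the finiteness just shown.\<close>

lemma AE_time_derivative_integrable:
  assumes \<Omega>: "\<Omega> \<in> lmeasurable" and u: "has_time_derivative \<Omega> T u u'"
  shows "AE x in lebesgue_on \<Omega>. integrable (lebesgue_on {0..T}) (\<lambda>t. u' t x)"
  by (rule weighted_chain_rule(3)[where u\<^sub>0 = "\<lambda>_. 0" and w = "\<lambda>_. 0" and W = 0, OF _ finite_measure_lebesgue_on[OF \<Omega>]])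
    (use u time_derivative_square_integrable[OF \<Omega> u]
      in \<open>auto simp: has_time_derivative_def spacetime_measurable_def\<close>)

text \<open>The time integral at a point x is additive only where both derivatives are integrable in
  time, hence the recourse to \<open>AE_time_derivative_integrable\<close>.\<close>

lemma has_time_derivative_diff:
  assumes \<Omega>: "\<Omega> \<in> lmeasurable" and u: "has_time_derivative \<Omega> T u u'" and v: "has_time_derivative \<Omega> T v v'"
  shows "has_time_derivative \<Omega> T (\<lambda>t x. u t x - v t x) (\<lambda>t x. u' t x - v' t x)"
  unfolding has_time_derivative_def
proof (intro conjI ballI)
  let ?J = "lebesgue_on {0..T}"
  have mu: "spacetime_measurable \<Omega> T u" "spacetime_measurable \<Omega> T u'"
    and mv: "spacetime_measurable \<Omega> T v" "spacetime_measurable \<Omega> T v'"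
    using u v by (auto simp: has_time_derivative_def)
  show "spacetime_measurable \<Omega> T (\<lambda>t x. u t x - v t x)" "spacetime_measurable \<Omega> T (\<lambda>t x. u' t x - v' t x)"
    using mu mv unfolding spacetime_measurable_def case_prod_beta' by measurable
  have "time_Lp T 1 (\<lambda>t. Lp_norm \<Omega> 2 (\<lambda>x. u' t x - v' t x))
      \<le> (\<integral>\<^sup>+t. 2 * (Lp_norm \<Omega> 2 (u' t) + Lp_norm \<Omega> 2 (v' t)) \<partial>?J)"
    unfolding time_Lp_1
    by (intro nn_integral_mono Lp_norm_2_diff_le spacetime_measurable_at[OF mu(2)] spacetime_measurable_at[OF mv(2)]) auto
  also have "\<dots> = 2 * (time_Lp T 1 (\<lambda>t. Lp_norm \<Omega> 2 (u' t)) + time_Lp T 1 (\<lambda>t. Lp_norm \<Omega> 2 (v' t)))"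
    unfolding time_Lp_1
    using measurable_Lp_norm_in_time[OF \<Omega> mu(2), of 2] measurable_Lp_norm_in_time[OF \<Omega> mv(2), of 2]
    by (simp add: nn_integral_cmult nn_integral_add)
  also have "\<dots> < \<infinity>" using u v by (simp add: has_time_derivative_def ennreal_mult_less_top)
  finally show "time_Lp T 1 (\<lambda>t. Lp_norm \<Omega> 2 (\<lambda>x. u' t x - v' t x)) < \<infinity>" .
  fix t assume t: "t \<in> {0..T}"
  have "AE x in lebesgue_on \<Omega>. u t x = u 0 x + (LINT \<tau>|lebesgue_on {0..t}. u' \<tau> x)"
    and "AE x in lebesgue_on \<Omega>. v t x = v 0 x + (LINT \<tau>|lebesgue_on {0..t}. v' \<tau> x)"
    using u v t by (auto simp: has_time_derivative_def)
  with AE_time_derivative_integrable[OF \<Omega> u] AE_time_derivative_integrable[OF \<Omega> v]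
  show "AE x in lebesgue_on \<Omega>. u t x - v t x
      = u 0 x - v 0 x + (LINT \<tau>|lebesgue_on {0..t}. u' \<tau> x - v' \<tau> x)"
  proof eventually_elim
    case (elim x)
    have "integrable (lebesgue_on {0..t}) (\<lambda>\<tau>. u' \<tau> x)" "integrable (lebesgue_on {0..t}) (\<lambda>\<tau>. v' \<tau> x)"
      using elim t by (auto elim!: integrable_subinterval)
    then show ?case using elim by simp
  qed
qed

text \<open>For each t, u equals its primitive only off a null set that may depend on t.
  \<open>R\<close> is the primitive at every point and jointly measurable, so
  \<open>weighted_chain_rule\<close> applies to it; the null sets then disappear inside spatial
  integrals, one t at a time.\<close>

lemma energy_identity:
  fixes u u' :: "real \<Rightarrow> 'a::euclidean_space \<Rightarrow> real" and w :: "'a \<Rightarrow> real"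
  assumes \<Omega>: "\<Omega> \<in> lmeasurable" and T: "0 \<le> T" and u: "has_time_derivative \<Omega> T u u'"
    and u0: "integrable (lebesgue_on \<Omega>) (\<lambda>x. (u 0 x)\<^sup>2)"
    and w: "w \<in> borel_measurable (lebesgue_on \<Omega>)" "\<And>x. x \<in> \<Omega> \<Longrightarrow> \<bar>w x\<bar> \<le> W"
  shows "integrable (lebesgue_on {0..T}) (\<lambda>\<tau>. pairing \<Omega> (\<lambda>x. w x * u' \<tau> x) (u \<tau>))" (is ?int)
    and "\<And>t. t \<in> {0..T} \<Longrightarrow> (LINT x|lebesgue_on \<Omega>. w x * (u t x)\<^sup>2)
      = (LINT x|lebesgue_on \<Omega>. w x * (u 0 x)\<^sup>2)
        + 2 * (LINT \<tau>|lebesgue_on {0..T}. (if \<tau> \<le> t then pairing \<Omega> (\<lambda>x. w x * u' \<tau> x) (u \<tau>) else 0))"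
proof -
  let ?J = "lebesgue_on {0..T}" and ?M = "lebesgue_on \<Omega>"
  define R where "R t x = u 0 x + (LINT \<sigma>|?J. (if \<sigma> \<le> t then u' \<sigma> x else 0))" for t x
  have mu: "spacetime_measurable \<Omega> T u" "spacetime_measurable \<Omega> T u'"
    using u by (auto simp: has_time_derivative_def)
  have um: "u t \<in> borel_measurable ?M" "u' t \<in> borel_measurable ?M" if "t \<in> {0..T}" for t
    using spacetime_measurable_at mu that by blast+
  have g: "(\<lambda>(t, x). u' t x) \<in> borel_measurable (?J \<Otimes>\<^sub>M ?M)"
    using mu(2) by (simp add: spacetime_measurable_def)
  have w': "\<And>x. x \<in> space ?M \<Longrightarrow> \<bar>w x\<bar> \<le> W" using w(2) by simp
  have u0m: "u 0 \<in> borel_measurable ?M" using um(1)[of 0] T by simp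
  note chain = weighted_chain_rule[OF lmeasurable_interval(1) finite_measure_lebesgue_on[OF \<Omega>] g
      time_derivative_square_integrable[OF \<Omega> u] u0m u0 w(1) w' R_def]
  have uR: "AE x in ?M. u t x = R t x" if "t \<in> {0..T}" for t
  proof -
    have "AE x in ?M. u t x = u 0 x + (LINT \<tau>|lebesgue_on {0..t}. u' \<tau> x)"
      using u that by (auto simp: has_time_derivative_def)
    moreover have "t \<le> T" using that by simp
    ultimately show ?thesis by (simp only: R_def integral_lebesgue_on_initial)
  qed
  have p: "(LINT x|?M. w x * u' t x * R t x) = pairing \<Omega> (\<lambda>x. w x * u' t x) (u t)" if t: "t \<in> {0..T}" for t
    unfolding pairing_def inner_real_def
  proof (rule integral_cong_AE)
    show "AE x in ?M. w x * u' t x * R t x = w x * u' t x * u t x"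
      using uR[OF t] by (rule eventually_mono) simp
  qed (use w(1) um[OF t] chain(4)[of t] in measurable)
  show ?int
    using chain(1) by (subst Bochner_Integration.integrable_cong[OF refl p[symmetric]]) auto
  fix t assume t: "t \<in> {0..T}"
  have "(LINT x|?M. w x * (u t x)\<^sup>2) = (LINT x|?M. w x * (R t x)\<^sup>2)"
  proof (rule integral_cong_AE)
    show "AE x in ?M. w x * (u t x)\<^sup>2 = w x * (R t x)\<^sup>2"
      using uR[OF t] by (rule eventually_mono) simp
  qed (use w(1) um[OF t] chain(4)[of t] in measurable)
  also have "\<dots> = (LINT x|?M. w x * (u 0 x)\<^sup>2)
      + 2 * (LINT \<tau>|?J. (if \<tau> \<le> t then LINT x|?M. w x * u' \<tau> x * R \<tau> x else 0))"
    by (rule chain(2))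
  also have "(LINT \<tau>|?J. (if \<tau> \<le> t then LINT x|?M. w x * u' \<tau> x * R \<tau> x else 0))
      = (LINT \<tau>|?J. (if \<tau> \<le> t then pairing \<Omega> (\<lambda>x. w x * u' \<tau> x) (u \<tau>) else 0))"
    using p by (intro Bochner_Integration.integral_cong) auto
  finally show "(LINT x|?M. w x * (u t x)\<^sup>2) = (LINT x|?M. w x * (u 0 x)\<^sup>2)
      + 2 * (LINT \<tau>|?J. (if \<tau> \<le> t then pairing \<Omega> (\<lambda>x. w x * u' \<tau> x) (u \<tau>) else 0))" .
qed

section \<open>Square-integrable functions and discrete spaces\<close>

lemma integrable_inner_L2:
  fixes u v :: "'a::euclidean_space \<Rightarrow> 'b::euclidean_space"
  assumes u: "u \<in> Lp_space \<Omega> 2" and v: "v \<in> Lp_space \<Omega> 2"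
  shows "integrable (lebesgue_on \<Omega>) (\<lambda>x. u x \<bullet> v x)"
proof (rule Bochner_Integration.integrable_bound)
  show "integrable (lebesgue_on \<Omega>) (\<lambda>x. (norm (u x))\<^sup>2 + (norm (v x))\<^sup>2)"
    using u v by (simp add: Lp_space_2_iff)
  show "(\<lambda>x. u x \<bullet> v x) \<in> borel_measurable (lebesgue_on \<Omega>)"
    using u v by (auto simp: Lp_space_2_iff)
  have "norm (u x \<bullet> v x) \<le> norm ((norm (u x))\<^sup>2 + (norm (v x))\<^sup>2)" for x
  proof -
    have "\<bar>u x \<bullet> v x\<bar> \<le> norm (u x) * norm (v x)" by (rule Cauchy_Schwarz_ineq2)
    moreover have "2 * (norm (u x) * norm (v x)) \<le> (norm (u x))\<^sup>2 + (norm (v x))\<^sup>2"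
      using sum_squares_bound[of "norm (u x)" "norm (v x)"] by (simp add: ac_simps)
    moreover have "0 \<le> norm (u x) * norm (v x)" by simp
    ultimately show ?thesis by simp
  qed
  then show "AE x in lebesgue_on \<Omega>. norm (u x \<bullet> v x) \<le> norm ((norm (u x))\<^sup>2 + (norm (v x))\<^sup>2)"
    by (rule AE_I2)
qed

lemma L2_diff:
  fixes u v :: "'a::euclidean_space \<Rightarrow> 'b::euclidean_space"
  assumes u: "u \<in> Lp_space \<Omega> 2" and v: "v \<in> Lp_space \<Omega> 2"
  shows "(\<lambda>x. u x - v x) \<in> Lp_space \<Omega> 2"
proof -
  have "(norm (u x - v x))\<^sup>2 = (norm (u x))\<^sup>2 + (norm (v x))\<^sup>2 - 2 * (u x \<bullet> v x)" for x
    by (simp add: power2_norm_eq_inner inner_diff_left inner_diff_right inner_commute)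
  moreover have "(\<lambda>x. u x - v x) \<in> borel_measurable (lebesgue_on \<Omega>)"
    using u v by (auto simp: Lp_space_2_iff)
  ultimately show ?thesis
    using integrable_inner_L2[OF u v] u v by (simp add: Lp_space_2_iff)
qed

lemma pairing_diff_left:
  fixes u v w :: "'a::euclidean_space \<Rightarrow> 'b::euclidean_space"
  assumes "u \<in> Lp_space \<Omega> 2" "v \<in> Lp_space \<Omega> 2" "w \<in> Lp_space \<Omega> 2"
  shows "pairing \<Omega> (\<lambda>x. u x - v x) w = pairing \<Omega> u w - pairing \<Omega> v w"
  using assms by (simp add: pairing_def inner_diff_left integrable_inner_L2)

lemma pairing_commute: "pairing \<Omega> u v = pairing \<Omega> v u"
  by (simp add: pairing_def inner_commute)

lemma AE_bounded_imp_L2: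
  fixes u :: "'a::euclidean_space \<Rightarrow> 'b::euclidean_space"
  assumes \<Omega>: "\<Omega> \<in> lmeasurable" and u: "u \<in> borel_measurable (lebesgue_on \<Omega>)"
    and B: "AE x in lebesgue_on \<Omega>. norm (u x) \<le> B"
  shows "u \<in> Lp_space \<Omega> 2"
proof -
  interpret finite_measure "lebesgue_on \<Omega>" by (rule finite_measure_lebesgue_on[OF \<Omega>])
  have "integrable (lebesgue_on \<Omega>) (\<lambda>x. (norm (u x))\<^sup>2)"
  proof (rule integrable_const_bound)
    show "AE x in lebesgue_on \<Omega>. norm ((norm (u x))\<^sup>2) \<le> B\<^sup>2"
      using B by (rule eventually_mono) (auto intro: power_mono)
  qed (use u in measurable)
  then show ?thesis using u by (simp add: Lp_space_2_iff)
qed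

lemma L2_mult_bounded:
  fixes u w :: "'a::euclidean_space \<Rightarrow> real"
  assumes u: "u \<in> Lp_space \<Omega> 2" and w: "w \<in> borel_measurable (lebesgue_on \<Omega>)"
    and W: "\<And>x. x \<in> \<Omega> \<Longrightarrow> \<bar>w x\<bar> \<le> W"
  shows "(\<lambda>x. w x * u x) \<in> Lp_space \<Omega> 2"
proof -
  have "integrable (lebesgue_on \<Omega>) (\<lambda>x. (norm (w x * u x))\<^sup>2)"
  proof (rule Bochner_Integration.integrable_bound)
    show "integrable (lebesgue_on \<Omega>) (\<lambda>x. W\<^sup>2 * (norm (u x))\<^sup>2)"
      using u by (simp add: Lp_space_2_iff)
    have "norm ((norm (w x * u x))\<^sup>2) \<le> norm (W\<^sup>2 * (norm (u x))\<^sup>2)" if "x \<in> space (lebesgue_on \<Omega>)" for x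
      using W[of x] that power_mono[OF W[of x], of 2] by (simp add: power_mult_distrib mult_right_mono)
    then show "AE x in lebesgue_on \<Omega>. norm ((norm (w x * u x))\<^sup>2) \<le> norm (W\<^sup>2 * (norm (u x))\<^sup>2)"
      by (rule AE_I2)
  qed (use u w in \<open>auto simp: Lp_space_2_iff\<close>)
  then show ?thesis using u w by (auto simp: Lp_space_2_iff)
qed

lemma continuous_on_closure_bounded:
  fixes u :: "'a::euclidean_space \<Rightarrow> 'b::euclidean_space"
  assumes "bounded \<Omega>" "continuous_on (closure \<Omega>) u"
  obtains B where "0 \<le> B" "\<And>x. x \<in> \<Omega> \<Longrightarrow> norm (u x) \<le> B"
proof -
  have "compact (u ` closure \<Omega>)"
    using assms by (intro compact_continuous_image) (auto simp: compact_closure)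
  then have "bounded (u ` closure \<Omega>)" by (rule compact_imp_bounded)
  then obtain B where "B > 0" and B: "\<And>y. y \<in> u ` closure \<Omega> \<Longrightarrow> norm y \<le> B"
    unfolding bounded_pos by blast
  moreover have "norm (u x) \<le> B" if "x \<in> \<Omega>" for x
    using that closure_subset[of \<Omega>] by (intro B imageI) auto
  ultimately show ?thesis by (intro that[of B]) simp_all
qed

lemma continuous_on_closure_measurable:
  fixes u :: "'a::euclidean_space \<Rightarrow> 'b::euclidean_space"
  assumes "\<Omega> \<in> sets lebesgue" "continuous_on (closure \<Omega>) u"
  shows "u \<in> borel_measurable (lebesgue_on \<Omega>)"
  by (rule continuous_imp_measurable_on_sets_lebesgue)
    (use assms continuous_on_subset[OF assms(2) closure_subset] in auto)

lemma continuous_on_closure_L2: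
  fixes u :: "'a::euclidean_space \<Rightarrow> 'b::euclidean_space"
  assumes "\<Omega> \<in> lmeasurable" "bounded \<Omega>" "continuous_on (closure \<Omega>) u"
  shows "u \<in> Lp_space \<Omega> 2"
proof -
  obtain B where B: "\<And>x. x \<in> \<Omega> \<Longrightarrow> norm (u x) \<le> B"
    using continuous_on_closure_bounded[OF assms(2,3)] by blast
  have "u \<in> borel_measurable (lebesgue_on \<Omega>)"
    using assms by (intro continuous_on_closure_measurable) auto
  moreover have "AE x in lebesgue_on \<Omega>. norm (u x) \<le> B"
    by (rule AE_I2) (simp add: B)
  ultimately show ?thesis by (rule AE_bounded_imp_L2[OF assms(1)])
qed

lemma polynomials_diff:
  assumes "p \<in> polynomials k" "q \<in> polynomials k"
  shows "(\<lambda>x. p x - q x) \<in> polynomials k"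
proof -
  from assms obtain c d where
    "\<And>x. p x = (\<Sum>\<mu> \<in> {\<mu> \<in> Basis \<rightarrow>\<^sub>E (UNIV :: nat set). (\<Sum>b\<in>Basis. \<mu> b) \<le> k}. (\<Prod>b\<in>Basis. (x \<bullet> b) ^ \<mu> b) *\<^sub>R c \<mu>)"
    "\<And>x. q x = (\<Sum>\<mu> \<in> {\<mu> \<in> Basis \<rightarrow>\<^sub>E (UNIV :: nat set). (\<Sum>b\<in>Basis. \<mu> b) \<le> k}. (\<Prod>b\<in>Basis. (x \<bullet> b) ^ \<mu> b) *\<^sub>R d \<mu>)"
    unfolding polynomials_def by blast
  then show ?thesis
    unfolding polynomials_def
    by (intro CollectI exI[of _ "\<lambda>\<mu>. c \<mu> - d \<mu>"]) (simp add: scaleR_diff_right sum_subtractf)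
qed

lemma fe_space_diff:
  assumes u: "u \<in> fe_space \<Omega> \<T> k" and v: "v \<in> fe_space \<Omega> \<T> k"
  shows "(\<lambda>x. u x - v x) \<in> fe_space \<Omega> \<T> k"
  unfolding fe_space_def
proof (intro CollectI conjI ballI)
  show "continuous_on (closure \<Omega>) (\<lambda>x. u x - v x)"
    using u v by (auto simp: fe_space_def intro: continuous_on_diff)
  fix \<tau> assume "\<tau> \<in> \<T>"
  with u v obtain p q where "p \<in> polynomials k" "q \<in> polynomials k"
    and "\<forall>x\<in>\<tau>. u x = p x" "\<forall>x\<in>\<tau>. v x = q x"
    unfolding fe_space_def by blast
  then show "\<exists>p\<in>polynomials k. \<forall>x\<in>\<tau>. u x - v x = p x"
    by (intro bexI[of _ "\<lambda>x. p x - q x"] polynomials_diff) auto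
qed

text \<open>Test functions and their gradients are continuous on the compact closure, hence square
  integrable, so all pairings in the definition split. This provides a divergence for the difference
  of two discrete fluxes.\<close>

lemma has_L2_divergence_diff:
  assumes \<Omega>: "\<Omega> \<in> lmeasurable" "bounded \<Omega>"
    and u: "has_L2_divergence \<Omega> u du" "u \<in> Lp_space \<Omega> 2"
    and v: "has_L2_divergence \<Omega> v dv" "v \<in> Lp_space \<Omega> 2"
  shows "has_L2_divergence \<Omega> (\<lambda>x. u x - v x) (\<lambda>x. du x - dv x)"
  unfolding has_L2_divergence_def
proof (intro conjI allI impI)
  have d: "du \<in> Lp_space \<Omega> 2" "dv \<in> Lp_space \<Omega> 2"
    using u(1) v(1) by (auto simp: has_L2_divergence_def)
  show "(\<lambda>x. du x - dv x) \<in> Lp_space \<Omega> 2" by (rule L2_diff[OF d])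
  fix \<eta> G
  assume \<eta>: "\<forall>x. GDERIV \<eta> x :> G x" and G: "continuous_on UNIV G"
    and supp: "compact (closure {x. \<eta> x \<noteq> 0})" "closure {x. \<eta> x \<noteq> 0} \<subseteq> \<Omega>"
  have "continuous_on (closure \<Omega>) \<eta>"
    using \<eta> by (intro continuous_at_imp_continuous_on ballI)
      (auto simp: gderiv_def intro: has_derivative_continuous)
  then have "\<eta> \<in> Lp_space \<Omega> 2" by (rule continuous_on_closure_L2[OF \<Omega>])
  moreover have "G \<in> Lp_space \<Omega> 2"
    using G by (intro continuous_on_closure_L2[OF \<Omega>]) (rule continuous_on_subset, auto)
  moreover have "pairing \<Omega> u G = - pairing \<Omega> du \<eta>" "pairing \<Omega> v G = - pairing \<Omega> dv \<eta>"
    using u(1) v(1) \<eta> G supp unfolding has_L2_divergence_def by blast+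
  ultimately show "pairing \<Omega> (\<lambda>x. u x - v x) G = - pairing \<Omega> (\<lambda>x. du x - dv x) \<eta>"
    using d u(2) v(2) by (simp add: pairing_diff_left)
qed

text \<open>Applied both to one solution and to the difference of two. Integrability of g is a
  conclusion: 0 \<le> g \<le> b - p almost everywhere, where p is the pairing with the time
  derivative, integrable by \<open>energy_identity\<close>. Since b \<ge> 0, its integral may be
  extended from {0..t} to the whole interval, which makes the right-hand side independent of
  t.\<close>

lemma energy_inequality:
  fixes u u' :: "real \<Rightarrow> 'a::euclidean_space \<Rightarrow> real" and w :: "'a \<Rightarrow> real" and g b :: "real \<Rightarrow> real"
  assumes \<Omega>: "\<Omega> \<in> lmeasurable" and T: "0 \<le> T" and u: "has_time_derivative \<Omega> T u u'"
    and u0: "integrable (lebesgue_on \<Omega>) (\<lambda>x. (u 0 x)\<^sup>2)"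
    and w: "w \<in> borel_measurable (lebesgue_on \<Omega>)" "\<And>x. x \<in> \<Omega> \<Longrightarrow> \<bar>w x\<bar> \<le> W"
    and g: "g \<in> borel_measurable (lebesgue_on {0..T})" "\<And>t. 0 \<le> g t"
    and b: "integrable (lebesgue_on {0..T}) b" "\<And>t. 0 \<le> b t"
    and ineq: "AE t in lebesgue_on {0..T}. g t + pairing \<Omega> (\<lambda>x. w x * u' t x) (u t) \<le> b t"
  shows "integrable (lebesgue_on {0..T}) g"
    and "\<And>t. t \<in> {0..T} \<Longrightarrow>
      (LINT x|lebesgue_on \<Omega>. w x * (u t x)\<^sup>2) / 2 + (LINT \<tau>|lebesgue_on {0..T}. (if \<tau> \<le> t then g \<tau> else 0))
      \<le> (LINT x|lebesgue_on \<Omega>. w x * (u 0 x)\<^sup>2) / 2 + (LINT \<tau>|lebesgue_on {0..T}. b \<tau>)"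
proof -
  let ?J = "lebesgue_on {0..T}"
  define p where "p t = pairing \<Omega> (\<lambda>x. w x * u' t x) (u t)" for t
  note en = energy_identity[OF \<Omega> T u u0 w, folded p_def]
  have p: "integrable ?J p" using en(1) by simp
  have [measurable]: "(\<lambda>x. x) \<in> borel_measurable ?J"
    using id_borel_measurable_lebesgue_on[of "{0..T}"] by (simp add: id_def)
  note [measurable] = g(1) borel_measurable_integrable[OF p] borel_measurable_integrable[OF b(1)]
  show gi: "integrable ?J g"
  proof (rule Bochner_Integration.integrable_bound)
    show "integrable ?J (\<lambda>t. b t - p t)" using b(1) p by simp
    show "AE t in ?J. norm (g t) \<le> norm (b t - p t)"
      using ineq[folded p_def]
    proof (rule eventually_mono)
      fix t assume "g t + p t \<le> b t"
      then show "norm (g t) \<le> norm (b t - p t)" using g(2)[of t] by simp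
    qed
  qed measurable
  fix t assume t: "t \<in> {0..T}"
  let ?r = "\<lambda>h \<tau>. (if \<tau> \<le> t then h \<tau> else 0 :: real)"
  have ri: "integrable ?J (?r h)" if "integrable ?J h" for h
    by (rule Bochner_Integration.integrable_bound[OF that]) (use that in auto)
  have "(LINT \<tau>|?J. ?r g \<tau>) + (LINT \<tau>|?J. ?r p \<tau>) = (LINT \<tau>|?J. ?r g \<tau> + ?r p \<tau>)"
    by (rule Bochner_Integration.integral_add[OF ri[OF gi] ri[OF p], symmetric])
  also have "\<dots> \<le> (LINT \<tau>|?J. b \<tau>)"
  proof (rule integral_mono_AE)
    show "integrable ?J (\<lambda>\<tau>. ?r g \<tau> + ?r p \<tau>)"
      by (rule Bochner_Integration.integrable_add[OF ri[OF gi] ri[OF p]])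
    show "AE \<tau> in ?J. ?r g \<tau> + ?r p \<tau> \<le> b \<tau>"
      using ineq[folded p_def] by (rule eventually_mono) (use b(2) in auto)
  qed (rule b(1))
  finally show "(LINT x|lebesgue_on \<Omega>. w x * (u t x)\<^sup>2) / 2 + (LINT \<tau>|?J. ?r g \<tau>)
      \<le> (LINT x|lebesgue_on \<Omega>. w x * (u 0 x)\<^sup>2) / 2 + (LINT \<tau>|?J. b \<tau>)"
    using en(2)[OF _ t] by (simp add: add_divide_distrib)
qed

section \<open>Energy estimates for the discrete problem\<close>

lemma grad_eq:
  assumes "GDERIV u x :> D"
  shows "grad u x = D"
  unfolding grad_def
proof (rule the_equality)
  show "GDERIV u x :> D" by fact
  fix E assume "GDERIV u x :> E"
  then have "(\<lambda>h. h \<bullet> E) = (\<lambda>h. h \<bullet> D)"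
    using assms unfolding gderiv_def by (rule has_derivative_unique)
  then have "(E - D) \<bullet> (E - D) = 0"
    by (metis inner_diff_right diff_self)
  then show "E = D" by simp
qed

lemma C12_bounds:
  fixes \<Psi> :: "real \<Rightarrow> 'a::euclidean_space \<Rightarrow> real"
  assumes \<Omega>: "open \<Omega>" "bounded \<Omega>" and T: "0 < T" and \<Psi>: "C12 \<Omega> T \<Psi>"
  obtains K where "0 \<le> K"
    and "\<And>t. t \<in> {0..T} \<Longrightarrow> grad (\<Psi> t) \<in> Lp_space \<Omega> 2"
    and "\<And>t. t \<in> {0..T} \<Longrightarrow> time_deriv T \<Psi> t \<in> Lp_space \<Omega> 2"
    and "\<And>t x. t \<in> {0..T} \<Longrightarrow> x \<in> \<Omega> \<Longrightarrow> norm (grad (\<Psi> t) x) \<le> K"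
    and "\<And>t x. t \<in> {0..T} \<Longrightarrow> x \<in> \<Omega> \<Longrightarrow> \<bar>time_deriv T \<Psi> t x\<bar> \<le> K"
    and "\<And>t. t \<in> {0..T} \<Longrightarrow> \<Psi> t \<in> Lp_space \<Omega> 2"
proof -
  from \<Psi> obtain G u' where
    cont: "continuous_on ({0..T} \<times> closure \<Omega>) (\<lambda>(t, x). \<Psi> t x)"
      "continuous_on ({0..T} \<times> closure \<Omega>) (\<lambda>(t, x). G t x)"
      "continuous_on ({0..T} \<times> closure \<Omega>) (\<lambda>(t, x). u' t x)"
    and G: "\<And>t x. t \<in> {0..T} \<Longrightarrow> x \<in> \<Omega> \<Longrightarrow> GDERIV (\<Psi> t) x :> G t x"
    and u': "\<And>t x. t \<in> {0..T} \<Longrightarrow> x \<in> \<Omega> \<Longrightarrow>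
       ((\<lambda>\<tau>. \<Psi> \<tau> x) has_real_derivative u' t x) (at t within {0..T})"
    unfolding C12_def by blast
  have lm: "\<Omega> \<in> lmeasurable" using \<Omega> by (simp add: lmeasurable_open)
  have slice: "h t \<in> Lp_space \<Omega> 2"
    if "continuous_on ({0..T} \<times> closure \<Omega>) (\<lambda>(t, x). h t x)" "t \<in> {0..T}"
    for h :: "real \<Rightarrow> 'a \<Rightarrow> 'b::euclidean_space" and t
  proof -
    have "continuous_on (closure \<Omega>) (\<lambda>x. case (t, x) of (t, x) \<Rightarrow> h t x)"
      by (rule continuous_on_compose2[OF that(1)]) (use that(2) in \<open>auto intro!: continuous_intros\<close>)
    then show ?thesis using continuous_on_closure_L2[OF lm \<Omega>(2)] by simp
  qed
  have bound: "\<exists>B\<ge>0. \<forall>t\<in>{0..T}. \<forall>x\<in>\<Omega>. norm (h t x) \<le> B"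
    if "continuous_on ({0..T} \<times> closure \<Omega>) (\<lambda>(t, x). h t x)"
    for h :: "real \<Rightarrow> 'a \<Rightarrow> 'b::euclidean_space"
  proof -
    have "compact ((\<lambda>(t, x). h t x) ` ({0..T} \<times> closure \<Omega>))"
      using \<Omega> that by (intro compact_continuous_image compact_Times) (auto simp: compact_closure)
    then have "bounded ((\<lambda>(t, x). h t x) ` ({0..T} \<times> closure \<Omega>))" by (rule compact_imp_bounded)
    then obtain B where "B > 0" and B: "\<forall>y\<in>(\<lambda>(t, x). h t x) ` ({0..T} \<times> closure \<Omega>). norm y \<le> B"
      unfolding bounded_pos by blast
    have "norm (h t x) \<le> B" if "t \<in> {0..T}" "x \<in> \<Omega>" for t x
    proof -
      have "x \<in> closure \<Omega>" using that closure_subset by blast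
      then have "h t x \<in> (\<lambda>(t, x). h t x) ` ({0..T} \<times> closure \<Omega>)"
        using that(1) by (intro image_eqI[of _ _ "(t, x)"]) auto
      then show ?thesis using B by blast
    qed
    then show ?thesis using \<open>B > 0\<close> by (intro exI[of _ B]) simp
  qed
  obtain K1 where K1: "0 \<le> K1" "\<forall>t\<in>{0..T}. \<forall>x\<in>\<Omega>. norm (G t x) \<le> K1" using bound[OF cont(2)] by blast
  obtain K2 where K2: "0 \<le> K2" "\<forall>t\<in>{0..T}. \<forall>x\<in>\<Omega>. norm (u' t x) \<le> K2" using bound[OF cont(3)] by blast
  have eqG: "grad (\<Psi> t) x = G t x" if "t \<in> {0..T}" "x \<in> \<Omega>" for t x
    by (rule grad_eq[OF G[OF that]])
  \<comment> \<open>T > 0 makes the derivative within {0..T} unique, also the one-sided ones at the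
    endpoints.\<close>
  have equ: "time_deriv T \<Psi> t x = u' t x" if "t \<in> {0..T}" "x \<in> \<Omega>" for t x
    unfolding time_deriv_def
  proof (rule vector_derivative_within_closed_interval)
    show "((\<lambda>\<tau>. \<Psi> \<tau> x) has_vector_derivative u' t x) (at t within {0..T})"
      using u'[OF that] by (simp add: has_real_derivative_iff_has_vector_derivative)
  qed (use T that in auto)
  have L2_cong: "v \<in> Lp_space \<Omega> 2" if "u \<in> Lp_space \<Omega> 2" "\<And>x. x \<in> \<Omega> \<Longrightarrow> v x = u x"
    for u v :: "'a \<Rightarrow> 'b::euclidean_space"
  proof -
    have "v \<in> borel_measurable (lebesgue_on \<Omega>) \<longleftrightarrow> u \<in> borel_measurable (lebesgue_on \<Omega>)"
      by (rule measurable_cong) (simp add: that(2))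
    moreover have "integrable (lebesgue_on \<Omega>) (\<lambda>x. (norm (v x))\<^sup>2)
        \<longleftrightarrow> integrable (lebesgue_on \<Omega>) (\<lambda>x. (norm (u x))\<^sup>2)"
      by (rule Bochner_Integration.integrable_cong[OF refl]) (simp add: that(2))
    ultimately show ?thesis using that(1) by (simp add: Lp_space_2_iff)
  qed
  show ?thesis
  proof (rule that[of "max K1 K2"])
    show "grad (\<Psi> t) \<in> Lp_space \<Omega> 2" if "t \<in> {0..T}" for t
      by (rule L2_cong[OF slice[OF cont(2) that] eqG[OF that]])
    show "time_deriv T \<Psi> t \<in> Lp_space \<Omega> 2" if "t \<in> {0..T}" for t
      by (rule L2_cong[OF slice[OF cont(3) that] equ[OF that]])
    show "\<Psi> t \<in> Lp_space \<Omega> 2" if "t \<in> {0..T}" for t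
      by (rule slice[OF cont(1) that])
    show "norm (grad (\<Psi> t) x) \<le> max K1 K2" if "t \<in> {0..T}" "x \<in> \<Omega>" for t x
      using K1(2) that by (fastforce simp: eqG)
    show "\<bar>time_deriv T \<Psi> t x\<bar> \<le> max K1 K2" if "t \<in> {0..T}" "x \<in> \<Omega>" for t x
      using K2(2) that by (fastforce simp: equ)
  qed (use K1 in auto)
qed

lemma AE_time_derivative_L2:
  assumes \<Omega>: "\<Omega> \<in> lmeasurable" and u: "has_time_derivative \<Omega> T u u'"
  shows "AE t in lebesgue_on {0..T}. u' t \<in> Lp_space \<Omega> 2"
proof -
  have m: "spacetime_measurable \<Omega> T u'" using u by (simp add: has_time_derivative_def)
  have "AE t in lebesgue_on {0..T}. Lp_norm \<Omega> 2 (u' t) \<noteq> \<infinity>"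
  proof (rule nn_integral_PInf_AE)
    show "(\<lambda>t. Lp_norm \<Omega> 2 (u' t)) \<in> borel_measurable (lebesgue_on {0..T})"
      by (rule measurable_Lp_norm_in_time[OF \<Omega> m])
    show "(\<integral>\<^sup>+t. Lp_norm \<Omega> 2 (u' t) \<partial>lebesgue_on {0..T}) \<noteq> \<infinity>"
      using u by (auto simp: has_time_derivative_def time_Lp_1)
  qed
  moreover have "AE t in lebesgue_on {0..T}. t \<in> {0..T}"
    by (rule AE_I2) simp
  ultimately show ?thesis
    by eventually_elim (simp add: Lp_space_def spacetime_measurable_at[OF m] less_top)
qed

section \<open>Problem data and the bounds they provide\<close>

locale forchheimer_data = forchheimer_exponents N \<alpha> \<alpha>' s
  for N :: nat and \<alpha> :: "int \<Rightarrow> real" and \<alpha>' s :: real +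
  fixes \<Omega> :: "'a::euclidean_space set" and T a_lo a_hi b_hi \<phi>_lo \<phi>_hi :: real and D :: "(int \<Rightarrow> real) set"
    and \<phi> :: "'a \<Rightarrow> real" and f \<Psi> :: "real \<Rightarrow> 'a \<Rightarrow> real"
  assumes open_\<Omega>: "open \<Omega>" and bounded_\<Omega>: "bounded \<Omega>" and T: "0 < T"
    and a_lo: "0 < a_lo" and D: "D \<subseteq> coeff_box N a_lo a_hi"
    and \<phi>_measurable: "\<phi> \<in> borel_measurable (lebesgue_on \<Omega>)" and \<phi>_lo: "0 < \<phi>_lo"
    and \<phi>: "\<And>x. x \<in> \<Omega> \<Longrightarrow> \<phi>_lo \<le> \<phi> x \<and> \<phi> x \<le> \<phi>_hi"
    and f_measurable: "spacetime_measurable \<Omega> T f"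
    and f_bounded: "time_Linf T (\<lambda>t. Lp_norm \<Omega> 2 (f t)) < \<infinity>"
    and \<Psi>: "C12 \<Omega> T \<Psi>"
begin

abbreviation "J \<equiv> lebesgue_on {0..T}"
abbreviation "M \<equiv> lebesgue_on \<Omega>"

definition "vol = measure M \<Omega>"
text \<open>Half of the constant of strong monotonicity of the flux; the other half absorbs the terms
  estimated by Young's inequality.\<close>

definition "\<kappa> = a_lo * (1/2) powr (s - 1) / 2"

lemma \<kappa>_pos: "0 < \<kappa>"
  using a_lo by (simp add: \<kappa>_def)

lemma \<Omega>_lmeasurable: "\<Omega> \<in> lmeasurable"
  using open_\<Omega> bounded_\<Omega> by (simp add: lmeasurable_open)

sublocale M: finite_measure M
  by (rule finite_measure_lebesgue_on[OF \<Omega>_lmeasurable])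

sublocale J: finite_measure J
  by (rule finite_measure_lebesgue_on) simp

lemma measure_J: "measure J {0..T} = T"
  using T by (simp add: measure_restrict_space)

lemma vol_nonneg: "0 \<le> vol"
  by (simp add: vol_def)

lemma \<phi>_abs: "x \<in> \<Omega> \<Longrightarrow> \<bar>\<phi> x\<bar> \<le> \<phi>_hi"
  using \<phi>[of x] \<phi>_lo by simp

lemma \<phi>_mult_L2: "u \<in> Lp_space \<Omega> 2 \<Longrightarrow> (\<lambda>x. \<phi> x * u x) \<in> Lp_space \<Omega> 2"
  by (rule L2_mult_bounded) (auto intro: \<phi>_measurable \<phi>_abs)

lemma fe_L2: "u \<in> fe_space \<Omega> \<T> k \<Longrightarrow> u \<in> Lp_space \<Omega> 2"
  for u :: "'a \<Rightarrow> 'c::euclidean_space"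
  by (rule continuous_on_closure_L2[OF \<Omega>_lmeasurable bounded_\<Omega>]) (simp add: fe_space_def)

lemma fe_bounded:
  fixes u :: "'a \<Rightarrow> 'c::euclidean_space"
  assumes "u \<in> fe_space \<Omega> \<T> k"
  obtains B where "0 \<le> B" "\<And>x. x \<in> \<Omega> \<Longrightarrow> norm (u x) \<le> B"
  by (rule continuous_on_closure_bounded[OF bounded_\<Omega>, of u]) (use assms in \<open>auto simp: fe_space_def\<close>)

lemma fe_measurable: "u \<in> fe_space \<Omega> \<T> k \<Longrightarrow> u \<in> borel_measurable M"
  for u :: "'a \<Rightarrow> 'c::euclidean_space"
  using fe_L2 by (auto simp: Lp_space_2_iff)

text \<open>A discrete function is continuous on a compact set, hence bounded. This bound is
  specific to the function and gives finiteness only; uniform control comes from the energy.\<close>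

lemma fe_integrable_powr:
  fixes u :: "'a \<Rightarrow> 'c::euclidean_space"
  assumes u: "u \<in> fe_space \<Omega> \<T> k"
  shows "integrable M (\<lambda>x. norm (u x) powr s)"
proof -
  obtain B where B: "0 \<le> B" "\<And>x. x \<in> \<Omega> \<Longrightarrow> norm (u x) \<le> B" using fe_bounded[OF u] by blast
  have "AE x in M. norm (norm (u x) powr s) \<le> B powr s"
    using B s_gt_2 by (intro AE_I2) (auto intro!: powr_mono2)
  then show ?thesis
    using fe_measurable[OF u] by (intro M.integrable_const_bound) auto
qed

lemma admissible_measurable:
  assumes "admissible_coeff \<Omega> T N D b_hi a" "t \<in> {0..T}" "i \<in> {-1..int N}"
  shows "(\<lambda>x. a t x i) \<in> borel_measurable M"
proof -
  obtain a' where "has_time_derivative \<Omega> T (\<lambda>t x. a t x i) a'"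
    using assms(1,3) unfolding admissible_coeff_def by blast
  then have "spacetime_measurable \<Omega> T (\<lambda>t x. a t x i)" by (simp add: has_time_derivative_def)
  then show ?thesis using assms(2) spacetime_measurable_at by blast
qed

text \<open>Growth of order s - 1 is harmless for a bounded field, so the nonlinear flux of a
  discrete function is bounded almost everywhere and its pairings are linear.\<close>

lemma flux_L2:
  fixes m :: "'a \<Rightarrow> 'a"
  assumes a: "\<And>i. i \<in> {-1..int N} \<Longrightarrow> (\<lambda>x. a x i) \<in> borel_measurable M"
    and aD: "AE x in M. a x \<in> D" and m: "m \<in> fe_space \<Omega> \<T> k"
  shows "(\<lambda>x. forchheimer N \<alpha> (a x) (norm (m x)) *\<^sub>R m x) \<in> Lp_space \<Omega> 2"
proof -
  obtain B where B: "0 \<le> B" "\<And>x. x \<in> \<Omega> \<Longrightarrow> norm (m x) \<le> B" using fe_bounded[OF m] by blast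
  have "AE x in M. x \<in> \<Omega>" by (rule AE_I2) simp
  with aD have "AE x in M. norm (forchheimer N \<alpha> (a x) (norm (m x)) *\<^sub>R m x)
      \<le> \<bar>a_hi\<bar> * ((real N + 2) * (1 + B powr (s - 1)))"
  proof eventually_elim
    case (elim x)
    have "norm (forchheimer N \<alpha> (a x) (norm (m x)) *\<^sub>R m x)
        \<le> a_hi * ((real N + 2) * (1 + norm (m x) powr (s - 1)))"
      using elim D by (intro forchheimer_bound[OF _ a_lo]) auto
    also have "\<dots> \<le> \<bar>a_hi\<bar> * ((real N + 2) * (1 + B powr (s - 1)))"
      using B elim s_gt_2 by (intro mult_mono add_left_mono powr_mono2) auto
    finally show ?case .
  qed
  moreover have "(\<lambda>x. forchheimer N \<alpha> (a x) (norm (m x)) *\<^sub>R m x) \<in> borel_measurable M"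
    unfolding forchheimer_def using a fe_measurable[OF m]
    by (intro borel_measurable_scaleR borel_measurable_sum borel_measurable_times) auto
  ultimately show ?thesis by (intro AE_bounded_imp_L2[OF \<Omega>_lmeasurable])
qed

lemma measurable_integral_powr:
  fixes m :: "real \<Rightarrow> 'a \<Rightarrow> 'a"
  assumes "spacetime_measurable \<Omega> T m"
  shows "(\<lambda>t. LINT x|M. norm (m t x) powr s) \<in> borel_measurable J"
proof (rule M.borel_measurable_lebesgue_integral)
  show "(\<lambda>(t, x). norm (m t x) powr s) \<in> borel_measurable (J \<Otimes>\<^sub>M M)"
    using assms unfolding spacetime_measurable_def case_prod_beta' by measurable
qed

text \<open>The two source terms stay together because they are paired with the same density. The
  bound combines the essential supremum of f in time with the continuity of the time derivative of
  \<Psi> up to the boundary, through (y - z)^2 \<le> 2 y^2 + 2 z^2.\<close>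

lemma source_bound:
  obtains K where "0 \<le> K"
    "AE t in J. f t \<in> Lp_space \<Omega> 2 \<and>
      (LINT x|M. (f t x - \<phi> x * time_deriv T \<Psi> t x)\<^sup>2) \<le> K"
proof -
  obtain K where K: "0 \<le> K"
    "\<And>t. t \<in> {0..T} \<Longrightarrow> time_deriv T \<Psi> t \<in> Lp_space \<Omega> 2"
    "\<And>t x. t \<in> {0..T} \<Longrightarrow> x \<in> \<Omega> \<Longrightarrow> \<bar>time_deriv T \<Psi> t x\<bar> \<le> K"
    using C12_bounds[OF open_\<Omega> bounded_\<Omega> T \<Psi>] by metis
  obtain F where F: "0 \<le> F" "time_Linf T (\<lambda>t. Lp_norm \<Omega> 2 (f t)) = ennreal F"
    using f_bounded unfolding infinity_ennreal_def less_top_ennreal by blast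
  have "AE t in J. Lp_norm \<Omega> 2 (f t) \<le> ennreal F"
    using esssup_AE[of "\<lambda>t. Lp_norm \<Omega> 2 (f t)" J] F(2) by (simp add: time_Linf_def)
  moreover have "AE t in J. t \<in> {0..T}" by (rule AE_I2) simp
  ultimately have "AE t in J. f t \<in> Lp_space \<Omega> 2 \<and>
      (LINT x|M. (f t x - \<phi> x * time_deriv T \<Psi> t x)\<^sup>2) \<le> 2 * F\<^sup>2 + 2 * (\<phi>_hi * K)\<^sup>2 * vol"
  proof eventually_elim
    case (elim t)
    have fL: "f t \<in> Lp_space \<Omega> 2"
      using elim spacetime_measurable_at[OF f_measurable, of t]
      by (auto simp: Lp_space_def intro: le_less_trans)
    have fi: "integrable M (\<lambda>x. (f t x)\<^sup>2)" using fL by (simp add: Lp_space_2_iff)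
    have "ennreal (LINT x|M. (f t x)\<^sup>2) = (Lp_norm \<Omega> 2 (f t))\<^sup>2"
      unfolding Lp_norm_2_real_power2 using fi by (intro nn_integral_eq_integral[symmetric]) auto
    also have "\<dots> \<le> (ennreal F)\<^sup>2" using elim by (intro power_mono) auto
    finally have f2: "(LINT x|M. (f t x)\<^sup>2) \<le> F\<^sup>2"
      using F(1) by (simp add: ennreal_power)
    have L: "(\<lambda>x. f t x - \<phi> x * time_deriv T \<Psi> t x) \<in> Lp_space \<Omega> 2"
      using fL K(2) elim by (intro L2_diff \<phi>_mult_L2) auto
    have "(LINT x|M. (f t x - \<phi> x * time_deriv T \<Psi> t x)\<^sup>2)
        \<le> (LINT x|M. 2 * (f t x)\<^sup>2 + 2 * (\<phi>_hi * K)\<^sup>2)"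
    proof (rule integral_mono)
      fix x assume "x \<in> space M"
      then have x: "x \<in> \<Omega>" by simp
      have "\<bar>\<phi> x * time_deriv T \<Psi> t x\<bar> \<le> \<phi>_hi * K"
        using \<phi>_abs[OF x] K(3)[OF elim(2) x] unfolding abs_mult by (intro mult_mono) auto
      from power_mono[OF this, of 2]
      have "(\<phi> x * time_deriv T \<Psi> t x)\<^sup>2 \<le> (\<phi>_hi * K)\<^sup>2" by simp
      moreover have "(y - z)\<^sup>2 \<le> 2 * y\<^sup>2 + 2 * z\<^sup>2" for y z :: real
      proof -
        have "(y - z)\<^sup>2 + (y + z)\<^sup>2 = 2 * y\<^sup>2 + 2 * z\<^sup>2"
          by (simp add: power2_eq_square algebra_simps)
        then show ?thesis using zero_le_power2[of "y + z"] by linarith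
      qed
      ultimately show "(f t x - \<phi> x * time_deriv T \<Psi> t x)\<^sup>2 \<le> 2 * (f t x)\<^sup>2 + 2 * (\<phi>_hi * K)\<^sup>2"
        by (smt (verit))
    qed (use L fi in \<open>auto simp: Lp_space_2_iff\<close>)
    also have "\<dots> = 2 * (LINT x|M. (f t x)\<^sup>2) + 2 * (\<phi>_hi * K)\<^sup>2 * vol"
      using fi by (simp add: vol_def)
    also have "\<dots> \<le> 2 * F\<^sup>2 + 2 * (\<phi>_hi * K)\<^sup>2 * vol" using f2 by simp
    finally show ?case using fL by simp
  qed
  moreover have "0 \<le> 2 * F\<^sup>2 + 2 * (\<phi>_hi * K)\<^sup>2 * vol" using vol_nonneg by simp
  ultimately show ?thesis by (intro that[of "2 * F\<^sup>2 + 2 * (\<phi>_hi * K)\<^sup>2 * vol"])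
qed

text \<open>The weight is free: a large one makes the density term absorbable in the a priori bound,
  and weight 1 shows that the projection does not increase the norm.\<close>

lemma pairing_young:
  fixes u v :: "'a \<Rightarrow> real"
  assumes u: "u \<in> Lp_space \<Omega> 2" and v: "v \<in> Lp_space \<Omega> 2" and \<mu>: "0 < \<mu>"
  shows "pairing \<Omega> u v \<le> \<mu> / 2 * (LINT x|M. (u x)\<^sup>2) + 1 / (2 * \<mu>) * (LINT x|M. (v x)\<^sup>2)"
proof -
  have i: "integrable M (\<lambda>x. (u x)\<^sup>2)" "integrable M (\<lambda>x. (v x)\<^sup>2)"
    using u v by (auto simp: Lp_space_2_iff)
  have "pairing \<Omega> u v \<le> (LINT x|M. \<mu> / 2 * (u x)\<^sup>2 + 1 / (2 * \<mu>) * (v x)\<^sup>2)"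
    unfolding pairing_def
  proof (rule integral_mono[OF integrable_inner_L2[OF u v]])
    fix x
    have "0 \<le> (\<mu> * u x - v x)\<^sup>2 / (2 * \<mu>)" using \<mu> by simp
    also have "\<dots> = \<mu> / 2 * (u x)\<^sup>2 + 1 / (2 * \<mu>) * (v x)\<^sup>2 - u x * v x"
      using \<mu> by (simp add: power2_eq_square field_simps)
    finally show "u x \<bullet> v x \<le> \<mu> / 2 * (u x)\<^sup>2 + 1 / (2 * \<mu>) * (v x)\<^sup>2" by simp
  qed (use i in simp)
  also have "\<dots> = \<mu> / 2 * (LINT x|M. (u x)\<^sup>2) + 1 / (2 * \<mu>) * (LINT x|M. (v x)\<^sup>2)"
    using i by simp
  finally show ?thesis .
qed

text \<open>Links the energy with weight \<phi> to the L^2 norm. The absolute value keeps the upper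
  factor nonnegative also for empty \<Omega>, where the bounds on \<phi> do not determine the sign
  of \<open>\<phi>_hi\<close>.\<close>

lemma weighted_square_bounds:
  fixes u :: "'a \<Rightarrow> real"
  assumes u: "u \<in> Lp_space \<Omega> 2"
  shows "\<phi>_lo * (LINT x|M. (u x)\<^sup>2) \<le> (LINT x|M. \<phi> x * (u x)\<^sup>2)"
    and "(LINT x|M. \<phi> x * (u x)\<^sup>2) \<le> \<bar>\<phi>_hi\<bar> * (LINT x|M. (u x)\<^sup>2)"
proof -
  have i: "integrable M (\<lambda>x. (u x)\<^sup>2)" using u by (simp add: Lp_space_2_iff)
  have j: "integrable M (\<lambda>x. \<phi> x * (u x)\<^sup>2)"
    using integrable_inner_L2[OF \<phi>_mult_L2[OF u] u] by (simp add: power2_eq_square mult.assoc)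
  have "(LINT x|M. \<phi>_lo * (u x)\<^sup>2) \<le> (LINT x|M. \<phi> x * (u x)\<^sup>2)"
    using i j \<phi> by (intro integral_mono) (auto intro!: mult_right_mono)
  then show "\<phi>_lo * (LINT x|M. (u x)\<^sup>2) \<le> (LINT x|M. \<phi> x * (u x)\<^sup>2)" by simp
  have "\<phi> x \<le> \<bar>\<phi>_hi\<bar>" if "x \<in> \<Omega>" for x
    using \<phi>[OF that] by linarith
  then have "(LINT x|M. \<phi> x * (u x)\<^sup>2) \<le> (LINT x|M. \<bar>\<phi>_hi\<bar> * (u x)\<^sup>2)"
    using i j by (intro integral_mono) (auto intro!: mult_right_mono)
  then show "(LINT x|M. \<phi> x * (u x)\<^sup>2) \<le> \<bar>\<phi>_hi\<bar> * (LINT x|M. (u x)\<^sup>2)" by simp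
qed

section \<open>Uniform bound for a single discrete solution\<close>

lemma discrete_problemE:
  assumes "mixed_solution \<Omega> T N \<alpha> \<phi> f \<Psi> (fe_space \<Omega> \<T> k) (fe_space \<Omega> \<T> k) a m \<rho>"
  obtains \<rho>' where "has_time_derivative \<Omega> T \<rho> \<rho>'"
    and "AE t in J. t \<in> {0..T} \<and> \<rho>' t \<in> Lp_space \<Omega> 2 \<and>
      (\<forall>v\<in>fe_space \<Omega> \<T> k. \<forall>dv. has_L2_divergence \<Omega> v dv \<longrightarrow>
         pairing \<Omega> (\<lambda>x. forchheimer N \<alpha> (a t x) (norm (m t x)) *\<^sub>R m t x) v - pairing \<Omega> (\<rho> t) dv
           = - pairing \<Omega> (grad (\<Psi> t)) v) \<and>
      (\<exists>dm. has_L2_divergence \<Omega> (m t) dm \<and>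
         (\<forall>q\<in>fe_space \<Omega> \<T> k. pairing \<Omega> (\<lambda>x. \<phi> x * \<rho>' t x) q + pairing \<Omega> dm q
           = pairing \<Omega> (f t) q - pairing \<Omega> (\<lambda>x. \<phi> x * time_deriv T \<Psi> t x) q))"
proof -
  from assms obtain \<rho>' where \<rho>': "has_time_derivative \<Omega> T \<rho> \<rho>'"
    and eqs: "AE t in J.
      (\<forall>v\<in>fe_space \<Omega> \<T> k. \<forall>dv. has_L2_divergence \<Omega> v dv \<longrightarrow>
         pairing \<Omega> (\<lambda>x. forchheimer N \<alpha> (a t x) (norm (m t x)) *\<^sub>R m t x) v - pairing \<Omega> (\<rho> t) dv
           = - pairing \<Omega> (grad (\<Psi> t)) v) \<and>
      (\<exists>dm. has_L2_divergence \<Omega> (m t) dm \<and>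
         (\<forall>q\<in>fe_space \<Omega> \<T> k. pairing \<Omega> (\<lambda>x. \<phi> x * \<rho>' t x) q + pairing \<Omega> dm q
           = pairing \<Omega> (f t) q - pairing \<Omega> (\<lambda>x. \<phi> x * time_deriv T \<Psi> t x) q))"
    unfolding mixed_solution_def by blast
  have "AE t in J. t \<in> {0..T}" by (rule AE_I2) simp
  from that[OF \<rho>' AE_conjI[OF this AE_conjI[OF AE_time_derivative_L2[OF \<Omega>_lmeasurable \<rho>'] eqs]]]
  show ?thesis .
qed

text \<open>Testing the orthogonality with p itself gives (p, p) = (u, p), and Young's inequality
  returns half of (p, p) to the left. The initial energy is thereby bounded independently of the
  mesh.\<close>

lemma L2_projection_norm_le:
  assumes u: "u \<in> Lp_space \<Omega> 2" and p: "is_L2_projection \<Omega> (fe_space \<Omega> \<T> k) u p"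
  shows "(LINT x|M. (p x)\<^sup>2) \<le> (LINT x|M. (u x)\<^sup>2)"
proof -
  have pfe: "p \<in> fe_space \<Omega> \<T> k" and "pairing \<Omega> (\<lambda>x. p x - u x) p = 0"
    using p by (auto simp: is_L2_projection_def)
  moreover have pL: "p \<in> Lp_space \<Omega> 2" by (rule fe_L2[OF pfe])
  ultimately have "pairing \<Omega> p p = pairing \<Omega> u p"
    using pairing_diff_left[OF pL u pL] by simp
  then have "(LINT x|M. (p x)\<^sup>2) = pairing \<Omega> u p"
    by (simp add: pairing_def power2_eq_square)
  then show ?thesis using pairing_young[OF u pL, of 1] by simp
qed

text \<open>Strong monotonicity against the zero field, where the flux vanishes. The factor is 2
  \<kappa> because \<kappa> is half of the monotonicity constant.\<close>

lemma flux_coercive: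
  fixes m :: "'a \<Rightarrow> 'a"
  assumes a: "\<And>i. i \<in> {-1..int N} \<Longrightarrow> (\<lambda>x. a x i) \<in> borel_measurable M"
    and aD: "AE x in M. a x \<in> D" and m: "m \<in> fe_space \<Omega> \<T> k"
  shows "2 * \<kappa> * (LINT x|M. norm (m x) powr s)
    \<le> pairing \<Omega> (\<lambda>x. forchheimer N \<alpha> (a x) (norm (m x)) *\<^sub>R m x) m"
proof -
  have "(LINT x|M. 2 * \<kappa> * norm (m x) powr s)
      \<le> pairing \<Omega> (\<lambda>x. forchheimer N \<alpha> (a x) (norm (m x)) *\<^sub>R m x) m"
    unfolding pairing_def
  proof (rule integral_mono_AE)
    show "integrable M (\<lambda>x. 2 * \<kappa> * norm (m x) powr s)" using fe_integrable_powr[OF m] by simp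
    show "integrable M (\<lambda>x. (forchheimer N \<alpha> (a x) (norm (m x)) *\<^sub>R m x) \<bullet> m x)"
      by (rule integrable_inner_L2[OF flux_L2[OF a aD m] fe_L2[OF m]])
    show "AE x in M. 2 * \<kappa> * norm (m x) powr s \<le> (forchheimer N \<alpha> (a x) (norm (m x)) *\<^sub>R m x) \<bullet> m x"
      using aD
    proof (rule eventually_mono)
      fix x assume "a x \<in> D"
      then have "a x \<in> coeff_box N a_lo a_hi" using D by blast
      from forchheimer_strongly_monotone[OF this a_lo, of "m x" 0]
      show "2 * \<kappa> * norm (m x) powr s \<le> (forchheimer N \<alpha> (a x) (norm (m x)) *\<^sub>R m x) \<bullet> m x"
        by (simp add: \<kappa>_def)
    qed
  qed
  then show ?thesis by simp
qed

text \<open>The weight \<open>2 T / \<phi>_lo\<close> in Young's inequality is chosen so that, after taking the supremum in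
  time, half of the density norm is left on the left-hand side; no Gronwall argument is needed.\<close>

lemma discrete_a_priori_bound:
  assumes u\<^sub>0: "u\<^sub>0 \<in> Lp_space \<Omega> 2"
  obtains K where "0 \<le> K"
    and "\<And>\<T> k a m \<rho>. admissible_coeff \<Omega> T N D b_hi a \<Longrightarrow>
      mixed_solution \<Omega> T N \<alpha> \<phi> f \<Psi> (fe_space \<Omega> \<T> k) (fe_space \<Omega> \<T> k) a m \<rho> \<Longrightarrow>
      is_L2_projection \<Omega> (fe_space \<Omega> \<T> k) u\<^sub>0 (\<rho> 0) \<Longrightarrow>
      integrable J (\<lambda>t. LINT x|M. norm (m t x) powr s) \<and>
      (LINT t|J. LINT x|M. norm (m t x) powr s) \<le> K"
proof -
  obtain G where G: "0 \<le> G"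
    "\<And>t. t \<in> {0..T} \<Longrightarrow> grad (\<Psi> t) \<in> Lp_space \<Omega> 2"
    "\<And>t. t \<in> {0..T} \<Longrightarrow> time_deriv T \<Psi> t \<in> Lp_space \<Omega> 2"
    "\<And>t x. t \<in> {0..T} \<Longrightarrow> x \<in> \<Omega> \<Longrightarrow> norm (grad (\<Psi> t) x) \<le> G"
    by (rule C12_bounds[OF open_\<Omega> bounded_\<Omega> T \<Psi>]) (use that in blast)
  obtain S where S: "0 \<le> S" "AE t in J. f t \<in> Lp_space \<Omega> 2 \<and>
      (LINT x|M. (f t x - \<phi> x * time_deriv T \<Psi> t x)\<^sup>2) \<le> S"
    by (rule source_bound)
  \<comment> \<open>\<open>C\<close> is the second term of \<open>young_absorb\<close> for the
    product of |m| with the bound \<open>G\<close> on the gradient of \<Psi>.\<close>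
  define C where "C = (1 / \<kappa>) powr (1 / (s - 1)) * G powr (s / (s - 1))"
  define \<mu> where "\<mu> = 2 * T / \<phi>_lo"
  define U where "U = (LINT x|M. (u\<^sub>0 x)\<^sup>2)"
  \<comment> \<open>Half the initial energy plus the time integral of the sources: everything in the
    final bound that is free of the supremum \<open>Y\<close>.\<close>
  define A where "A = \<bar>\<phi>_hi\<bar> * U / 2 + T * (C * vol + \<mu> / 2 * S)"
  have \<mu>: "0 < \<mu>" using T \<phi>_lo by (simp add: \<mu>_def)
  have C: "0 \<le> C" by (simp add: C_def)
  have U: "0 \<le> U" by (simp add: U_def)
  have A: "0 \<le> A" using U C vol_nonneg \<mu> S(1) T by (simp add: A_def)
  show ?thesis
  proof (rule that[of "2 * A / \<kappa>"])
    show "0 \<le> 2 * A / \<kappa>" using A \<kappa>_pos by simp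
    fix \<T> k a m \<rho>
    assume adm: "admissible_coeff \<Omega> T N D b_hi a"
      and sol: "mixed_solution \<Omega> T N \<alpha> \<phi> f \<Psi> (fe_space \<Omega> \<T> k) (fe_space \<Omega> \<T> k) a m \<rho>"
      and proj: "is_L2_projection \<Omega> (fe_space \<Omega> \<T> k) u\<^sub>0 (\<rho> 0)"
    have mm: "spacetime_measurable \<Omega> T m"
      and m: "\<And>t. t \<in> {0..T} \<Longrightarrow> m t \<in> fe_space \<Omega> \<T> k"
      and \<rho>: "\<And>t. t \<in> {0..T} \<Longrightarrow> \<rho> t \<in> fe_space \<Omega> \<T> k"
      using sol by (auto simp: mixed_solution_def)
    have \<rho>L: "\<rho> t \<in> Lp_space \<Omega> 2" if "t \<in> {0..T}" for t by (rule fe_L2[OF \<rho>[OF that]])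
    have \<rho>0: "integrable M (\<lambda>x. (\<rho> 0 x)\<^sup>2)" using \<rho>L[of 0] T by (simp add: Lp_space_2_iff)
    obtain \<rho>' where \<rho>': "has_time_derivative \<Omega> T \<rho> \<rho>'"
      and eqs: "AE t in J. t \<in> {0..T} \<and> \<rho>' t \<in> Lp_space \<Omega> 2 \<and>
      (\<forall>v\<in>fe_space \<Omega> \<T> k. \<forall>dv. has_L2_divergence \<Omega> v dv \<longrightarrow>
         pairing \<Omega> (\<lambda>x. forchheimer N \<alpha> (a t x) (norm (m t x)) *\<^sub>R m t x) v - pairing \<Omega> (\<rho> t) dv
           = - pairing \<Omega> (grad (\<Psi> t)) v) \<and>
      (\<exists>dm. has_L2_divergence \<Omega> (m t) dm \<and>
         (\<forall>q\<in>fe_space \<Omega> \<T> k. pairing \<Omega> (\<lambda>x. \<phi> x * \<rho>' t x) q + pairing \<Omega> dm q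
           = pairing \<Omega> (f t) q - pairing \<Omega> (\<lambda>x. \<phi> x * time_deriv T \<Psi> t x) q))"
      by (rule discrete_problemE[OF sol])
    define R where "R t = (LINT x|M. (\<rho> t x)\<^sup>2)" for t
    define p where "p t = pairing \<Omega> (\<lambda>x. \<phi> x * \<rho>' t x) (\<rho> t)" for t
    define E where "E t = (LINT x|M. \<phi> x * (\<rho> t x)\<^sup>2)" for t
    define Y where "Y = (SUP t\<in>{0..T}. R t)"
    define g where "g t = \<kappa> * (LINT x|M. norm (m t x) powr s)" for t
    define b where "b = C * vol + \<mu> / 2 * S + Y / (2 * \<mu>)"
    have ER: "\<phi>_lo * R t \<le> E t" if "t \<in> {0..T}" for t
      using weighted_square_bounds(1)[OF \<rho>L[OF that]] by (simp add: E_def R_def)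
    have E0: "E 0 \<le> \<bar>\<phi>_hi\<bar> * U"
    proof -
      have "E 0 \<le> \<bar>\<phi>_hi\<bar> * R 0"
        using weighted_square_bounds(2)[OF \<rho>L[of 0]] T by (simp add: E_def R_def)
      also have "\<dots> \<le> \<bar>\<phi>_hi\<bar> * U"
        using L2_projection_norm_le[OF u\<^sub>0 proj] by (intro mult_left_mono) (auto simp: R_def U_def)
      finally show ?thesis .
    qed
    have [measurable]: "(\<lambda>x. x) \<in> borel_measurable J"
      using id_borel_measurable_lebesgue_on[of "{0..T}"] by (simp add: id_def)
    \<comment> \<open>The supremum must be finite before it can be absorbed. The energy identity
      ensures this through the integral of |p|, with a bound that depends on the particular
      solution.\<close>
    have bdd: "bdd_above (R ` {0..T})"
    proof (rule bdd_aboveI2)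
      fix t assume t: "t \<in> {0..T}"
      have pint: "integrable J p"
        unfolding p_def
        by (rule energy_identity(1)[OF \<Omega>_lmeasurable _ \<rho>' \<rho>0 \<phi>_measurable]) (use T \<phi>_abs in auto)
      have "E t = E 0 + 2 * (LINT \<tau>|J. (if \<tau> \<le> t then p \<tau> else 0))"
        unfolding E_def p_def
        by (rule energy_identity(2)[OF \<Omega>_lmeasurable _ \<rho>' \<rho>0 \<phi>_measurable \<phi>_abs t]) (use T in auto)
      moreover have "(LINT \<tau>|J. (if \<tau> \<le> t then p \<tau> else 0)) \<le> (LINT \<tau>|J. \<bar>p \<tau>\<bar>)"
      proof (rule integral_mono)
        show "integrable J (\<lambda>\<tau>. if \<tau> \<le> t then p \<tau> else 0)"
          by (rule Bochner_Integration.integrable_bound[OF pint]) (use pint in auto)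
      qed (use pint in auto)
      ultimately have "\<phi>_lo * R t \<le> E 0 + 2 * (LINT \<tau>|J. \<bar>p \<tau>\<bar>)" using ER[OF t] by linarith
      then show "R t \<le> (E 0 + 2 * (LINT \<tau>|J. \<bar>p \<tau>\<bar>)) / \<phi>_lo"
        using \<phi>_lo by (simp add: field_simps)
    qed
    have RY: "R t \<le> Y" if "t \<in> {0..T}" for t
      unfolding Y_def by (rule cSUP_upper[OF that bdd])
    have Y0: "0 \<le> Y" using RY[of 0] T by (auto simp: R_def intro: order_trans[rotated])
    have b0: "0 \<le> b" using C vol_nonneg \<mu> S(1) Y0 by (simp add: b_def)
    have g0: "0 \<le> g t" for t using \<kappa>_pos by (simp add: g_def)
    have aD: "AE t in J. AE x in M. a t x \<in> D"
      using adm by (simp add: admissible_coeff_def)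
    \<comment> \<open>The mass equation is tested with the density and the flux equation with the
      flux, so the divergence terms cancel. Coercivity yields 2 g; the gradient of \<Psi> takes back
      one g and the other stays on the left.\<close>
    have ineq: "AE t in J. g t + p t \<le> b"
      using eqs aD S(2)
    proof eventually_elim
      case (elim t)
      then have t: "t \<in> {0..T}" and \<rho>'L: "\<rho>' t \<in> Lp_space \<Omega> 2" and fL: "f t \<in> Lp_space \<Omega> 2" by auto
      from elim obtain dm where dm: "has_L2_divergence \<Omega> (m t) dm"
        and e2: "pairing \<Omega> (\<lambda>x. \<phi> x * \<rho>' t x) (\<rho> t) + pairing \<Omega> dm (\<rho> t)
           = pairing \<Omega> (f t) (\<rho> t) - pairing \<Omega> (\<lambda>x. \<phi> x * time_deriv T \<Psi> t x) (\<rho> t)"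
        using \<rho>[OF t] by blast
      let ?F = "\<lambda>x. forchheimer N \<alpha> (a t x) (norm (m t x)) *\<^sub>R m t x"
      have e1: "pairing \<Omega> ?F (m t) - pairing \<Omega> (\<rho> t) dm = - pairing \<Omega> (grad (\<Psi> t)) (m t)"
        using elim m[OF t] dm by blast
      have 1: "2 * g t \<le> pairing \<Omega> ?F (m t)"
        using flux_coercive[OF admissible_measurable[OF adm t] elim(2) m[OF t]] by (simp add: g_def)
      have "- pairing \<Omega> (grad (\<Psi> t)) (m t) = (LINT x|M. - (grad (\<Psi> t) x \<bullet> m t x))"
        by (simp add: pairing_def)
      also have "\<dots> \<le> (LINT x|M. \<kappa> * norm (m t x) powr s + C)"
      proof (rule integral_mono)
        show "integrable M (\<lambda>x. - (grad (\<Psi> t) x \<bullet> m t x))"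
          using integrable_inner_L2[OF G(2)[OF t] fe_L2[OF m[OF t]]] by simp
        show "integrable M (\<lambda>x. \<kappa> * norm (m t x) powr s + C)"
          using fe_integrable_powr[OF m[OF t]] by simp
        fix x assume "x \<in> space M"
        then have x: "x \<in> \<Omega>" by simp
        have "- (grad (\<Psi> t) x \<bullet> m t x) \<le> norm (m t x) * norm (grad (\<Psi> t) x)"
          using Cauchy_Schwarz_ineq2[of "grad (\<Psi> t) x" "m t x"] by (simp add: mult.commute)
        also have "\<dots> \<le> norm (m t x) * G" using G(4)[OF t x] by (intro mult_left_mono) auto
        also have "\<dots> \<le> \<kappa> * norm (m t x) powr s + C"
          unfolding C_def using G(1) s_gt_2 \<kappa>_pos by (intro young_absorb) auto
        finally show "- (grad (\<Psi> t) x \<bullet> m t x) \<le> \<kappa> * norm (m t x) powr s + C" .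
      qed
      also have "\<dots> = g t + C * vol"
        using fe_integrable_powr[OF m[OF t]] by (simp add: g_def vol_def)
      finally have 2: "- pairing \<Omega> (grad (\<Psi> t)) (m t) \<le> g t + C * vol" .
      have L: "(\<lambda>x. \<phi> x * time_deriv T \<Psi> t x) \<in> Lp_space \<Omega> 2"
        by (rule \<phi>_mult_L2[OF G(3)[OF t]])
      have "pairing \<Omega> (f t) (\<rho> t) - pairing \<Omega> (\<lambda>x. \<phi> x * time_deriv T \<Psi> t x) (\<rho> t)
          = pairing \<Omega> (\<lambda>x. f t x - \<phi> x * time_deriv T \<Psi> t x) (\<rho> t)"
        by (rule pairing_diff_left[OF fL L \<rho>L[OF t], symmetric])
      also have "\<dots> \<le> \<mu> / 2 * (LINT x|M. (f t x - \<phi> x * time_deriv T \<Psi> t x)\<^sup>2) + 1 / (2 * \<mu>) * R t"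
        unfolding R_def by (rule pairing_young[OF L2_diff[OF fL L] \<rho>L[OF t] \<mu>])
      also have "\<dots> \<le> \<mu> / 2 * S + 1 / (2 * \<mu>) * Y"
        using elim(3) RY[OF t] \<mu> by (intro add_mono mult_left_mono) auto
      finally have 3: "pairing \<Omega> (f t) (\<rho> t) - pairing \<Omega> (\<lambda>x. \<phi> x * time_deriv T \<Psi> t x) (\<rho> t)
          \<le> \<mu> / 2 * S + Y / (2 * \<mu>)" by simp
      show ?case
        using e1 e2 1 2 3 pairing_commute[of \<Omega> dm "\<rho> t"] unfolding p_def b_def by linarith
    qed
    note ei = energy_inequality[OF \<Omega>_lmeasurable less_imp_le[OF T] \<rho>' \<rho>0 \<phi>_measurable \<phi>_abs
        _ g0 _ b0 ineq[unfolded p_def], folded E_def]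
    have gm: "g \<in> borel_measurable J"
      unfolding g_def using measurable_integral_powr[OF mm] by measurable
    have gi: "integrable J g"
      by (rule ei(1)) (use gm in auto)
    have en: "E t / 2 + (LINT \<tau>|J. (if \<tau> \<le> t then g \<tau> else 0)) \<le> E 0 / 2 + T * b" if "t \<in> {0..T}" for t
      using ei(2)[OF _ gm _ that] measure_J by simp
    \<comment> \<open>Integration over I turns Y / (2 \<mu>) into \<phi>_lo Y / 4, half of the
      coefficient 1/2 with which \<phi>_lo R t is controlled on the left.\<close>
    have Tb: "E 0 / 2 + T * b \<le> A + \<phi>_lo * Y / 4"
    proof -
      have "T * (Y / (2 * \<mu>)) = \<phi>_lo * Y / 4" using T \<phi>_lo by (simp add: \<mu>_def field_simps)
      then show ?thesis using E0 by (simp add: b_def A_def distrib_left)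
    qed
    have "R t \<le> 2 * A / \<phi>_lo + Y / 2" if t: "t \<in> {0..T}" for t
    proof -
      have "0 \<le> (LINT \<tau>|J. (if \<tau> \<le> t then g \<tau> else 0))"
        using g0 by (intro integral_nonneg_AE) auto
      then have "\<phi>_lo * R t / 2 \<le> A + \<phi>_lo * Y / 4"
        using en[OF t] ER[OF t] Tb by linarith
      then show ?thesis using \<phi>_lo by (simp add: field_simps)
    qed
    then have "Y \<le> 2 * A / \<phi>_lo + Y / 2"
      unfolding Y_def using T by (intro cSUP_least) auto
    then have Y: "\<phi>_lo * Y / 4 \<le> A"
      using \<phi>_lo by (simp add: field_simps)
    \<comment> \<open>At t = T the energy is dropped by its sign. Absorption gave \<phi>_lo Y / 4
      \<le> A, so the integral of g is at most 2 A, and g carries the factor \<kappa>.\<close>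
    have "E T \<ge> 0"
      using ER[of T] T \<phi>_lo by (auto simp: R_def intro: order_trans[rotated])
    moreover have "(LINT \<tau>|J. (if \<tau> \<le> T then g \<tau> else 0)) = integral\<^sup>L J g"
      by (intro Bochner_Integration.integral_cong) auto
    ultimately have "integral\<^sup>L J g \<le> 2 * A"
      using en[of T] T Tb Y by simp
    then show "integrable J (\<lambda>t. LINT x|M. norm (m t x) powr s) \<and>
      (LINT t|J. LINT x|M. norm (m t x) powr s) \<le> 2 * A / \<kappa>"
      using gi \<kappa>_pos by (simp add: g_def[abs_def] field_simps)
  qed
qed

section \<open>Difference of two discrete solutions\<close>

definition "\<Lambda> = (1 / \<kappa>) powr (1 / (s - 1)) * (2 * (real N + 2)) powr (s / (s - 1))"

lemma \<Lambda>_nonneg: "0 \<le> \<Lambda>"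
  by (simp add: \<Lambda>_def)

text \<open>\<open>forchheimer_stability\<close> integrated over \<Omega>, with \<Lambda> as its
  constant \<open>K\<close>; the volume is the integral of the summand 1. The coefficient change is
  evaluated at the second flux, so only |\<open>m\<^sub>2\<close>|^s, which has a uniform bound,
  stands next to the power of \<delta>.\<close>

lemma flux_difference_bound:
  fixes m\<^sub>1 m\<^sub>2 :: "'a \<Rightarrow> 'a"
  assumes a1: "\<And>i. i \<in> {-1..int N} \<Longrightarrow> (\<lambda>x. a\<^sub>1 x i) \<in> borel_measurable M" "AE x in M. a\<^sub>1 x \<in> D"
    and a2: "\<And>i. i \<in> {-1..int N} \<Longrightarrow> (\<lambda>x. a\<^sub>2 x i) \<in> borel_measurable M" "AE x in M. a\<^sub>2 x \<in> D"
    and m: "m\<^sub>1 \<in> fe_space \<Omega> \<T> k" "m\<^sub>2 \<in> fe_space \<Omega> \<T> k"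
    and \<delta>: "AE x in M. \<forall>i\<in>{-1..int N}. \<bar>a\<^sub>1 x i - a\<^sub>2 x i\<bar> \<le> \<delta>"
  shows "\<kappa> * (LINT x|M. norm (m\<^sub>1 x - m\<^sub>2 x) powr s)
      - \<Lambda> * \<delta> powr (s / (s - 1)) * (vol + (LINT x|M. norm (m\<^sub>2 x) powr s))
    \<le> pairing \<Omega> (\<lambda>x. forchheimer N \<alpha> (a\<^sub>1 x) (norm (m\<^sub>1 x)) *\<^sub>R m\<^sub>1 x
        - forchheimer N \<alpha> (a\<^sub>2 x) (norm (m\<^sub>2 x)) *\<^sub>R m\<^sub>2 x) (\<lambda>x. m\<^sub>1 x - m\<^sub>2 x)"
proof -
  let ?F = "\<lambda>x. forchheimer N \<alpha> (a\<^sub>1 x) (norm (m\<^sub>1 x)) *\<^sub>R m\<^sub>1 x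
        - forchheimer N \<alpha> (a\<^sub>2 x) (norm (m\<^sub>2 x)) *\<^sub>R m\<^sub>2 x"
  let ?L = "\<Lambda> * \<delta> powr (s / (s - 1))"
  have m12: "(\<lambda>x. m\<^sub>1 x - m\<^sub>2 x) \<in> fe_space \<Omega> \<T> k" by (rule fe_space_diff[OF m])
  have F: "?F \<in> Lp_space \<Omega> 2" by (rule L2_diff[OF flux_L2[OF a1 m(1)] flux_L2[OF a2 m(2)]])
  note i = fe_integrable_powr[OF m12] fe_integrable_powr[OF m(2)]
  have "\<kappa> * (LINT x|M. norm (m\<^sub>1 x - m\<^sub>2 x) powr s) - ?L * (vol + (LINT x|M. norm (m\<^sub>2 x) powr s))
     = (LINT x|M. \<kappa> * norm (m\<^sub>1 x - m\<^sub>2 x) powr s - ?L * (1 + norm (m\<^sub>2 x) powr s))"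
    using i by (simp add: vol_def)
  also have "\<dots> \<le> (LINT x|M. ?F x \<bullet> (m\<^sub>1 x - m\<^sub>2 x))"
  proof (rule integral_mono_AE)
    show "integrable M (\<lambda>x. \<kappa> * norm (m\<^sub>1 x - m\<^sub>2 x) powr s - ?L * (1 + norm (m\<^sub>2 x) powr s))"
      using i by simp
    show "integrable M (\<lambda>x. ?F x \<bullet> (m\<^sub>1 x - m\<^sub>2 x))"
      by (rule integrable_inner_L2[OF F fe_L2[OF m12]])
    show "AE x in M. \<kappa> * norm (m\<^sub>1 x - m\<^sub>2 x) powr s - ?L * (1 + norm (m\<^sub>2 x) powr s)
        \<le> ?F x \<bullet> (m\<^sub>1 x - m\<^sub>2 x)"
      using a1(2) \<delta>
    proof eventually_elim
      case (elim x)
      then have "a\<^sub>1 x \<in> coeff_box N a_lo a_hi" using D by blast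
      then show ?case
        by (rule forchheimer_stability[OF _ a_lo _ \<kappa>_def \<Lambda>_def]) (use elim in auto)
    qed
  qed
  finally show ?thesis by (simp add: pairing_def)
qed

text \<open>\<open>B\<close> bounds the time integral of the perturbation, with \<open>K\<close> for
  the integral of |\<open>m\<^sub>2\<close>|^s. The common data drop out of the difference, so
  neither a density norm nor an initial energy is left on the right and
  \<open>energy_inequality\<close> concludes without absorption in time.\<close>

lemma discrete_stability:
  assumes adm: "admissible_coeff \<Omega> T N D b_hi a\<^sub>1" "admissible_coeff \<Omega> T N D b_hi a\<^sub>2"
    and sol1: "mixed_solution \<Omega> T N \<alpha> \<phi> f \<Psi> (fe_space \<Omega> \<T> k) (fe_space \<Omega> \<T> k) a\<^sub>1 m\<^sub>1 \<rho>\<^sub>1"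
    and sol2: "mixed_solution \<Omega> T N \<alpha> \<phi> f \<Psi> (fe_space \<Omega> \<T> k) (fe_space \<Omega> \<T> k) a\<^sub>2 m\<^sub>2 \<rho>\<^sub>2"
    and u\<^sub>0: "u\<^sub>0 \<in> Lp_space \<Omega> 2"
    and proj: "is_L2_projection \<Omega> (fe_space \<Omega> \<T> k) u\<^sub>0 (\<rho>\<^sub>1 0)"
      "is_L2_projection \<Omega> (fe_space \<Omega> \<T> k) u\<^sub>0 (\<rho>\<^sub>2 0)"
    and \<delta>: "AE t in J. AE x in M. \<forall>i\<in>{-1..int N}. \<bar>a\<^sub>1 t x i - a\<^sub>2 t x i\<bar> \<le> \<delta>"
    and bound: "integrable J (\<lambda>t. LINT x|M. norm (m\<^sub>2 t x) powr s)"
      "(LINT t|J. LINT x|M. norm (m\<^sub>2 t x) powr s) \<le> K"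
    and B: "B = \<Lambda> * (T * vol + K) * \<delta> powr (s / (s - 1))"
  shows "\<And>t. t \<in> {0..T} \<Longrightarrow> (LINT x|M. (\<rho>\<^sub>1 t x - \<rho>\<^sub>2 t x)\<^sup>2) \<le> 2 / \<phi>_lo * B"
    and "integrable J (\<lambda>t. LINT x|M. norm (m\<^sub>1 t x - m\<^sub>2 t x) powr s)"
    and "(LINT t|J. LINT x|M. norm (m\<^sub>1 t x - m\<^sub>2 t x) powr s) \<le> B / \<kappa>"
proof -
  let ?X = "fe_space \<Omega> \<T> k :: ('a \<Rightarrow> real) set" and ?V = "fe_space \<Omega> \<T> k :: ('a \<Rightarrow> 'a) set"
  have mm: "spacetime_measurable \<Omega> T m\<^sub>1" "spacetime_measurable \<Omega> T m\<^sub>2"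
    and m1: "\<And>t. t \<in> {0..T} \<Longrightarrow> m\<^sub>1 t \<in> ?V" and \<rho>1: "\<And>t. t \<in> {0..T} \<Longrightarrow> \<rho>\<^sub>1 t \<in> ?X"
    and m2: "\<And>t. t \<in> {0..T} \<Longrightarrow> m\<^sub>2 t \<in> ?V" and \<rho>2: "\<And>t. t \<in> {0..T} \<Longrightarrow> \<rho>\<^sub>2 t \<in> ?X"
    using sol1 sol2 by (auto simp: mixed_solution_def)
  define u where "u t x = \<rho>\<^sub>1 t x - \<rho>\<^sub>2 t x" for t x
  define v where "v t x = m\<^sub>1 t x - m\<^sub>2 t x" for t x
  have u: "u t \<in> ?X" if "t \<in> {0..T}" for t
    unfolding u_def by (rule fe_space_diff[OF \<rho>1[OF that] \<rho>2[OF that]])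
  have v: "v t \<in> ?V" if "t \<in> {0..T}" for t
    unfolding v_def by (rule fe_space_diff[OF m1[OF that] m2[OF that]])
  have vm: "spacetime_measurable \<Omega> T v"
    using mm unfolding v_def spacetime_measurable_def case_prod_beta' by measurable
  have uL: "u t \<in> Lp_space \<Omega> 2" if "t \<in> {0..T}" for t by (rule fe_L2[OF u[OF that]])
  have \<rho>L: "\<rho>\<^sub>1 t \<in> Lp_space \<Omega> 2" "\<rho>\<^sub>2 t \<in> Lp_space \<Omega> 2" if "t \<in> {0..T}" for t
    using fe_L2[OF \<rho>1[OF that]] fe_L2[OF \<rho>2[OF that]] by auto
  have u0i: "integrable M (\<lambda>x. (u 0 x)\<^sup>2)" using uL[of 0] T by (simp add: Lp_space_2_iff)
  have u0: "(LINT x|M. (u 0 x)\<^sup>2) = 0"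
  proof -
    \<comment> \<open>The difference of the two projections belongs to the discrete space, so both
      orthogonality relations can be tested with it; subtracting them shows that it is orthogonal to
      itself.\<close>
    have "pairing \<Omega> (\<lambda>x. \<rho>\<^sub>1 0 x - u\<^sub>0 x) (u 0) = 0" "pairing \<Omega> (\<lambda>x. \<rho>\<^sub>2 0 x - u\<^sub>0 x) (u 0) = 0"
      using proj u[of 0] T by (auto simp: is_L2_projection_def)
    then have "pairing \<Omega> (\<rho>\<^sub>1 0) (u 0) - pairing \<Omega> (\<rho>\<^sub>2 0) (u 0) = 0"
      using pairing_diff_left[OF \<rho>L(1)[of 0] u\<^sub>0 uL[of 0]] pairing_diff_left[OF \<rho>L(2)[of 0] u\<^sub>0 uL[of 0]] T
      by simp
    then have "pairing \<Omega> (u 0) (u 0) = 0"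
      using pairing_diff_left[OF \<rho>L(1)[of 0] \<rho>L(2)[of 0] uL[of 0]] T by (simp add: u_def[abs_def])
    then show ?thesis by (simp add: pairing_def power2_eq_square)
  qed
  obtain \<rho>1' where \<rho>1': "has_time_derivative \<Omega> T \<rho>\<^sub>1 \<rho>1'"
    and eqs1: "AE t in J. t \<in> {0..T} \<and> \<rho>1' t \<in> Lp_space \<Omega> 2 \<and>
      (\<forall>v\<in>?V. \<forall>dv. has_L2_divergence \<Omega> v dv \<longrightarrow>
         pairing \<Omega> (\<lambda>x. forchheimer N \<alpha> (a\<^sub>1 t x) (norm (m\<^sub>1 t x)) *\<^sub>R m\<^sub>1 t x) v - pairing \<Omega> (\<rho>\<^sub>1 t) dv
           = - pairing \<Omega> (grad (\<Psi> t)) v) \<and>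
      (\<exists>dm. has_L2_divergence \<Omega> (m\<^sub>1 t) dm \<and>
         (\<forall>q\<in>?X. pairing \<Omega> (\<lambda>x. \<phi> x * \<rho>1' t x) q + pairing \<Omega> dm q
           = pairing \<Omega> (f t) q - pairing \<Omega> (\<lambda>x. \<phi> x * time_deriv T \<Psi> t x) q))"
    by (rule discrete_problemE[OF sol1])
  obtain \<rho>2' where \<rho>2': "has_time_derivative \<Omega> T \<rho>\<^sub>2 \<rho>2'"
    and eqs2: "AE t in J. t \<in> {0..T} \<and> \<rho>2' t \<in> Lp_space \<Omega> 2 \<and>
      (\<forall>v\<in>?V. \<forall>dv. has_L2_divergence \<Omega> v dv \<longrightarrow>
         pairing \<Omega> (\<lambda>x. forchheimer N \<alpha> (a\<^sub>2 t x) (norm (m\<^sub>2 t x)) *\<^sub>R m\<^sub>2 t x) v - pairing \<Omega> (\<rho>\<^sub>2 t) dv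
           = - pairing \<Omega> (grad (\<Psi> t)) v) \<and>
      (\<exists>dm. has_L2_divergence \<Omega> (m\<^sub>2 t) dm \<and>
         (\<forall>q\<in>?X. pairing \<Omega> (\<lambda>x. \<phi> x * \<rho>2' t x) q + pairing \<Omega> dm q
           = pairing \<Omega> (f t) q - pairing \<Omega> (\<lambda>x. \<phi> x * time_deriv T \<Psi> t x) q))"
    by (rule discrete_problemE[OF sol2])
  define u' where "u' t x = \<rho>1' t x - \<rho>2' t x" for t x
  have u': "has_time_derivative \<Omega> T u u'"
    unfolding u_def u'_def by (rule has_time_derivative_diff[OF \<Omega>_lmeasurable \<rho>1' \<rho>2'])
  define g where "g t = \<kappa> * (LINT x|M. norm (v t x) powr s)" for t
  define b where "b t = \<Lambda> * \<delta> powr (s / (s - 1)) * (vol + (LINT x|M. norm (m\<^sub>2 t x) powr s))" for t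
  have g0: "0 \<le> g t" for t using \<kappa>_pos by (simp add: g_def)
  have b0: "0 \<le> b t" for t using \<Lambda>_nonneg vol_nonneg by (simp add: b_def)
  have bi: "integrable J b" unfolding b_def using bound(1) by simp
  have gm: "g \<in> borel_measurable J"
    unfolding g_def using measurable_integral_powr[OF vm] by measurable
  have aD: "AE t in J. AE x in M. a\<^sub>1 t x \<in> D" "AE t in J. AE x in M. a\<^sub>2 t x \<in> D"
    using adm by (simp_all add: admissible_coeff_def)
  have ineq: "AE t in J. g t + pairing \<Omega> (\<lambda>x. \<phi> x * u' t x) (u t) \<le> b t"
    using eqs1 eqs2 aD \<delta>
  proof eventually_elim
    case (elim t)
    then have t: "t \<in> {0..T}" and L': "\<rho>1' t \<in> Lp_space \<Omega> 2" "\<rho>2' t \<in> Lp_space \<Omega> 2" by auto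
    let ?F1 = "\<lambda>x. forchheimer N \<alpha> (a\<^sub>1 t x) (norm (m\<^sub>1 t x)) *\<^sub>R m\<^sub>1 t x"
    let ?F2 = "\<lambda>x. forchheimer N \<alpha> (a\<^sub>2 t x) (norm (m\<^sub>2 t x)) *\<^sub>R m\<^sub>2 t x"
    let ?P = "pairing \<Omega> (\<lambda>x. \<phi> x * time_deriv T \<Psi> t x) (u t)"
    from elim(1) obtain d1 where d1: "has_L2_divergence \<Omega> (m\<^sub>1 t) d1"
      and r1: "pairing \<Omega> (\<lambda>x. \<phi> x * \<rho>1' t x) (u t) + pairing \<Omega> d1 (u t) = pairing \<Omega> (f t) (u t) - ?P"
      using u[OF t] by blast
    from elim(2) obtain d2 where d2: "has_L2_divergence \<Omega> (m\<^sub>2 t) d2"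
      and r2: "pairing \<Omega> (\<lambda>x. \<phi> x * \<rho>2' t x) (u t) + pairing \<Omega> d2 (u t) = pairing \<Omega> (f t) (u t) - ?P"
      using u[OF t] by blast
    \<comment> \<open>The flux equation holds for every divergence of its test field. Choosing the
      difference of the two divergences that occur in the mass equations makes the density terms
      match exactly.\<close>
    define dv where "dv x = d1 x - d2 x" for x
    have dL: "d1 \<in> Lp_space \<Omega> 2" "d2 \<in> Lp_space \<Omega> 2"
      using d1 d2 by (auto simp: has_L2_divergence_def)
    have dvL: "dv \<in> Lp_space \<Omega> 2" unfolding dv_def by (rule L2_diff[OF dL])
    have dv: "has_L2_divergence \<Omega> (v t) dv"
      unfolding v_def dv_def
      by (rule has_L2_divergence_diff[OF \<Omega>_lmeasurable bounded_\<Omega> d1 fe_L2[OF m1[OF t]] d2 fe_L2[OF m2[OF t]]])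
    have p1: "pairing \<Omega> ?F1 (v t) - pairing \<Omega> (\<rho>\<^sub>1 t) dv = - pairing \<Omega> (grad (\<Psi> t)) (v t)"
      using elim(1) v[OF t] dv by blast
    have p2: "pairing \<Omega> ?F2 (v t) - pairing \<Omega> (\<rho>\<^sub>2 t) dv = - pairing \<Omega> (grad (\<Psi> t)) (v t)"
      using elim(2) v[OF t] dv by blast
    have F: "?F1 \<in> Lp_space \<Omega> 2"
      by (rule flux_L2[OF admissible_measurable[OF adm(1) t] elim(3) m1[OF t]])
    have F': "?F2 \<in> Lp_space \<Omega> 2"
      by (rule flux_L2[OF admissible_measurable[OF adm(2) t] elim(4) m2[OF t]])
    have "g t - b t \<le> pairing \<Omega> (\<lambda>x. ?F1 x - ?F2 x) (v t)"
      unfolding g_def b_def v_def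
      by (rule flux_difference_bound[OF admissible_measurable[OF adm(1) t] elim(3)
            admissible_measurable[OF adm(2) t] elim(4) m1[OF t] m2[OF t] elim(5)])
    also have "\<dots> = pairing \<Omega> ?F1 (v t) - pairing \<Omega> ?F2 (v t)"
      by (rule pairing_diff_left[OF F F' fe_L2[OF v[OF t]]])
    also have "\<dots> = pairing \<Omega> (u t) dv"
      using p1 p2 pairing_diff_left[OF \<rho>L[OF t] dvL] by (simp add: u_def[abs_def])
    also have "\<dots> = pairing \<Omega> d1 (u t) - pairing \<Omega> d2 (u t)"
      using pairing_diff_left[OF dL uL[OF t]] by (simp add: dv_def[abs_def] pairing_commute[of \<Omega> "u t"])
    also have "\<dots> = - (pairing \<Omega> (\<lambda>x. \<phi> x * \<rho>1' t x) (u t) - pairing \<Omega> (\<lambda>x. \<phi> x * \<rho>2' t x) (u t))"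
      using r1 r2 by simp
    also have "\<dots> = - pairing \<Omega> (\<lambda>x. \<phi> x * u' t x) (u t)"
      using pairing_diff_left[OF \<phi>_mult_L2[OF L'(1)] \<phi>_mult_L2[OF L'(2)] uL[OF t]]
      by (simp add: u'_def right_diff_distrib)
    finally show ?case by simp
  qed
  note ei = energy_inequality[OF \<Omega>_lmeasurable less_imp_le[OF T] u' u0i \<phi>_measurable \<phi>_abs
      gm g0 bi b0 ineq]
  have "(LINT x|M. \<phi> x * (u 0 x)\<^sup>2) \<le> 0"
    using weighted_square_bounds(2)[OF uL[of 0]] T u0 by simp
  moreover have "(LINT t|J. b t) \<le> B"
  proof -
    have "(LINT t|J. b t) = \<Lambda> * \<delta> powr (s / (s - 1)) * (T * vol + (LINT t|J. LINT x|M. norm (m\<^sub>2 t x) powr s))"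
      using bound(1) measure_J by (simp add: b_def mult.commute)
    also have "\<dots> \<le> \<Lambda> * \<delta> powr (s / (s - 1)) * (T * vol + K)"
      using bound(2) \<Lambda>_nonneg by (intro mult_left_mono add_left_mono) auto
    finally show ?thesis by (simp add: B ac_simps)
  qed
  ultimately have en: "(LINT x|M. \<phi> x * (u t x)\<^sup>2) / 2 + (LINT \<tau>|J. (if \<tau> \<le> t then g \<tau> else 0)) \<le> B"
    if "t \<in> {0..T}" for t
    using ei(2)[OF _ that] by fastforce
  have gi: "integrable J g" by (rule ei(1)) auto
  then show "integrable J (\<lambda>t. LINT x|M. norm (m\<^sub>1 t x - m\<^sub>2 t x) powr s)"
    using \<kappa>_pos by (simp add: g_def[abs_def] v_def)
  show "(LINT x|M. (\<rho>\<^sub>1 t x - \<rho>\<^sub>2 t x)\<^sup>2) \<le> 2 / \<phi>_lo * B" if t: "t \<in> {0..T}" for t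
  proof -
    have "0 \<le> (LINT \<tau>|J. (if \<tau> \<le> t then g \<tau> else 0))"
      using g0 by (intro integral_nonneg_AE) auto
    then have "\<phi>_lo * (LINT x|M. (u t x)\<^sup>2) \<le> 2 * B"
      using en[OF t] weighted_square_bounds(1)[OF uL[OF t]] by linarith
    then show ?thesis using \<phi>_lo by (simp add: u_def field_simps)
  qed
  have "0 \<le> \<phi>_lo * (LINT x|M. (u T x)\<^sup>2)" using \<phi>_lo by simp
  also have "\<dots> \<le> (LINT x|M. \<phi> x * (u T x)\<^sup>2)"
    using weighted_square_bounds(1)[OF uL[of T]] T by simp
  finally have "0 \<le> (LINT x|M. \<phi> x * (u T x)\<^sup>2)" .
  moreover have "(LINT \<tau>|J. (if \<tau> \<le> T then g \<tau> else 0)) = integral\<^sup>L J g"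
    by (intro Bochner_Integration.integral_cong) auto
  ultimately have "integral\<^sup>L J g \<le> B" using en[of T] T by simp
  then show "(LINT t|J. LINT x|M. norm (m\<^sub>1 t x - m\<^sub>2 t x) powr s) \<le> B / \<kappa>"
    using \<kappa>_pos by (simp add: g_def[abs_def] v_def field_simps)
qed

section \<open>From integrals to extended norms\<close>

lemma discrete_stability_enorm:
  assumes u\<^sub>0: "u\<^sub>0 \<in> Lp_space \<Omega> 2"
  obtains C where "0 < C"
    and "\<And>\<T> k a\<^sub>1 a\<^sub>2 m\<^sub>1 m\<^sub>2 \<rho>\<^sub>1 \<rho>\<^sub>2.
      admissible_coeff \<Omega> T N D b_hi a\<^sub>1 \<Longrightarrow> admissible_coeff \<Omega> T N D b_hi a\<^sub>2 \<Longrightarrow>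
      mixed_solution \<Omega> T N \<alpha> \<phi> f \<Psi> (fe_space \<Omega> \<T> k) (fe_space \<Omega> \<T> k) a\<^sub>1 m\<^sub>1 \<rho>\<^sub>1 \<Longrightarrow>
      mixed_solution \<Omega> T N \<alpha> \<phi> f \<Psi> (fe_space \<Omega> \<T> k) (fe_space \<Omega> \<T> k) a\<^sub>2 m\<^sub>2 \<rho>\<^sub>2 \<Longrightarrow>
      is_L2_projection \<Omega> (fe_space \<Omega> \<T> k) u\<^sub>0 (\<rho>\<^sub>1 0) \<Longrightarrow>
      is_L2_projection \<Omega> (fe_space \<Omega> \<T> k) u\<^sub>0 (\<rho>\<^sub>2 0) \<Longrightarrow>
      (time_Linf T (\<lambda>t. Lp_norm \<Omega> 2 (\<lambda>x. \<rho>\<^sub>1 t x - \<rho>\<^sub>2 t x)))\<^sup>2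
        + epow (time_Lp T s (\<lambda>t. Lp_norm \<Omega> s (\<lambda>x. m\<^sub>1 t x - m\<^sub>2 t x))) s
      \<le> ennreal C * epow (coeff_dist \<Omega> T N a\<^sub>1 a\<^sub>2) (s / (s - 1))"
proof -
  obtain K where K: "0 \<le> K"
    and apriori: "\<And>\<T> k a m \<rho>. admissible_coeff \<Omega> T N D b_hi a \<Longrightarrow>
      mixed_solution \<Omega> T N \<alpha> \<phi> f \<Psi> (fe_space \<Omega> \<T> k) (fe_space \<Omega> \<T> k) a m \<rho> \<Longrightarrow>
      is_L2_projection \<Omega> (fe_space \<Omega> \<T> k) u\<^sub>0 (\<rho> 0) \<Longrightarrow>
      integrable J (\<lambda>t. LINT x|M. norm (m t x) powr s) \<and>
      (LINT t|J. LINT x|M. norm (m t x) powr s) \<le> K"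
    by (rule discrete_a_priori_bound[OF u\<^sub>0]) (use that in blast)
  define E where "E = \<Lambda> * (T * vol + K)"
  \<comment> \<open>The summand 2 / \<phi>_lo comes from the density bound and 1 / \<kappa> from the
    flux bound; the added 1 makes \<open>C\<close> positive even if E = 0.\<close>
  define C where "C = 1 + (2 / \<phi>_lo + 1 / \<kappa>) * E"
  have E: "0 \<le> E" using \<Lambda>_nonneg vol_nonneg K T by (simp add: E_def)
  have C: "0 < C" using E \<phi>_lo \<kappa>_pos by (simp add: C_def add_pos_nonneg)
  show ?thesis
  proof (rule that[OF C])
    fix \<T> k a\<^sub>1 a\<^sub>2 m\<^sub>1 m\<^sub>2 \<rho>\<^sub>1 \<rho>\<^sub>2
    assume adm: "admissible_coeff \<Omega> T N D b_hi a\<^sub>1" "admissible_coeff \<Omega> T N D b_hi a\<^sub>2"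
      and sol: "mixed_solution \<Omega> T N \<alpha> \<phi> f \<Psi> (fe_space \<Omega> \<T> k) (fe_space \<Omega> \<T> k) a\<^sub>1 m\<^sub>1 \<rho>\<^sub>1"
        "mixed_solution \<Omega> T N \<alpha> \<phi> f \<Psi> (fe_space \<Omega> \<T> k) (fe_space \<Omega> \<T> k) a\<^sub>2 m\<^sub>2 \<rho>\<^sub>2"
      and proj: "is_L2_projection \<Omega> (fe_space \<Omega> \<T> k) u\<^sub>0 (\<rho>\<^sub>1 0)"
        "is_L2_projection \<Omega> (fe_space \<Omega> \<T> k) u\<^sub>0 (\<rho>\<^sub>2 0)"
    let ?d = "coeff_dist \<Omega> T N a\<^sub>1 a\<^sub>2"
    let ?lhs = "(time_Linf T (\<lambda>t. Lp_norm \<Omega> 2 (\<lambda>x. \<rho>\<^sub>1 t x - \<rho>\<^sub>2 t x)))\<^sup>2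
        + epow (time_Lp T s (\<lambda>t. Lp_norm \<Omega> s (\<lambda>x. m\<^sub>1 t x - m\<^sub>2 t x))) s"
    show "?lhs \<le> ennreal C * epow ?d (s / (s - 1))"
    \<comment> \<open>An infinite coefficient distance makes the right-hand side infinite because C
      > 0; otherwise the distance is a real number.\<close>
    proof (cases "?d = \<infinity>")
      case True
      then show ?thesis using C by (simp add: epow_def ennreal_mult_top)
    next
      case False
      define \<delta> where "\<delta> = enn2real ?d"
      have \<delta>0: "0 \<le> \<delta>" and d: "?d = ennreal \<delta>"
        using False by (simp_all add: \<delta>_def less_top)
      \<comment> \<open>Each essential supremum bounds its function almost everywhere, first in t
        and then in x; the Euclidean norm of the coefficient difference dominates every
        component.\<close>
      have "AE t in J. AE x in M. \<forall>i\<in>{-1..int N}. \<bar>a\<^sub>1 t x i - a\<^sub>2 t x i\<bar> \<le> \<delta>"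
        using esssup_AE[of "\<lambda>t. Linf_norm \<Omega> (\<lambda>x. L2_set (\<lambda>i. a\<^sub>1 t x i - a\<^sub>2 t x i) {-1..int N})" J]
      proof eventually_elim
        case (elim t)
        then have t: "Linf_norm \<Omega> (\<lambda>x. L2_set (\<lambda>i. a\<^sub>1 t x i - a\<^sub>2 t x i) {-1..int N}) \<le> ennreal \<delta>"
          using d by (simp add: coeff_dist_def time_Linf_def)
        show ?case
          using esssup_AE[of "\<lambda>x. ennreal (norm (L2_set (\<lambda>i. a\<^sub>1 t x i - a\<^sub>2 t x i) {-1..int N}))" M]
        proof eventually_elim
          case (elim x)
          then have "ennreal (norm (L2_set (\<lambda>i. a\<^sub>1 t x i - a\<^sub>2 t x i) {-1..int N})) \<le> ennreal \<delta>"
            using t unfolding Linf_norm_def by (rule order_trans)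
          then have le: "L2_set (\<lambda>i. a\<^sub>1 t x i - a\<^sub>2 t x i) {-1..int N} \<le> \<delta>"
            using \<delta>0 by (simp add: ennreal_le_iff)
          show ?case
          proof
            fix i assume i: "i \<in> {-1..int N}"
            have "L2_set (\<lambda>i. a\<^sub>1 t x i - a\<^sub>2 t x i) {i} \<le> L2_set (\<lambda>i. a\<^sub>1 t x i - a\<^sub>2 t x i) {-1..int N}"
              unfolding L2_set_def using i by (intro real_sqrt_le_mono sum_mono2) auto
            then show "\<bar>a\<^sub>1 t x i - a\<^sub>2 t x i\<bar> \<le> \<delta>" using le by (simp add: L2_set_def)
          qed
        qed
      qed
      note st = discrete_stability[OF adm sol u\<^sub>0 proj this
          conjunct1[OF apriori[OF adm(2) sol(2) proj(2)]] conjunct2[OF apriori[OF adm(2) sol(2) proj(2)]] refl,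
          folded E_def]
      define B where "B = E * \<delta> powr (s / (s - 1))"
      have B: "0 \<le> B" using E by (simp add: B_def)
      note st = st[folded B_def]
      have sm: "spacetime_measurable \<Omega> T (\<lambda>t x. \<rho>\<^sub>1 t x - \<rho>\<^sub>2 t x)"
          "spacetime_measurable \<Omega> T (\<lambda>t x. m\<^sub>1 t x - m\<^sub>2 t x)"
        and fe: "\<And>t. t \<in> {0..T} \<Longrightarrow> (\<lambda>x. \<rho>\<^sub>1 t x - \<rho>\<^sub>2 t x) \<in> fe_space \<Omega> \<T> k"
          "\<And>t. t \<in> {0..T} \<Longrightarrow> (\<lambda>x. m\<^sub>1 t x - m\<^sub>2 t x) \<in> fe_space \<Omega> \<T> k"
      proof -
        have "spacetime_measurable \<Omega> T \<rho>\<^sub>1" "spacetime_measurable \<Omega> T \<rho>\<^sub>2"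
          "spacetime_measurable \<Omega> T m\<^sub>1" "spacetime_measurable \<Omega> T m\<^sub>2"
          using sol by (auto simp: mixed_solution_def has_time_derivative_def)
        then show "spacetime_measurable \<Omega> T (\<lambda>t x. \<rho>\<^sub>1 t x - \<rho>\<^sub>2 t x)"
          "spacetime_measurable \<Omega> T (\<lambda>t x. m\<^sub>1 t x - m\<^sub>2 t x)"
          unfolding spacetime_measurable_def case_prod_beta' by measurable
        show "(\<lambda>x. \<rho>\<^sub>1 t x - \<rho>\<^sub>2 t x) \<in> fe_space \<Omega> \<T> k" "(\<lambda>x. m\<^sub>1 t x - m\<^sub>2 t x) \<in> fe_space \<Omega> \<T> k"
          if "t \<in> {0..T}" for t
          using sol that by (auto simp: mixed_solution_def intro!: fe_space_diff)
      qed
      have "time_Linf T (\<lambda>t. Lp_norm \<Omega> 2 (\<lambda>x. \<rho>\<^sub>1 t x - \<rho>\<^sub>2 t x)) \<le> ennreal (sqrt (2 / \<phi>_lo * B))"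
        unfolding time_Linf_def
      \<comment> \<open>Measurability in time matters here: by convention a non-measurable function
        has essential supremum \<open>top\<close>.\<close>
      proof (rule esssup_I[OF measurable_Lp_norm_in_time[OF \<Omega>_lmeasurable sm(1)]], rule AE_I2)
        fix t assume "t \<in> space J"
        then have t: "t \<in> {0..T}" by simp
        have i: "integrable M (\<lambda>x. (\<rho>\<^sub>1 t x - \<rho>\<^sub>2 t x)\<^sup>2)"
          using fe_L2[OF fe(1)[OF t]] by (simp add: Lp_space_2_iff)
        show "Lp_norm \<Omega> 2 (\<lambda>x. \<rho>\<^sub>1 t x - \<rho>\<^sub>2 t x) \<le> ennreal (sqrt (2 / \<phi>_lo * B))"
        proof (rule ennreal_power2_le_imp_le)
          have "(Lp_norm \<Omega> 2 (\<lambda>x. \<rho>\<^sub>1 t x - \<rho>\<^sub>2 t x))\<^sup>2 = ennreal (LINT x|M. (\<rho>\<^sub>1 t x - \<rho>\<^sub>2 t x)\<^sup>2)"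
            unfolding Lp_norm_2_real_power2 using i by (intro nn_integral_eq_integral) auto
          also have "\<dots> \<le> ennreal (2 / \<phi>_lo * B)" by (rule ennreal_leI[OF st(1)[OF t]])
          also have "\<dots> = (ennreal (sqrt (2 / \<phi>_lo * B)))\<^sup>2"
            using B \<phi>_lo by (simp add: ennreal_power)
          finally show "(Lp_norm \<Omega> 2 (\<lambda>x. \<rho>\<^sub>1 t x - \<rho>\<^sub>2 t x))\<^sup>2 \<le> (ennreal (sqrt (2 / \<phi>_lo * B)))\<^sup>2" .
        qed
      qed
      then have "(time_Linf T (\<lambda>t. Lp_norm \<Omega> 2 (\<lambda>x. \<rho>\<^sub>1 t x - \<rho>\<^sub>2 t x)))\<^sup>2
          \<le> (ennreal (sqrt (2 / \<phi>_lo * B)))\<^sup>2"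
        by (intro power_mono) auto
      also have "\<dots> = ennreal (2 / \<phi>_lo * B)"
        using B \<phi>_lo by (simp add: ennreal_power)
      finally have 1: "(time_Linf T (\<lambda>t. Lp_norm \<Omega> 2 (\<lambda>x. \<rho>\<^sub>1 t x - \<rho>\<^sub>2 t x)))\<^sup>2 \<le> ennreal (2 / \<phi>_lo * B)" .
      \<comment> \<open>The outer power s cancels the root of the norm in time, and the power inside
        that norm cancels the root of the norm in space, leaving a double integral.\<close>
      have "epow (time_Lp T s (\<lambda>t. Lp_norm \<Omega> s (\<lambda>x. m\<^sub>1 t x - m\<^sub>2 t x))) s
          = (\<integral>\<^sup>+t. epow (Lp_norm \<Omega> s (\<lambda>x. m\<^sub>1 t x - m\<^sub>2 t x)) s \<partial>J)"
        using s_gt_2 by (simp add: time_Lp_def Lp_enorm_def epow_epow)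
      also have "\<dots> = (\<integral>\<^sup>+t. ennreal (LINT x|M. norm (m\<^sub>1 t x - m\<^sub>2 t x) powr s) \<partial>J)"
      proof (rule nn_integral_cong)
        fix t assume "t \<in> space J"
        then have "integrable M (\<lambda>x. norm (m\<^sub>1 t x - m\<^sub>2 t x) powr s)"
          using fe_integrable_powr[OF fe(2)] by simp
        then show "epow (Lp_norm \<Omega> s (\<lambda>x. m\<^sub>1 t x - m\<^sub>2 t x)) s
            = ennreal (LINT x|M. norm (m\<^sub>1 t x - m\<^sub>2 t x) powr s)"
          using s_gt_2 by (simp add: epow_Lp_norm nn_integral_eq_integral)
      qed
      also have "\<dots> = ennreal (LINT t|J. LINT x|M. norm (m\<^sub>1 t x - m\<^sub>2 t x) powr s)"
        using st(2) by (intro nn_integral_eq_integral) auto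
      also have "\<dots> \<le> ennreal (B / \<kappa>)" by (rule ennreal_leI[OF st(3)])
      finally have "?lhs \<le> ennreal (2 / \<phi>_lo * B) + ennreal (B / \<kappa>)"
        using 1 by (intro add_mono)
      also have "\<dots> = ennreal ((2 / \<phi>_lo + 1 / \<kappa>) * E * \<delta> powr (s / (s - 1)))"
        using B \<phi>_lo \<kappa>_pos by (subst ennreal_plus[symmetric]) (auto simp: B_def algebra_simps)
      also have "\<dots> \<le> ennreal (C * \<delta> powr (s / (s - 1)))"
        by (intro ennreal_leI mult_right_mono) (auto simp: C_def)
      also have "\<dots> = ennreal C * epow ?d (s / (s - 1))"
        using C \<delta>0 by (simp add: d epow_ennreal ennreal_mult)
      finally show ?thesis .
    qed
  qed
qed

end

theorem theorem6p2:
  fixes \<Omega> :: "'a::euclidean_space set" and T \<alpha>' s s' a_lo a_hi b_hi \<phi>_lo \<phi>_hi :: real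
    and N k :: nat and \<alpha> :: "int \<Rightarrow> real" and D :: "(int \<Rightarrow> real) set"
    and \<phi> \<rho>\<^sub>0 :: "'a \<Rightarrow> real" and f \<psi> \<Psi> :: "real \<Rightarrow> 'a \<Rightarrow> real"
    and H :: "real set" and \<T> :: "real \<Rightarrow> 'a set set"
  assumes "DIM('a) \<ge> 2" and "open \<Omega>" and "bounded \<Omega>" and "C1_boundary \<Omega>" and "T > 0"
    and "N \<ge> 1" and "0 < \<alpha>'" and "\<alpha>' < 1" and "\<alpha> (-1) = - \<alpha>'" and "\<alpha> 0 = 0"
    and "strict_mono_on {0..int N} \<alpha>"
    and "s = \<alpha> (int N) + 2" and "s' = s / (s - 1)"
    and "0 < a_lo" and "a_lo \<le> a_hi" and "compact D" and "D \<subseteq> coeff_box N a_lo a_hi"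
    and "\<phi> \<in> borel_measurable (lebesgue_on \<Omega>)"
    and "0 < \<phi>_lo" and "\<And>x. x \<in> \<Omega> \<Longrightarrow> \<phi>_lo \<le> \<phi> x \<and> \<phi> x \<le> \<phi>_hi"
    and "spacetime_measurable \<Omega> T f" and "time_Linf T (\<lambda>t. Lp_norm \<Omega> 2 (f t)) < \<infinity>"
    and "C12 \<Omega> T \<psi>" and "C12 \<Omega> T \<Psi>"
    and "\<And>t x. t \<in> {0..T} \<Longrightarrow> x \<in> frontier \<Omega> \<Longrightarrow> \<Psi> t x = \<psi> t x"
    and "\<rho>\<^sub>0 \<in> Lp_space \<Omega> 2"
    and "quasi_uniform_family \<Omega> H \<T>"
  shows "\<exists>C>0. \<forall>h\<in>H. \<forall>a m\<^sub>h \<rho>\<^sub>h m \<rho>.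
    (\<forall>i\<in>{1, 2 :: nat}.
       admissible_coeff \<Omega> T N D b_hi (a i) \<and>
       mixed_solution \<Omega> T N \<alpha> \<phi> f \<Psi> (fe_space \<Omega> (\<T> h) k) (fe_space \<Omega> (\<T> h) k) (a i) (m\<^sub>h i) (\<rho>\<^sub>h i) \<and>
       is_L2_projection \<Omega> (fe_space \<Omega> (\<T> h) k) (\<lambda>x. \<rho>\<^sub>0 x - \<Psi> 0 x) (\<rho>\<^sub>h i 0) \<and>
       mixed_solution \<Omega> T N \<alpha> \<phi> f \<Psi> (V_space \<Omega> s) (Lp_space \<Omega> 2) (a i) (m i) (\<rho> i) \<and>
       (AE x in lebesgue_on \<Omega>. \<rho> i 0 x = \<rho>\<^sub>0 x - \<Psi> 0 x) \<and>
       (\<exists>\<rho>'. has_time_derivative \<Omega> T (\<lambda>t x. \<rho> i t x + \<Psi> t x) \<rho>' \<and>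
          time_Lp T 2 (\<lambda>t. Lp_norm \<Omega> 2 (\<rho>' t)) < \<infinity>))
    \<longrightarrow>
      (time_Linf T (\<lambda>t. Lp_norm \<Omega> 2 (\<lambda>x. \<rho>\<^sub>h 1 t x - \<rho>\<^sub>h 2 t x)))\<^sup>2
        + epow (time_Lp T s (\<lambda>t. Lp_norm \<Omega> s (\<lambda>x. m\<^sub>h 1 t x - m\<^sub>h 2 t x))) s
      \<le> ennreal C * (ennreal (h powr (s' * (1 - \<alpha>'))) + epow (coeff_dist \<Omega> T N (a 1) (a 2)) s')"
proof -
  interpret forchheimer_data N \<alpha> \<alpha>' s \<Omega> T a_lo a_hi b_hi \<phi>_lo \<phi>_hi D \<phi> f \<Psi>
    by unfold_locales (fact assms)+
  have "\<Psi> 0 \<in> Lp_space \<Omega> 2"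
    by (rule C12_bounds[OF open_\<Omega> bounded_\<Omega> T \<Psi>]) (use T in auto)
  with \<open>\<rho>\<^sub>0 \<in> Lp_space \<Omega> 2\<close> have u0: "(\<lambda>x. \<rho>\<^sub>0 x - \<Psi> 0 x) \<in> Lp_space \<Omega> 2"
    by (rule L2_diff)
  obtain C where C: "0 < C"
    and stab: "\<And>\<T> k a\<^sub>1 a\<^sub>2 m\<^sub>1 m\<^sub>2 \<rho>\<^sub>1 \<rho>\<^sub>2.
      admissible_coeff \<Omega> T N D b_hi a\<^sub>1 \<Longrightarrow> admissible_coeff \<Omega> T N D b_hi a\<^sub>2 \<Longrightarrow>
      mixed_solution \<Omega> T N \<alpha> \<phi> f \<Psi> (fe_space \<Omega> \<T> k) (fe_space \<Omega> \<T> k) a\<^sub>1 m\<^sub>1 \<rho>\<^sub>1 \<Longrightarrow>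
      mixed_solution \<Omega> T N \<alpha> \<phi> f \<Psi> (fe_space \<Omega> \<T> k) (fe_space \<Omega> \<T> k) a\<^sub>2 m\<^sub>2 \<rho>\<^sub>2 \<Longrightarrow>
      is_L2_projection \<Omega> (fe_space \<Omega> \<T> k) (\<lambda>x. \<rho>\<^sub>0 x - \<Psi> 0 x) (\<rho>\<^sub>1 0) \<Longrightarrow>
      is_L2_projection \<Omega> (fe_space \<Omega> \<T> k) (\<lambda>x. \<rho>\<^sub>0 x - \<Psi> 0 x) (\<rho>\<^sub>2 0) \<Longrightarrow>
      (time_Linf T (\<lambda>t. Lp_norm \<Omega> 2 (\<lambda>x. \<rho>\<^sub>1 t x - \<rho>\<^sub>2 t x)))\<^sup>2
        + epow (time_Lp T s (\<lambda>t. Lp_norm \<Omega> s (\<lambda>x. m\<^sub>1 t x - m\<^sub>2 t x))) s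
      \<le> ennreal C * epow (coeff_dist \<Omega> T N a\<^sub>1 a\<^sub>2) (s / (s - 1))"
    by (rule discrete_stability_enorm[OF u0]) (use that in blast)
  show ?thesis
    unfolding \<open>s' = s / (s - 1)\<close>
  proof (intro exI[of _ C] conjI C ballI allI impI, goal_cases)
    case (1 h a m\<^sub>h \<rho>\<^sub>h m \<rho>)
    have "(time_Linf T (\<lambda>t. Lp_norm \<Omega> 2 (\<lambda>x. \<rho>\<^sub>h 1 t x - \<rho>\<^sub>h 2 t x)))\<^sup>2
        + epow (time_Lp T s (\<lambda>t. Lp_norm \<Omega> s (\<lambda>x. m\<^sub>h 1 t x - m\<^sub>h 2 t x))) s
      \<le> ennreal C * epow (coeff_dist \<Omega> T N (a 1) (a 2)) (s / (s - 1))"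
      by (rule stab[where \<T> = "\<T> h" and k = k]) (use 1(2) in auto)
    also have "\<dots> \<le> ennreal C * (ennreal (h powr (s / (s - 1) * (1 - \<alpha>')))
        + epow (coeff_dist \<Omega> T N (a 1) (a 2)) (s / (s - 1)))"
      by (intro mult_left_mono add_increasing) auto
    finally show ?case .
  qed
qed

end
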